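(* Let $T_1,\ldots,T_n$ be commuting contractions on a complex Hilbert space $\mathcal{H}$ and let $T=\prod_{j=1}^n T_j$. (a) If $\widetilde{\mathcal{K}}_0$ is a minimal unitary dilation space for $T$, then $(T_1,\ldots,T_n)$ possesses a unitary dilation $(W_1,\ldots,W_n)$ on $\widetilde{\mathcal{K}}_0$ with $W=\prod_{i=1}^n W_i$ being the minimal unitary dilation of $T$ if and only if there exist unique projections $P_1,\ldots,P_n$ and unique commuting unitaries $U_1,\ldots,U_n$ in $\mathcal{B}(\mathcal{D}_T)$ with $\prod_{i=1}^n U_i=I$ such that the following hold for all $i,j=1,\ldots,n$: (1) $D_TT_i=P_i^{\perp}U_i^*D_T+P_iU_i^*D_TT$; (2) $P_i^{\perp}U_i^*P_j^{\perp}U_j^*=P_j^{\perp}U_j^*P_i^{\perp}U_i^*$; (3) $U_iP_iU_jP_j=U_jP_jU_iP_i$; (4) $D_TU_iP_iU_i^*D_T=D_{T_i}^2$; (5) $P_1+U_1^*P_2U_1+U_1^*U_2^*P_3U_2U_1+\cdots+U_1^*U_2^*\cdots U_{n-1}^*P_nU_{n-1}\cdots U_2U_1=I_{\mathcal{D}_T}$. (b) Such a unitary dilation is minimal, and it is unique in the sense that if $(X_1,\ldots,X_n)$ on $\widetilde{\mathcal{K}}_1$ is another unitary dilation of $(T_1,\ldots,T_n)$ such that the product $X=\prod_{i=1}^n X_i$ is a minimal unitary dilation of $T$, then there is a unitary $\rho:\widetilde{\mathcal{K}}_0\to\widetilde{\mathcal{K}}_1$ such that $(X_1,\ldots,X_n)=(\rho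 W_1\rho^*,\ldots,\rho W_n\rho^* )$.
   Context: All operators are bounded linear operators on complex Hilbert spaces; a contraction is an operator of norm at most $1$. Projections are orthogonal projections, and $P^{\perp}=I-P$. For a contraction $A$ on $\mathcal{H}$, $D_A=(I-A^*A)^{1/2}$ and $\mathcal{D}_A=\overline{\mathrm{Ran}}\,D_A$ (closure of the range); where appropriate, $D_A$ is regarded as an operator from $\mathcal{H}$ into $\mathcal{D}_A$. Unitary dilation: a commuting tuple of unitaries $(W_1,\ldots,W_n)$ on a Hilbert space $\mathcal{K}'$ is a unitary dilation of a commuting tuple of contractions $(T_1,\ldots,T_n)$ on $\mathcal{H}$ if $\mathcal{H}$ can be realized as a closed linear subspace of $\mathcal{K}'$ and $T_1^{k_1}\cdots T_n^{k_n}=P_{\mathcal{H}}(W_1^{k_1}\cdots W_n^{k_n})|_{\mathcal{H}}$ for all non-negative integers $k_1,\ldots,k_n$, where $P_{\mathcal{H}}:\mathcal{K}'\to\mathcal{H}$ is the orthogonal projection. It is minimal if $\mathcal{K}'=\overline{\mathrm{Span}}\{W_1^{t_1}\cdots W_n^{t_n}h : h\in\mathcal{H},\ t_1,\ldots,t_n\in\mathbb{Z}\}$. For a single contraction $T$ this is the case $n=1$; a minimal unitary dilation of $T$ exists and is unique up to unitary equivalence, and the space on which it acts is called a minimal unitary dilation space of $T$. *)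

theory Defs
  imports "HOL-Analysis.Analysis"
begin

section \<open>Complex Hilbert spaces\<close>

class scaleC =
  fixes scaleC :: "complex \<Rightarrow> 'a \<Rightarrow> 'a"  (infixr "*\<^sub>C" 75)

class complex_vector = real_vector + scaleC +
  assumes scaleC_add_right: "a *\<^sub>C (x + y) = a *\<^sub>C x + a *\<^sub>C y"
    and scaleC_add_left: "(a + b) *\<^sub>C x = a *\<^sub>C x + b *\<^sub>C x"
    and scaleC_scaleC: "a *\<^sub>C (b *\<^sub>C x) = (a * b) *\<^sub>C x"
    and scaleC_one: "1 *\<^sub>C x = x"
    and scaleR_scaleC: "r *\<^sub>R x = complex_of_real r *\<^sub>C x"

text \<open>The inner product is linear in the first argument and conjugate-linear in the second.\<close>

class complex_inner = complex_vector + real_normed_vector +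
  fixes cinner :: "'a \<Rightarrow> 'a \<Rightarrow> complex"
  assumes cinner_commute: "cinner x y = cnj (cinner y x)"
    and cinner_add_left: "cinner (x + y) z = cinner x z + cinner y z"
    and cinner_scaleC_left: "cinner (a *\<^sub>C x) y = a * cinner x y"
    and cinner_self: "cinner x x = complex_of_real ((norm x)\<^sup>2)"

class chilbert_space = complex_inner + complete_space

subclass (in chilbert_space) banach ..

global_interpretation complex_vector: vector_space "scaleC :: complex \<Rightarrow> 'a \<Rightarrow> 'a::complex_vector"
  by standard (simp_all add: scaleC_add_right scaleC_add_left scaleC_scaleC scaleC_one)

section \<open>Bounded operators between closed subspaces\<close>

text \<open>
  An operator between closed subspaces \<open>M\<close> and \<open>N\<close> is a function that is extensional on \<open>M\<close>
  (it takes the value \<open>undefined\<close> off \<open>M\<close>), so that equality in \<open>bounded_ops M N\<close> is equality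
  of operators from \<open>M\<close> to \<open>N\<close>.  Whole spaces are the case \<open>UNIV\<close>, where extensionality is void.
\<close>

definition bounded_ops ::
    "'a::chilbert_space set \<Rightarrow> 'b::chilbert_space set \<Rightarrow> ('a \<Rightarrow> 'b) set" where
  "bounded_ops M N = {f \<in> M \<rightarrow>\<^sub>E N.
     (\<forall>x\<in>M. \<forall>y\<in>M. f (x + y) = f x + f y) \<and>
     (\<forall>c. \<forall>x\<in>M. f (c *\<^sub>C x) = c *\<^sub>C f x) \<and>
     (\<exists>B. \<forall>x\<in>M. norm (f x) \<le> B * norm x)}"

definition adj ::
    "'a::chilbert_space set \<Rightarrow> 'b::chilbert_space set \<Rightarrow> ('a \<Rightarrow> 'b) \<Rightarrow> 'b \<Rightarrow> 'a" where
  "adj M N f = (\<lambda>y\<in>N. THE x. x \<in> M \<and> (\<forall>z\<in>M. cinner (f z) y = cinner z x))"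

definition contraction :: "('a::chilbert_space \<Rightarrow> 'a) \<Rightarrow> bool" where
  "contraction A \<longleftrightarrow> A \<in> bounded_ops UNIV UNIV \<and> onorm A \<le> 1"

definition unitary ::
    "'a::chilbert_space set \<Rightarrow> 'b::chilbert_space set \<Rightarrow> ('a \<Rightarrow> 'b) \<Rightarrow> bool" where
  "unitary M N U \<longleftrightarrow> U \<in> bounded_ops M N \<and>
     (\<forall>x\<in>M. adj M N U (U x) = x) \<and> (\<forall>y\<in>N. U (adj M N U y) = y)"

definition projection :: "'a::chilbert_space set \<Rightarrow> ('a \<Rightarrow> 'a) \<Rightarrow> bool" where
  "projection M P \<longleftrightarrow> P \<in> bounded_ops M M \<and> (\<forall>x\<in>M. P (P x) = P x) \<and> adj M M P = P"

definition perp :: "('a::chilbert_space \<Rightarrow> 'a) \<Rightarrow> 'a \<Rightarrow> 'a" where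
  "perp P x = x - P x"

definition orth_proj :: "'a::chilbert_space set \<Rightarrow> 'a \<Rightarrow> 'a" where
  "orth_proj M x = (THE y. y \<in> M \<and> (\<forall>z\<in>M. cinner (x - y) z = 0))"

definition positive_op :: "('a::chilbert_space \<Rightarrow> 'a) \<Rightarrow> bool" where
  "positive_op S \<longleftrightarrow> S \<in> bounded_ops UNIV UNIV \<and> (\<forall>x. cinner (S x) x \<in> \<real>\<^sub>\<ge>\<^sub>0)"

definition sqrt_op :: "('a::chilbert_space \<Rightarrow> 'a) \<Rightarrow> 'a \<Rightarrow> 'a" where
  "sqrt_op A = (THE S. positive_op S \<and> S \<circ> S = A)"

definition defect :: "('a::chilbert_space \<Rightarrow> 'a) \<Rightarrow> 'a \<Rightarrow> 'a" where
  "defect A = sqrt_op (\<lambda>x. x - adj UNIV UNIV A (A x))"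

definition defect_space :: "('a::chilbert_space \<Rightarrow> 'a) \<Rightarrow> 'a set" where
  "defect_space A = closure (range (defect A))"

section \<open>Tuples of operators\<close>

text \<open>
  An \<open>n\<close>-tuple of operators is a function on \<open>nat\<close> of which only the values at \<open>1, \<dots>, n\<close> matter.
  \<open>op_prod A [j\<^sub>1, \<dots>, j\<^sub>m]\<close> is the operator product of \<open>A j\<^sub>1, \<dots>, A j\<^sub>m\<close> in this order, so that
  \<open>A j\<^sub>m\<close> is applied first.
\<close>

definition op_prod :: "(nat \<Rightarrow> 'a \<Rightarrow> 'a) \<Rightarrow> nat list \<Rightarrow> 'a \<Rightarrow> 'a" where
  "op_prod A js = foldr (\<lambda>j g. A j \<circ> g) js id"

abbreviation tuple_prod :: "nat \<Rightarrow> (nat \<Rightarrow> 'a \<Rightarrow> 'a) \<Rightarrow> 'a \<Rightarrow> 'a" where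
  "tuple_prod n A \<equiv> op_prod A [1..<Suc n]"

definition commuting :: "'a set \<Rightarrow> nat \<Rightarrow> (nat \<Rightarrow> 'a \<Rightarrow> 'a) \<Rightarrow> bool" where
  "commuting M n A \<longleftrightarrow> (\<forall>i\<in>{1..n}. \<forall>j\<in>{1..n}. \<forall>x\<in>M. A i (A j x) = A j (A i x))"

definition int_pow :: "('a \<Rightarrow> 'a) \<Rightarrow> int \<Rightarrow> 'a \<Rightarrow> 'a" where
  "int_pow W t = (if t \<ge> 0 then W ^^ nat t else inv W ^^ nat (- t))"

section \<open>Unitary dilations\<close>

text \<open>The map \<open>J\<close> realizes the Hilbert space \<open>'h\<close> as the closed linear subspace \<open>range J\<close> of \<open>'k\<close>.\<close>

definition isometric_embedding :: "('h::chilbert_space \<Rightarrow> 'k::chilbert_space) \<Rightarrow> bool" where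
  "isometric_embedding J \<longleftrightarrow> J \<in> bounded_ops UNIV UNIV \<and> (\<forall>h. norm (J h) = norm h)"

definition unitary_dilation ::
    "('h::chilbert_space \<Rightarrow> 'k::chilbert_space) \<Rightarrow> nat \<Rightarrow>
     (nat \<Rightarrow> 'k \<Rightarrow> 'k) \<Rightarrow> (nat \<Rightarrow> 'h \<Rightarrow> 'h) \<Rightarrow> bool" where
  "unitary_dilation J n W T \<longleftrightarrow>
     isometric_embedding J \<and>
     (\<forall>i\<in>{1..n}. unitary UNIV UNIV (W i)) \<and> commuting UNIV n W \<and>
     (\<forall>k :: nat \<Rightarrow> nat. \<forall>h.
        J (tuple_prod n (\<lambda>i. T i ^^ k i) h) =
        orth_proj (range J) (tuple_prod n (\<lambda>i. W i ^^ k i) (J h)))"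

definition minimal_unitary_dilation ::
    "('h::chilbert_space \<Rightarrow> 'k::chilbert_space) \<Rightarrow> nat \<Rightarrow>
     (nat \<Rightarrow> 'k \<Rightarrow> 'k) \<Rightarrow> (nat \<Rightarrow> 'h \<Rightarrow> 'h) \<Rightarrow> bool" where
  "minimal_unitary_dilation J n W T \<longleftrightarrow>
     unitary_dilation J n W T \<and>
     closure (complex_vector.span
       {tuple_prod n (\<lambda>i. int_pow (W i) (t i)) (J h) | (t :: nat \<Rightarrow> int) h. True}) = UNIV"

abbreviation minimal_unitary_dilation_single ::
    "('h::chilbert_space \<Rightarrow> 'k::chilbert_space) \<Rightarrow> ('k \<Rightarrow> 'k) \<Rightarrow> ('h \<Rightarrow> 'h) \<Rightarrow> bool" where
  "minimal_unitary_dilation_single J V A \<equiv> minimal_unitary_dilation J 1 (\<lambda>_. V) (\<lambda>_. A)"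

end

theory Submission
  imports Defs
begin

text \<open>
  Let \<open>V\<close> be a minimal unitary dilation of the product \<open>T\<close>, and let \<open>D\<close> be the defect operator of
  \<open>T\<close>. Since \<open>\<parallel>V h - T h\<parallel> = \<parallel>D h\<parallel>\<close>, there is an isometry \<open>\<Lambda>\<close> (\<open>Lam\<close> below) of the defect space onto
  the wandering subspace \<open>\<L>\<close>, the closure of \<open>(V - T) H\<close>, with \<open>\<Lambda> D h = V h - T h\<close>. The
  subspaces \<open>V\<^sup>k \<L>\<close> are pairwise orthogonal, so that on their span \<open>V\<close> is a bilateral shift. A unitary that
  commutes with \<open>V\<close> acts there as multiplication by an operator valued function of the shift
  variable \<open>z\<close>; the theorem says which functions the factors \<open>W\<^sub>i\<close> of \<open>V\<close> give.

  Let \<open>V = R R'\<close> with commuting unitaries \<open>R\<close> and \<open>R'\<close> that dilate commuting operators \<open>S\<close> and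
  \<open>S'\<close>. The inner products \<open>\<langle>R V\<^sup>k h, V\<^sup>l h'\<rangle>\<close> are determined by \<open>S\<close> and \<open>S'\<close> alone: for
  \<open>k \<ge> l\<close> by the dilation property of \<open>R\<close>, and for \<open>k < l\<close> by that of \<open>R'\<close>, because
  \<open>R\<^sup>* V = R'\<close> (\<open>fp_moment\<close>). As the vectors \<open>V\<^sup>k h\<close> span a dense subspace, this proves the uniqueness
  statement (b) (\<open>factor_pair_transport\<close>). The same inner products show that \<open>R h - S h\<close> lies in \<open>\<L>\<close>,
  and hence that \<open>R\<close> acts on \<open>\<L>\<close> as a polynomial \<open>A + z B\<close> of degree at most one
  (\<open>factor_on_J\<close>, \<open>factor_on_Lam\<close>). Comparing coefficients in \<open>R\<^sup>* R = I\<close> and in the corresponding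
  identity for \<open>R'\<close>, which acts as \<open>B\<^sup>* + z A\<^sup>*\<close>, one finds that \<open>A + B = U\<^sup>*\<close> is unitary, that
  \<open>B B\<^sup>* = P\<close> is a projection, and that \<open>A = P\<^sup>\<bottom> U\<^sup>*\<close> and \<open>B = P U\<^sup>*\<close>.

  Applied to \<open>R = W\<^sub>i\<close>, this gives the projections \<open>P\<^sub>i\<close> and the unitaries \<open>U\<^sub>i\<close>. Condition (1)
  describes \<open>W\<^sub>i\<close> on \<open>(V - T) H\<close>, condition (4) says that \<open>W\<^sub>i\<close> is isometric on \<open>H\<close>, conditions
  (2) and (3) compare the coefficients in \<open>W\<^sub>i W\<^sub>j = W\<^sub>j W\<^sub>i\<close>, and condition (5) is the coefficient of
  \<open>z\<close> in \<open>W\<^sub>1 \<cdots> W\<^sub>n = V\<close>, computed from the partial products \<open>W\<^sub>1 \<cdots> W\<^sub>k\<close>, which are also factors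
  of \<open>V\<close> (\<open>factor_data_of_dilation\<close>).

  Conversely, (1) and (4) are what is needed for the prescription
  \<open>V\<^sup>k h \<mapsto> V\<^sup>k (T\<^sub>i h + \<Lambda> B\<^sub>i D h)\<close> to extend to an isometry \<open>W\<^sub>i\<close> (\<open>factor_lift\<close>). Conditions
  (2) and (3) make the \<open>W\<^sub>i\<close> commute (\<open>W_comm\<close>). By (5) the conjugated projections
  \<open>U\<^sub>1\<^sup>* \<cdots> P\<^sub>k \<cdots> U\<^sub>1\<close> are mutually orthogonal, so that the product of the \<open>W\<^sub>i\<close> is \<open>V\<close>
  (\<open>W_prod\<close>), which also makes each \<open>W\<^sub>i\<close> surjective. Since the \<open>W\<^sub>i\<close> are determined by the \<open>T\<^sub>i\<close> and in turn
  determine \<open>P\<^sub>i\<close> and \<open>U\<^sub>i\<close>, the latter are unique (\<open>factor_data_unique\<close>).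

  Defect operators are square roots of \<open>I - A\<^sup>* A\<close>; that these exist and are unique, the
  representation theorem behind adjoints, and the extension of isometries from spanning families are
  proved first.
\<close>

section \<open>Complex inner products\<close>

abbreviation csubspace :: "'a::complex_vector set \<Rightarrow> bool"
  where "csubspace \<equiv> complex_vector.subspace"

abbreviation cspan :: "'a::complex_vector set \<Rightarrow> 'a set"
  where "cspan \<equiv> complex_vector.span"

lemma cinner_add_right: "cinner x (y + z) = cinner x y + cinner (x::'a::complex_inner) z"
  by (metis cinner_add_left cinner_commute complex_cnj_add)

lemma cinner_scaleC_right: "cinner x (a *\<^sub>C y) = cnj a * cinner (x::'a::complex_inner) y"
  by (metis cinner_commute cinner_scaleC_left complex_cnj_mult)

lemma cinner_minus_left: "cinner (- x) y = - cinner (x::'a::complex_inner) y"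
  using cinner_scaleC_left[of "-1" x y] by simp

lemma cinner_minus_right: "cinner x (- y) = - cinner (x::'a::complex_inner) y"
  using cinner_scaleC_right[of x "-1" y] by simp

lemma cinner_diff_left: "cinner (x - y) z = cinner x z - cinner (y::'a::complex_inner) z"
  by (metis cinner_add_left cinner_minus_left diff_conv_add_uminus)

lemma cinner_diff_right: "cinner x (y - z) = cinner x y - cinner (x::'a::complex_inner) z"
  by (metis cinner_add_right cinner_minus_right diff_conv_add_uminus)

lemma cinner_zero_left [simp]: "cinner 0 (x::'a::complex_inner) = 0"
  using cinner_diff_left[of x x x] by simp

lemma cinner_zero_right [simp]: "cinner (x::'a::complex_inner) 0 = 0"
  using cinner_diff_right[of x x x] by simp

lemma cinner_scaleR_left: "cinner (r *\<^sub>R x) y = of_real r * cinner (x::'a::complex_inner) y"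
  by (simp add: scaleR_scaleC cinner_scaleC_left)

lemma cinner_scaleR_right: "cinner x (r *\<^sub>R y) = of_real r * cinner (x::'a::complex_inner) y"
  by (simp add: scaleR_scaleC cinner_scaleC_right)

lemmas cinner_simps = cinner_add_left cinner_add_right cinner_diff_left cinner_diff_right
  cinner_scaleC_left cinner_scaleC_right cinner_minus_left cinner_minus_right
  cinner_scaleR_left cinner_scaleR_right

lemma cinner_self_eq_0 [simp]: "cinner x x = 0 \<longleftrightarrow> (x::'a::complex_inner) = 0"
  by (simp add: cinner_self)

lemma norm_eqI: "cinner x x = cinner y y \<Longrightarrow> norm (x::'a::complex_inner) = norm (y::'b::complex_inner)"
  unfolding cinner_self of_real_eq_iff by (simp add: power2_eq_iff_nonneg)

lemma norm_scaleC: "norm (a *\<^sub>C x) = cmod a * norm (x::'a::complex_inner)"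
proof -
  have "complex_of_real ((norm (a *\<^sub>C x))\<^sup>2) = complex_of_real ((cmod a * norm x)\<^sup>2)"
    unfolding cinner_self[symmetric, of "a *\<^sub>C x"] cinner_scaleC_left cinner_scaleC_right cinner_self[of x]
    by (simp add: complex_norm_square power_mult_distrib ac_simps del: of_real_power)
  then have "(norm (a *\<^sub>C x))\<^sup>2 = (cmod a * norm x)\<^sup>2" using of_real_eq_iff by blast
  then show ?thesis by (rule power2_eq_imp_eq) auto
qed

lemma bounded_linear_scaleC: "bounded_linear (\<lambda>z::'a::complex_inner. c *\<^sub>C z)"
  by (rule bounded_linear_intro[of _ "cmod c"])
     (auto simp: scaleC_add_right scaleR_scaleC ac_simps norm_scaleC)

lemma norm_add_square:
  "(norm (x + y))\<^sup>2 = (norm x)\<^sup>2 + 2 * Re (cinner x y) + (norm (y::'a::complex_inner))\<^sup>2"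
proof -
  have "complex_of_real ((norm (x + y))\<^sup>2)
      = of_real ((norm x)\<^sup>2) + (cinner x y + cnj (cinner x y)) + of_real ((norm y)\<^sup>2)"
    unfolding cinner_self[symmetric] by (simp add: cinner_simps flip: cinner_commute)
  then have "Re (complex_of_real ((norm (x + y))\<^sup>2))
      = Re (of_real ((norm x)\<^sup>2) + (cinner x y + cnj (cinner x y)) + of_real ((norm y)\<^sup>2))" by simp
  then show ?thesis by simp
qed

lemma norm_diff_square:
  "(norm (x - y))\<^sup>2 = (norm x)\<^sup>2 - 2 * Re (cinner x y) + (norm (y::'a::complex_inner))\<^sup>2"
  using norm_add_square[of x "- y"] by (simp add: cinner_minus_right)

text \<open>
  Expanding \<open>\<parallel>x - c y\<parallel>\<^sup>2 \<ge> 0\<close> for the value of \<open>c\<close> at which \<open>c y\<close> is the projection of \<open>x\<close> onto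
  the line of \<open>y\<close> gives the Cauchy-Schwarz inequality.
\<close>

lemma norm_cinner_le: "cmod (cinner x y) \<le> norm x * norm (y::'a::complex_inner)"
proof (cases "y = 0")
  case False
  define c where "c = cinner x y / of_real ((norm y)\<^sup>2)"
  have ny: "(norm y)\<^sup>2 > 0" using False by simp
  have cc: "c * cnj (cinner x y) = of_real ((cmod (cinner x y))\<^sup>2 / (norm y)\<^sup>2)"
    unfolding c_def by (simp add: complex_norm_square del: of_real_power)
  have "Re (cinner x (c *\<^sub>C y)) = (cmod (cinner x y))\<^sup>2 / (norm y)\<^sup>2"
  proof -
    have "cinner x (c *\<^sub>C y) = cnj (c * cnj (cinner x y))" by (simp add: cinner_simps)
    then show ?thesis unfolding cc by simp
  qed
  moreover have "(norm (c *\<^sub>C y))\<^sup>2 = (cmod (cinner x y))\<^sup>2 / (norm y)\<^sup>2"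
    using False by (simp add: norm_scaleC c_def norm_divide power_mult_distrib power_divide norm_power norm_mult field_simps power2_eq_square)
  ultimately have "0 \<le> (norm x)\<^sup>2 - (cmod (cinner x y))\<^sup>2 / (norm y)\<^sup>2"
    using norm_diff_square[of x "c *\<^sub>C y"] by (smt (verit) zero_le_power2)
  then have "(cmod (cinner x y))\<^sup>2 \<le> (norm x * norm y)\<^sup>2"
    using ny by (simp add: field_simps power_mult_distrib)
  then show ?thesis by (rule power2_le_imp_le) auto
qed simp

lemma bounded_bilinear_cinner: "bounded_bilinear (cinner :: 'a::complex_inner \<Rightarrow> 'a \<Rightarrow> complex)"
proof
  show "\<exists>K. \<forall>a b. norm (cinner a b :: complex) \<le> norm (a::'a) * norm b * K"
    by (rule exI[of _ 1]) (simp add: norm_cinner_le)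
qed (simp_all add: cinner_simps scaleR_conv_of_real)

lemmas tendsto_cinner = bounded_bilinear.tendsto[OF bounded_bilinear_cinner]

lemma cinner_ext:
  assumes M: "csubspace M" and "x \<in> M" "y \<in> M"
    and eq: "\<And>z. z \<in> M \<Longrightarrow> cinner z x = cinner z (y::'a::complex_inner)"
  shows "x = y"
proof -
  have "x - y \<in> M" using M assms(2,3) complex_vector.subspace_diff by blast
  then have "cinner (x - y) (x - y) = 0" using eq by (simp add: cinner_diff_right)
  then show ?thesis by simp
qed

lemma cinner_eqI: "(\<And>z. cinner z x = cinner z (y::'a::complex_inner)) \<Longrightarrow> x = y"
  using cinner_ext[of UNIV x y] by simp

section \<open>Bounded operators\<close>

abbreviation operators :: "('a::chilbert_space \<Rightarrow> 'b::chilbert_space) set"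
  where "operators \<equiv> bounded_ops UNIV UNIV"

lemma
  assumes "f \<in> bounded_ops M N"
  shows bounded_ops_mem: "x \<in> M \<Longrightarrow> f x \<in> N"
    and bounded_ops_add: "x \<in> M \<Longrightarrow> y \<in> M \<Longrightarrow> f (x + y) = f x + f y"
    and bounded_ops_scaleC: "x \<in> M \<Longrightarrow> f (c *\<^sub>C x) = c *\<^sub>C f x"
    and bounded_ops_extensional: "f \<in> extensional M"
  using assms by (auto simp: bounded_ops_def PiE_def)

lemma bounded_ops_diff:
  assumes f: "f \<in> bounded_ops M N" and M: "csubspace M" and x: "x \<in> M" "y \<in> M"
  shows "f (x - y) = f x - f y"
proof -
  have m: "x - y = x + (- 1) *\<^sub>C y" by simp
  have "(- 1) *\<^sub>C y \<in> M" using M x complex_vector.subspace_scale by blast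
  then show ?thesis unfolding m
    using bounded_ops_scaleC[OF f x(2), of "- 1"] bounded_ops_add[OF f x(1), of "- y"] by simp
qed

lemma bounded_ops_zero:
  assumes f: "f \<in> bounded_ops M N" and M: "csubspace M"
  shows "f 0 = 0"
  using bounded_ops_diff[OF f M, of 0 0] M complex_vector.subspace_0 by auto

lemma bounded_ops_bound:
  assumes "f \<in> bounded_ops M N"
  obtains B where "B \<ge> 0" "\<And>x. x \<in> M \<Longrightarrow> norm (f x) \<le> B * norm x"
proof -
  obtain B where B: "\<And>x. x \<in> M \<Longrightarrow> norm (f x) \<le> B * norm x"
    using assms unfolding bounded_ops_def by blast
  have "norm (f x) \<le> \<bar>B\<bar> * norm x" if "x \<in> M" for x
    using B[OF that] by (meson abs_ge_self mult_right_mono norm_ge_zero order_trans)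
  then show ?thesis using that[of "\<bar>B\<bar>"] by auto
qed

lemma bounded_opsI:
  assumes "f \<in> extensional M" "\<And>x. x \<in> M \<Longrightarrow> f x \<in> N"
    "\<And>x y. x \<in> M \<Longrightarrow> y \<in> M \<Longrightarrow> f (x + y) = f x + f y"
    "\<And>c x. x \<in> M \<Longrightarrow> f (c *\<^sub>C x) = c *\<^sub>C f x"
    "\<And>x. x \<in> M \<Longrightarrow> norm (f x) \<le> B * norm x"
  shows "f \<in> bounded_ops M N"
  using assms unfolding bounded_ops_def by (auto simp: PiE_def intro!: exI[of _ B])

lemma bounded_ops_UNIV_bounded_linear:
  assumes "f \<in> operators" shows "bounded_linear f"
proof -
  obtain B where B: "\<And>x. norm (f x) \<le> B * norm x" using bounded_ops_bound[OF assms] by auto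
  show ?thesis
    by (rule bounded_linear_intro[of _ B])
       (auto simp: bounded_ops_add[OF assms] bounded_ops_scaleC[OF assms] scaleR_scaleC B mult.commute)
qed

lemmas UNIV_ops_add = bounded_ops_add[of _ UNIV UNIV, simplified]
  and UNIV_ops_diff = bounded_ops_diff[of _ UNIV UNIV, simplified]
  and UNIV_ops_scaleC = bounded_ops_scaleC[of _ UNIV UNIV, simplified]

lemma bounded_ops_tendsto:
  assumes f: "f \<in> bounded_ops M N" and M: "csubspace M"
    and X: "X \<longlonglongrightarrow> x" "\<And>n. X n \<in> M" "x \<in> M"
  shows "(\<lambda>n. f (X n)) \<longlonglongrightarrow> f x"
proof -
  obtain B where B: "B \<ge> 0" "\<And>x. x \<in> M \<Longrightarrow> norm (f x) \<le> B * norm x"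
    using bounded_ops_bound[OF f] by auto
  have "(\<lambda>n. B * norm (X n - x)) \<longlonglongrightarrow> B * 0"
    by (intro tendsto_intros tendsto_norm_zero LIM_zero X(1))
  then have "(\<lambda>n. B * norm (X n - x)) \<longlonglongrightarrow> 0" by simp
  moreover have "norm (f (X n) - f x) \<le> B * norm (X n - x)" for n
    using B(2)[of "X n - x"] bounded_ops_diff[OF f M X(2)[of n] X(3)]
      complex_vector.subspace_diff[OF M X(2)[of n] X(3)] by simp
  ultimately have "(\<lambda>n. f (X n) - f x) \<longlonglongrightarrow> 0"
    by (rule Lim_null_comparison[OF always_eventually[rule_format], rotated])
  then show ?thesis by (rule LIM_zero_cancel)
qed

section \<open>Riesz representation and adjoints\<close>

text \<open>
  The representing vector minimizes \<open>\<parallel>z\<parallel>\<^sup>2 - 2 Re (g z)\<close> over \<open>M\<close>. A minimizing sequence is Cauchy by the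
  parallelogram identity, and at the minimum the real-linear variation vanishes; replacing \<open>z\<close> by
  \<open>\<i> z\<close> takes care of the imaginary part.
\<close>

lemma riesz:
  fixes M :: "'a::chilbert_space set" and g :: "'a \<Rightarrow> complex"
  assumes M: "csubspace M" and cl: "closed M"
    and add: "\<And>x y. x \<in> M \<Longrightarrow> y \<in> M \<Longrightarrow> g (x + y) = g x + g y"
    and sc: "\<And>c x. x \<in> M \<Longrightarrow> g (c *\<^sub>C x) = c * g x"
    and bd: "\<And>x. x \<in> M \<Longrightarrow> cmod (g x) \<le> B * norm x"
  shows "\<exists>x\<in>M. \<forall>z\<in>M. g z = cinner z x"
proof -
  define q where "q z = (norm z)\<^sup>2 - 2 * Re (g z)" for z
  have M0: "0 \<in> M" and Madd: "\<And>x y. x \<in> M \<Longrightarrow> y \<in> M \<Longrightarrow> x + y \<in> M"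
    and Msc: "\<And>c x. x \<in> M \<Longrightarrow> c *\<^sub>C x \<in> M"
    using M by (auto simp: complex_vector.subspace_def)
  have MscR: "r *\<^sub>R x \<in> M" if "x \<in> M" for r x using Msc[OF that] by (simp add: scaleR_scaleC)
  have scR: "g (r *\<^sub>R x) = of_real r * g x" if "x \<in> M" for r x
    using sc[OF that] by (simp add: scaleR_scaleC)
  have qlb: "q z \<ge> - B\<^sup>2" if "z \<in> M" for z
  proof -
    have "Re (g z) \<le> B * norm z" using bd[OF that] abs_Re_le_cmod[of "g z"] by linarith
    then have "q z \<ge> (norm z)\<^sup>2 - 2 * (B * norm z)" unfolding q_def by simp
    moreover have "(norm z - B)\<^sup>2 \<ge> 0" by simp
    ultimately show ?thesis by (simp add: power2_diff algebra_simps)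
  qed
  define m where "m = Inf (q ` M)"
  have bdd: "bdd_below (q ` M)" using qlb by (auto intro!: bdd_belowI2)
  have mle: "m \<le> q z" if "z \<in> M" for z unfolding m_def by (rule cINF_lower[OF bdd that])
  have "\<exists>z\<in>M. q z < m + inverse (real (Suc n))" for n
    using cInf_lessD[of "q ` M" "m + inverse (real (Suc n))"] M0 unfolding m_def by auto
  then obtain Z where Z: "\<And>n. Z n \<in> M" "\<And>n. q (Z n) < m + inverse (real (Suc n))" by metis
  \<comment> \<open>Compare \<open>q x + q y\<close> with twice the value of \<open>q\<close> at the midpoint.\<close>
  have para: "(norm (x - y))\<^sup>2 \<le> 2 * (q x - m) + 2 * (q y - m)" if "x \<in> M" "y \<in> M" for x y
  proof -
    have h: "(1/2) *\<^sub>R (x + y) \<in> M" using that by (intro MscR Madd)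
    have "q ((1/2) *\<^sub>R (x + y)) = (norm (x + y))\<^sup>2 / 4 - (Re (g x) + Re (g y))"
    proof -
      have "g ((1/2) *\<^sub>R (x + y)) = of_real (1/2) * (g x + g y)"
        using scR[OF Madd[OF that], of "1/2"] add[OF that] by simp
      moreover have "Re (of_real (1/2) * w) = 1/2 * Re w" for w by simp
      ultimately have "Re (g ((1/2) *\<^sub>R (x + y))) = 1/2 * (Re (g x) + Re (g y))"
        by (simp only: plus_complex.sel)
      then show ?thesis unfolding q_def by (simp add: power_divide)
    qed
    then have "m \<le> (norm (x + y))\<^sup>2 / 4 - (Re (g x) + Re (g y))" using mle[OF h] by (simp only:)
    then have "4 * m \<le> (norm (x + y))\<^sup>2 - 4 * (Re (g x) + Re (g y))" by argo
    then show ?thesis unfolding q_def norm_add_square norm_diff_square by argo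
  qed
  have "Cauchy Z"
  proof (rule CauchyI)
    fix e :: real assume e: "e > 0"
    obtain N where N: "inverse (real (Suc N)) < e\<^sup>2 / 4"
      using reals_Archimedean[of "e\<^sup>2/4"] e by auto
    have qn: "q (Z n) - m < e\<^sup>2 / 4" if "n \<ge> N" for n
    proof -
      have "inverse (real (Suc n)) \<le> inverse (real (Suc N))" using that by simp
      then show ?thesis using Z(2)[of n] N by linarith
    qed
    have "norm (Z k - Z l) < e" if "k \<ge> N" "l \<ge> N" for k l
    proof -
      have "(norm (Z k - Z l))\<^sup>2 < e\<^sup>2"
        using para[OF Z(1) Z(1), of k l] qn[OF that(1)] qn[OF that(2)] by argo
      then show ?thesis using e by (simp add: power2_less_imp_less)
    qed
    then show "\<exists>N. \<forall>k\<ge>N. \<forall>l\<ge>N. norm (Z k - Z l) < e" by blast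
  qed
  then obtain x where x: "Z \<longlonglongrightarrow> x" using Cauchy_convergent_iff convergent_def by blast
  have xM: "x \<in> M" using closed_sequentially[OF cl] Z(1) x by blast
  have gdiff: "g (u - v) = g u - g v" if "u \<in> M" "v \<in> M" for u v
    using add[of u "- v"] sc[of v "-1"] Msc[of v "-1"] that by simp
  have gconv: "(\<lambda>n. g (Z n)) \<longlonglongrightarrow> g x"
  proof -
    have "(\<lambda>n. B * norm (Z n - x)) \<longlonglongrightarrow> B * 0"
      by (intro tendsto_intros tendsto_norm_zero LIM_zero x)
    then have "(\<lambda>n. B * norm (Z n - x)) \<longlonglongrightarrow> 0" by simp
    moreover have "norm (g (Z n) - g x) \<le> B * norm (Z n - x)" for n
      using bd[OF complex_vector.subspace_diff[OF M Z(1) xM], of n] gdiff[OF Z(1) xM] by simp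
    ultimately have "(\<lambda>n. g (Z n) - g x) \<longlonglongrightarrow> 0"
      by (rule Lim_null_comparison[OF always_eventually[rule_format], rotated])
    then show ?thesis by (rule LIM_zero_cancel)
  qed
  have "(\<lambda>n. q (Z n)) \<longlonglongrightarrow> q x" unfolding q_def by (intro tendsto_intros x gconv)
  moreover have "(\<lambda>n. m + inverse (real (Suc n))) \<longlonglongrightarrow> m + 0"
    by (intro tendsto_intros LIMSEQ_inverse_real_of_nat)
  ultimately have qx: "q x \<le> m" using Z(2) by (intro LIMSEQ_le) (auto intro: less_imp_le)
  have Re_eq: "Re (g z) = Re (cinner z x)" if z: "z \<in> M" for z
  proof (rule ccontr)
    define d where "d = Re (g z) - Re (cinner z x)"
    assume "\<not> ?thesis"
    then have d: "d \<noteq> 0" unfolding d_def by simp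
    have var: "2 * t * d \<le> t\<^sup>2 * (norm z)\<^sup>2" for t :: real
    proof -
      have "q x \<le> q (x + t *\<^sub>R z)" using qx mle[OF Madd[OF xM MscR[OF z, of t]]] by linarith
      moreover have "q (x + t *\<^sub>R z) = q x - 2 * t * d + t\<^sup>2 * (norm z)\<^sup>2"
      proof -
        have "cinner x z = cnj (cinner z x)" by (rule cinner_commute)
        then have "Re (cinner x z) = Re (cinner z x)" by simp
        then show ?thesis unfolding q_def norm_add_square d_def
          using add[OF xM MscR[OF z, of t]] scR[OF z, of t]
          by (simp add: cinner_simps power_mult_distrib algebra_simps)
      qed
      ultimately show ?thesis by linarith
    qed
    \<comment> \<open>Any small \<open>t\<close> of the sign of \<open>d\<close> violates \<open>var\<close>; the summand \<open>1\<close> covers \<open>z = 0\<close>.\<close>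
    define t where "t = d / (1 + (norm z)\<^sup>2)"
    have p: "1 + (norm z)\<^sup>2 > 0" by (smt (verit) zero_le_power2)
    have td: "d = t * (1 + (norm z)\<^sup>2)" and t: "t \<noteq> 0" using p d by (auto simp: t_def)
    have "2 * t\<^sup>2 * (1 + (norm z)\<^sup>2) \<le> t\<^sup>2 * (norm z)\<^sup>2"
      using var[of t] unfolding td by (simp add: power2_eq_square algebra_simps)
    then have "t\<^sup>2 * (2 + (norm z)\<^sup>2) \<le> 0" by (simp add: algebra_simps)
    moreover have "t\<^sup>2 * (2 + (norm z)\<^sup>2) > 0" using t by (intro mult_pos_pos) (auto simp: add_pos_nonneg)
    ultimately show False by linarith
  qed
  have "g z = cinner z x" if z: "z \<in> M" for z
  proof (rule complex_eqI)
    show "Re (g z) = Re (cinner z x)" by (rule Re_eq[OF z])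
    show "Im (g z) = Im (cinner z x)"
      using Re_eq[OF Msc[OF z, of \<i>]] sc[OF z] by (simp add: cinner_simps)
  qed
  then show ?thesis using xM by blast
qed

lemma adj_unique:
  assumes "csubspace M" "y \<in> N" "x \<in> M" "\<And>z. z \<in> M \<Longrightarrow> cinner (f z) y = cinner z x"
  shows "adj M N f y = x"
proof -
  have "(THE x. x \<in> M \<and> (\<forall>z\<in>M. cinner (f z) y = cinner z x)) = x"
  proof (rule the_equality)
    show "x \<in> M \<and> (\<forall>z\<in>M. cinner (f z) y = cinner z x)" using assms by blast
    fix x' assume "x' \<in> M \<and> (\<forall>z\<in>M. cinner (f z) y = cinner z x')"
    then show "x' = x" using assms by (intro cinner_ext[of M]) auto
  qed
  then show ?thesis unfolding adj_def using assms by simp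
qed

lemma
  fixes M :: "'a::chilbert_space set" and N :: "'b::chilbert_space set"
  assumes M: "csubspace M" "closed M" and f: "f \<in> bounded_ops M N" and y: "y \<in> N"
  shows adj_mem: "adj M N f y \<in> M"
    and adj_cinner: "z \<in> M \<Longrightarrow> cinner (f z) y = cinner z (adj M N f y)"
proof -
  obtain B where B: "\<And>x. x \<in> M \<Longrightarrow> norm (f x) \<le> B * norm x" using bounded_ops_bound[OF f] by auto
  have bd: "cmod (cinner (f x) y) \<le> B * norm y * norm x" if "x \<in> M" for x
  proof -
    have "cmod (cinner (f x) y) \<le> norm (f x) * norm y" by (rule norm_cinner_le)
    also have "\<dots> \<le> B * norm x * norm y" using B[OF that] by (simp add: mult_right_mono)
    finally show ?thesis by (simp add: ac_simps)
  qed
  obtain x where x: "x \<in> M" "\<And>z. z \<in> M \<Longrightarrow> cinner (f z) y = cinner z x"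
    using riesz[OF M, of "\<lambda>z. cinner (f z) y" "B * norm y"] bd
    by (auto simp: bounded_ops_add[OF f] bounded_ops_scaleC[OF f] cinner_simps)
  then have "adj M N f y = x" by (intro adj_unique M y) auto
  with x show "adj M N f y \<in> M" "z \<in> M \<Longrightarrow> cinner (f z) y = cinner z (adj M N f y)" by auto
qed

lemma adj_bounded_ops:
  fixes M :: "'a::chilbert_space set" and N :: "'b::chilbert_space set"
  assumes M: "csubspace M" "closed M" and N: "csubspace N"
    and f: "f \<in> bounded_ops M N"
  shows "adj M N f \<in> bounded_ops N M"
proof -
  obtain B where B: "B \<ge> 0" "\<And>x. x \<in> M \<Longrightarrow> norm (f x) \<le> B * norm x" using bounded_ops_bound[OF f] by auto
  note mem = adj_mem[OF M f] and ci = adj_cinner[OF M f]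
  show ?thesis
  proof (rule bounded_opsI[where B = B])
    show "adj M N f \<in> extensional N" by (simp add: adj_def)
    fix x assume x: "x \<in> N"
    show "adj M N f x \<in> M" using x by (rule mem)
    let ?a = "adj M N f x"
    have "(norm ?a)\<^sup>2 = cmod (cinner ?a ?a)" by (simp add: cinner_self norm_power)
    also have "\<dots> = cmod (cinner (f ?a) x)" using ci[OF x mem[OF x]] by simp
    also have "\<dots> \<le> norm (f ?a) * norm x" by (rule norm_cinner_le)
    also have "\<dots> \<le> B * norm ?a * norm x" using B(2)[OF mem[OF x]] by (simp add: mult_right_mono)
    finally have "norm ?a * norm ?a \<le> norm ?a * (B * norm x)" by (simp add: power2_eq_square ac_simps)
    then show "norm ?a \<le> B * norm x"
      using B(1) by (cases "norm ?a = 0") (auto simp: mult_le_cancel_left)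
    show "adj M N f (c *\<^sub>C x) = c *\<^sub>C ?a" for c
      using N M x mem[OF x] ci[OF x]
      by (intro adj_unique) (auto simp: complex_vector.subspace_scale cinner_simps)
    fix y assume y: "y \<in> N"
    show "adj M N f (x + y) = ?a + adj M N f y"
      using N M x y mem ci
      by (intro adj_unique) (auto simp: complex_vector.subspace_add cinner_simps)
  qed
qed

lemma unitary_cinner:
  assumes M: "csubspace M" "closed M" and U: "unitary M N U" and "x \<in> M" "y \<in> M"
  shows "cinner (U x) (U y) = cinner x y"
proof -
  have f: "U \<in> bounded_ops M N" and a: "adj M N U (U y) = y" using U assms by (auto simp: unitary_def)
  show ?thesis using adj_cinner[OF M f bounded_ops_mem[OF f \<open>y \<in> M\<close>] \<open>x \<in> M\<close>] a by simp
qed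

lemma unitaryI:
  assumes M: "csubspace M" and f: "U \<in> bounded_ops M N"
    and iso: "\<And>x y. x \<in> M \<Longrightarrow> y \<in> M \<Longrightarrow> cinner (U x) (U y) = cinner x y"
    and surj: "\<And>y. y \<in> N \<Longrightarrow> \<exists>x\<in>M. U x = y"
  shows "unitary M N U"
proof -
  have a: "adj M N U (U x) = x" if "x \<in> M" for x
    using bounded_ops_mem[OF f that] iso that by (intro adj_unique M) auto
  moreover have "U (adj M N U y) = y" if "y \<in> N" for y using surj[OF that] a by auto
  ultimately show ?thesis using f by (auto simp: unitary_def)
qed

text \<open>
  Polarization: norms of sums determine the real parts of inner products, and multiplying by \<open>\<i>\<close>
  determines the imaginary parts.
\<close>

lemma isometric_cinner:
  assumes f: "f \<in> bounded_ops M N" and M: "csubspace M"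
    and iso: "\<And>x. x \<in> M \<Longrightarrow> norm (f x) = norm x" and xy: "x \<in> M" "y \<in> M"
  shows "cinner (f x) (f y) = cinner x y"
proof -
  have re: "Re (cinner (f x) (f y)) = Re (cinner x y)" if "x \<in> M" "y \<in> M" for x y
    using iso[OF complex_vector.subspace_add[OF M that]] iso[OF that(1)] iso[OF that(2)]
      norm_add_square[of "f x" "f y"] norm_add_square[of x y]
    by (simp add: bounded_ops_add[OF f] that)
  show ?thesis
    using re[OF xy] re[OF complex_vector.subspace_scale[OF M xy(1), of \<i>] xy(2)]
    by (intro complex_eqI) (simp_all add: bounded_ops_scaleC[OF f xy(1)] cinner_simps)
qed

section \<open>Square roots and defect operators\<close>

text \<open>
  Polarization again. This uses complex scalars: a rotation of the real plane by a right angle has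
  vanishing quadratic form.
\<close>

lemma zero_of_quadratic_form_zero:
  fixes G :: "'a::chilbert_space \<Rightarrow> 'a"
  assumes G: "G \<in> operators" and q: "\<And>x. cinner (G x) x = 0"
  shows "G x = 0"
proof -
  have s: "cinner (G x) y + cinner (G y) x = 0" for x y
    using q[of "x + y"] q[of x] q[of y] by (simp add: UNIV_ops_add[OF G] cinner_simps add.commute)
  have "cinner (G x) y = 0" for y
  proof -
    have "\<i> * (cinner (G y) x - cinner (G x) y) = 0"
      using s[of x "\<i> *\<^sub>C y"] by (simp add: UNIV_ops_scaleC[OF G] cinner_simps algebra_simps)
    then have "cinner (G y) x = cinner (G x) y" by simp
    then show ?thesis using s[of x y] by simp
  qed
  from this[of "G x"] show ?thesis by simp
qed

lemma adj_UNIV_cinner: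
  assumes "f \<in> bounded_ops UNIV (UNIV::'b::chilbert_space set)"
  shows "cinner (f z) y = cinner (z::'a::chilbert_space) (adj UNIV UNIV f y)"
  using adj_cinner[of UNIV f UNIV y z] assms by simp

lemma adj_UNIV_cinner':
  assumes "f \<in> bounded_ops UNIV (UNIV::'b::chilbert_space set)"
  shows "cinner y (f z) = cinner (adj UNIV UNIV f y) (z::'a::chilbert_space)"
  by (metis adj_UNIV_cinner[OF assms] cinner_commute)

lemma adj_UNIV_ops:
  assumes "f \<in> bounded_ops (UNIV::'a::chilbert_space set) (UNIV::'b::chilbert_space set)"
  shows "adj UNIV UNIV f \<in> operators"
  using adj_bounded_ops[of UNIV UNIV f] assms by simp

lemma bounded_ops_UNIV_diff:
  assumes "f \<in> operators" "g \<in> operators"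
  shows "(\<lambda>x. f x - g x) \<in> operators"
proof -
  obtain B where B: "\<And>x. norm (f x) \<le> B * norm x" using bounded_ops_bound[OF assms(1)] by auto
  obtain C where C: "\<And>x. norm (g x) \<le> C * norm x" using bounded_ops_bound[OF assms(2)] by auto
  have "norm (f x - g x) \<le> (B + C) * norm x" for x
    using norm_triangle_ineq4[of "f x" "g x"] B[of x] C[of x] by (simp add: distrib_right)
  then show ?thesis
    by (rule bounded_opsI[where B = "B + C", rotated 4])
       (simp_all add: UNIV_ops_add[OF assms(1)] UNIV_ops_add[OF assms(2)]
          UNIV_ops_scaleC[OF assms(1)] UNIV_ops_scaleC[OF assms(2)] complex_vector.scale_right_diff_distrib)
qed

lemma UNIV_ops_comp:
  assumes g: "g \<in> operators" and f: "f \<in> operators"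
  shows "(\<lambda>x. f (g x)) \<in> operators"
proof -
  obtain B where B: "\<And>x. norm (g x) \<le> B * norm x" using bounded_ops_bound[OF g] by auto
  obtain C where C: "C \<ge> 0" "\<And>x. norm (f x) \<le> C * norm x" using bounded_ops_bound[OF f] by auto
  have "norm (f (g x)) \<le> (C * B) * norm x" for x
    using C(2)[of "g x"] mult_left_mono[OF B[of x] C(1)] by (simp add: ac_simps)
  then show ?thesis
    by (rule bounded_opsI[where B = "C * B", rotated 4])
       (simp_all add: UNIV_ops_add[OF f] UNIV_ops_add[OF g] UNIV_ops_scaleC[OF f] UNIV_ops_scaleC[OF g])
qed

text \<open>
  The quadratic form of \<open>S - S\<^sup>*\<close> is \<open>2 \<i>\<close> times the imaginary part of that of \<open>S\<close>, hence zero.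
\<close>

lemma positive_op_symmetric:
  assumes "positive_op S" shows "cinner (S x) y = cinner x (S y)"
proof -
  have S: "S \<in> operators" and p: "\<And>x. cinner (S x) x \<in> \<real>\<^sub>\<ge>\<^sub>0"
    using assms by (auto simp: positive_op_def)
  let ?G = "\<lambda>x. S x - adj UNIV UNIV S x"
  have real: "cnj (cinner (S x) x) = cinner (S x) x" for x
    using p[of x] by (auto simp: nonneg_Reals_def)
  have "cinner (adj UNIV UNIV S x) x = cinner (S x) x" for x
    using adj_UNIV_cinner'[OF S, of x x] real[of x] cinner_commute[of x "S x"] by simp
  then have "?G y = 0"
    using bounded_ops_UNIV_diff[OF S adj_UNIV_ops[OF S]]
    by (intro zero_of_quadratic_form_zero) (auto simp: cinner_simps)
  then show ?thesis using adj_UNIV_cinner[OF S, of x y] by simp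
qed

text \<open>
  The cone of polynomials in \<open>B\<close> with non-negative coefficients and zero constant term, each paired
  with its value at \<open>1\<close>, which bounds its norm when \<open>B\<close> is a contraction.
\<close>

inductive poly_cone :: "('a::complex_inner \<Rightarrow> 'a) \<Rightarrow> ('a \<Rightarrow> 'a) \<Rightarrow> real \<Rightarrow> bool" for B where
  zero: "poly_cone B (\<lambda>_. 0) 0"
| base: "poly_cone B B 1"
| add: "poly_cone B F r \<Longrightarrow> poly_cone B G s \<Longrightarrow> poly_cone B (\<lambda>x. F x + G x) (r + s)"
| mult: "poly_cone B F r \<Longrightarrow> poly_cone B G s \<Longrightarrow> poly_cone B (\<lambda>x. F (G x)) (r * s)"
| scale: "poly_cone B F r \<Longrightarrow> c \<ge> 0 \<Longrightarrow> poly_cone B (\<lambda>x. c *\<^sub>R F x) (c * r)"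

lemma poly_cone_linear:
  assumes "poly_cone B F r" "B \<in> operators"
  shows "F (x + y) = F x + F y \<and> F (c *\<^sub>C x) = c *\<^sub>C F x"
  using assms
  by (induction arbitrary: x y c rule: poly_cone.induct)
     (auto simp: UNIV_ops_add UNIV_ops_scaleC scaleC_add_right scaleR_scaleC ac_simps)

lemma poly_cone_bound:
  assumes "poly_cone B F r" "\<And>x. norm (B x) \<le> norm x"
  shows "0 \<le> r \<and> norm (F x) \<le> r * norm x"
  using assms
proof (induction arbitrary: x rule: poly_cone.induct)
  case (add F r G s)
  then have "norm (F x) \<le> r * norm x" "norm (G x) \<le> s * norm x" "0 \<le> r" "0 \<le> s" by auto
  then show ?case using norm_triangle_ineq[of "F x" "G x"] by (simp add: distrib_right)
next
  case (mult F r G s)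
  then have "norm (F (G x)) \<le> r * norm (G x)" "norm (G x) \<le> s * norm x" "0 \<le> r" "0 \<le> s" by auto
  then show ?case using mult_left_mono[of "norm (G x)" "s * norm x" r] by (simp add: mult.assoc)
next
  case (scale F r c)
  then show ?case by (auto simp: mult.assoc intro: mult_left_mono)
qed auto

lemma poly_cone_commute:
  assumes "poly_cone B F r" "S \<in> operators" "\<And>x. S (B x) = B (S x)"
  shows "S (F x) = F (S x)"
  using assms
proof (induction arbitrary: x rule: poly_cone.induct)
  case zero
  then show ?case using bounded_ops_zero[of S UNIV UNIV] by simp
qed (auto simp: UNIV_ops_add UNIV_ops_scaleC scaleR_scaleC)

lemma poly_cone_ops:
  assumes "poly_cone B F r" "B \<in> operators" "\<And>x. norm (B x) \<le> norm x"
  shows "F \<in> operators"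
  using poly_cone_linear[OF assms(1,2)] poly_cone_bound[OF assms(1,3)]
  by (intro bounded_opsI[where B = r]) auto

lemma poly_cone_commute2:
  assumes "poly_cone B F r" "poly_cone B G s" "B \<in> operators" "\<And>x. norm (B x) \<le> norm x"
  shows "F (G x) = G (F x)"
proof (rule poly_cone_commute[OF assms(2)])
  show F: "F \<in> operators" using poly_cone_ops assms by blast
  show "F (B x) = B (F x)" for x using poly_cone_commute[OF assms(1,3)] by simp
qed

lemma poly_cone_symmetric:
  assumes "poly_cone B F r" "B \<in> operators" "\<And>x. norm (B x) \<le> norm x"
    "\<And>x y. cinner (B x) y = cinner x (B y)"
  shows "cinner (F x) y = cinner x (F y)"
  using assms
proof (induction arbitrary: x y rule: poly_cone.induct)
  case (mult F r G s)
  then show ?case using poly_cone_commute2[of B F r G s] by simp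
qed (auto simp: cinner_simps)

text \<open>
  The iterates converge to \<open>I - (I - B)\<^sup>1\<^sup>/\<^sup>2\<close>, because a fixed point \<open>Y\<close> of the recursion satisfies
  \<open>(I - Y)\<^sup>2 = I - B\<close>.
\<close>

fun sqrt_iter :: "('a::complex_inner \<Rightarrow> 'a) \<Rightarrow> nat \<Rightarrow> 'a \<Rightarrow> 'a" where
  "sqrt_iter B 0 = (\<lambda>_. 0)"
| "sqrt_iter B (Suc n) = (\<lambda>x. (1/2) *\<^sub>R (B x + sqrt_iter B n (sqrt_iter B n x)))"

text \<open>
  The same recursion for \<open>B = 1\<close>, that is, the values at \<open>1\<close> of the polynomials \<open>sqrt_iter B n\<close>.
\<close>

fun sqrt_iter_bound :: "nat \<Rightarrow> real" where
  "sqrt_iter_bound 0 = 0"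
| "sqrt_iter_bound (Suc n) = (1/2) * (1 + sqrt_iter_bound n * sqrt_iter_bound n)"

lemma sqrt_iter_cone: "poly_cone B (sqrt_iter B n) (sqrt_iter_bound n)"
proof (induction n)
  case 0 show ?case by (simp add: poly_cone.zero)
next
  case (Suc n)
  then show ?case unfolding sqrt_iter.simps sqrt_iter_bound.simps by (intro poly_cone.intros) auto
qed

text \<open>
  The difference of consecutive iterates has non-negative coefficients by induction, because
  \<open>Y\<^sub>n\<^sub>+\<^sub>1\<^sup>2 - Y\<^sub>n\<^sup>2 = (Y\<^sub>n\<^sub>+\<^sub>1 - Y\<^sub>n) (Y\<^sub>n\<^sub>+\<^sub>1 + Y\<^sub>n)\<close>. Hence the norm of the difference is bounded by its value
  at \<open>1\<close>, and convergence of the operators reduces to that of a bounded increasing real sequence.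
\<close>

lemma sqrt_iter_diff_cone:
  assumes B: "B \<in> operators" "\<And>x. norm (B x) \<le> norm x"
  shows "poly_cone B (\<lambda>x. sqrt_iter B (Suc n) x - sqrt_iter B n x) (sqrt_iter_bound (Suc n) - sqrt_iter_bound n)"
proof (induction n)
  case 0
  then show ?case using poly_cone.scale[OF poly_cone.base, of "1/2" B] by simp
next
  case (Suc n)
  let ?E = "\<lambda>x. sqrt_iter B (Suc n) x - sqrt_iter B n x"
  let ?F = "\<lambda>x. sqrt_iter B (Suc n) x + sqrt_iter B n x"
  let ?s = sqrt_iter_bound
  let ?Y = "sqrt_iter B"
  have c: "poly_cone B (\<lambda>x. (1/2) *\<^sub>R ?E (?F x)) (1/2 * ((?s (Suc n) - ?s n) * (?s (Suc n) + ?s n)))"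
    by (intro poly_cone.scale poly_cone.mult[OF Suc poly_cone.add] sqrt_iter_cone) simp
  note lin = poly_cone_linear[OF sqrt_iter_cone B(1)]
  have "(\<lambda>x. (1/2) *\<^sub>R ?E (?F x)) = (\<lambda>x. ?Y (Suc (Suc n)) x - ?Y (Suc n) x)"
  proof
    fix x
    have "?Y (Suc n) (?Y n x) = ?Y n (?Y (Suc n) x)"
      by (rule poly_cone_commute2[OF sqrt_iter_cone sqrt_iter_cone B])
    then have eq: "?E (?F x) = ?Y (Suc n) (?Y (Suc n) x) - ?Y n (?Y n x)"
      using lin[of "Suc n"] lin[of n] by (simp del: sqrt_iter.simps)
    have "(1/2) *\<^sub>R ?E (?F x) = (1/2) *\<^sub>R (B x + ?Y (Suc n) (?Y (Suc n) x)) - (1/2) *\<^sub>R (B x + ?Y n (?Y n x))"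
      unfolding eq by (simp add: scaleR_right_diff_distrib scaleR_right_distrib del: sqrt_iter.simps)
    then show "(1/2) *\<^sub>R ?E (?F x) = ?Y (Suc (Suc n)) x - ?Y (Suc n) x"
      by (simp only: sqrt_iter.simps)
  qed
  moreover have "1/2 * ((?s (Suc n) - ?s n) * (?s (Suc n) + ?s n)) = ?s (Suc (Suc n)) - ?s (Suc n)"
    unfolding sqrt_iter_bound.simps(2)[of "Suc n"] sqrt_iter_bound.simps(2)[of n] by (simp add: field_simps)
  ultimately show ?case using c by (simp only:)
qed

text \<open>
  The last clause says that the root commutes with everything that commutes with \<open>B\<close>; the
  uniqueness of the root rests on it.
\<close>

lemma sqrt_exists:
  fixes B :: "'a::chilbert_space \<Rightarrow> 'a"
  assumes B: "B \<in> operators" "\<And>x. norm (B x) \<le> norm x"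
    and sym: "\<And>x y. cinner (B x) y = cinner x (B y)"
  obtains R where "positive_op R" "\<And>x. R (R x) = x - B x"
    "\<And>S x. S \<in> operators \<Longrightarrow> (\<And>x. S (B x) = B (S x)) \<Longrightarrow> S (R x) = R (S x)"
proof -
  let ?Y = "sqrt_iter B" and ?s = sqrt_iter_bound
  note bd = poly_cone_bound[OF sqrt_iter_cone B(2)]
  have ops: "?Y n \<in> operators" for n using poly_cone_ops[OF sqrt_iter_cone B] .
  have s1: "?s n \<le> 1" for n
  proof (induction n)
    case (Suc n)
    have "0 \<le> ?s n" using bd by blast
    then have "?s n * ?s n \<le> 1 * 1" using Suc by (intro mult_mono) auto
    then show ?case by simp
  qed simp
  note dcone = poly_cone_bound[OF sqrt_iter_diff_cone[OF B] B(2)]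
  have inc: "incseq ?s" by (rule incseq_SucI) (use dcone in \<open>auto simp del: sqrt_iter_bound.simps\<close>)
  have "Cauchy ?s"
    by (rule incseq_convergent[OF inc, of 1]) (use s1 in \<open>auto intro: LIMSEQ_imp_Cauchy\<close>)
  have diff: "norm (?Y (n + k) x - ?Y n x) \<le> (?s (n + k) - ?s n) * norm x" for n k x
  proof (induction k)
    case (Suc k)
    have "norm (?Y (n + Suc k) x - ?Y n x) \<le> norm (?Y (Suc (n + k)) x - ?Y (n + k) x) + norm (?Y (n + k) x - ?Y n x)"
      by (metis add_Suc_right diff_add_cancel add_diff_eq norm_triangle_ineq)
    also have "\<dots> \<le> (?s (Suc (n + k)) - ?s (n + k)) * norm x + (?s (n + k) - ?s n) * norm x"
      using dcone Suc by (intro add_mono) blast+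
    finally show ?case by (simp add: algebra_simps del: sqrt_iter.simps sqrt_iter_bound.simps)
  qed simp
  have "Cauchy (\<lambda>n. ?Y n x)" for x
  proof (rule CauchyI')
    fix e :: real assume e: "0 < e"
    define d where "d = e / (norm x + 1)"
    have d: "d > 0" using e by (simp add: d_def add_nonneg_pos)
    obtain N where N: "\<And>m n. m \<ge> N \<Longrightarrow> n \<ge> N \<Longrightarrow> norm (?s m - ?s n) < d"
      using \<open>Cauchy ?s\<close> d unfolding Cauchy_iff by blast
    have "norm (?Y m x - ?Y n x) < e" if "m \<ge> N" "n > m" for m n
    proof -
      have "norm (?Y n x - ?Y m x) \<le> (?s n - ?s m) * norm x"
        using diff[of m "n - m" x] that by simp
      also have "\<dots> \<le> d * norm x" using N[of n m] that by (intro mult_right_mono) auto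
      also have "\<dots> < d * (norm x + 1)" using d by simp
      also have "\<dots> = e" unfolding d_def by (simp add: add_nonneg_eq_0_iff)
      finally show ?thesis by (simp add: norm_minus_commute)
    qed
    then show "\<exists>M. \<forall>m\<ge>M. \<forall>n>m. dist (?Y m x) (?Y n x) < e"
      unfolding dist_norm by blast
  qed
  then have "\<exists>y. (\<lambda>n. ?Y n x) \<longlonglongrightarrow> y" for x using Cauchy_convergent_iff convergent_def by blast
  then obtain Y where Y: "\<And>x. (\<lambda>n. ?Y n x) \<longlonglongrightarrow> Y x" by metis
  have Ybd: "norm (Y x) \<le> norm x" for x
  proof (rule LIMSEQ_le_const2[OF tendsto_norm[OF Y]])
    have "norm (?Y n x) \<le> norm x" for n
      using bd[of n x] s1[of n] mult_right_mono[of "?s n" 1 "norm x"] by simp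
    then show "\<exists>N. \<forall>n\<ge>N. norm (?Y n x) \<le> norm x" by blast
  qed
  have Yops: "Y \<in> operators"
  proof (rule bounded_opsI[where B = 1])
    fix x y
    have "(\<lambda>n. ?Y n (x + y)) \<longlonglongrightarrow> Y x + Y y"
      unfolding UNIV_ops_add[OF ops] by (intro tendsto_add Y)
    then show "Y (x + y) = Y x + Y y" using Y LIMSEQ_unique by blast
    fix c
    have "(\<lambda>n. ?Y n (c *\<^sub>C x)) \<longlonglongrightarrow> c *\<^sub>C Y x"
      unfolding UNIV_ops_scaleC[OF ops] by (rule bounded_linear.tendsto[OF bounded_linear_scaleC Y])
    then show "Y (c *\<^sub>C x) = c *\<^sub>C Y x" using Y LIMSEQ_unique by blast
  qed (auto simp: Ybd)
  have YY: "Y (Y x) + B x = 2 *\<^sub>R Y x" for x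
  proof -
    have "(\<lambda>n. ?Y n (?Y n x)) \<longlonglongrightarrow> Y (Y x)"
    proof -
      have "(\<lambda>n. ?Y n (?Y n x - Y x)) \<longlonglongrightarrow> 0"
      proof (rule Lim_null_comparison)
        have "norm (?Y n (?Y n x - Y x)) \<le> norm (?Y n x - Y x)" for n
          using bd[of n "?Y n x - Y x"] s1[of n] mult_right_mono[of "?s n" 1 "norm (?Y n x - Y x)"]
          by simp
        then show "\<forall>\<^sub>F n in sequentially. norm (?Y n (?Y n x - Y x)) \<le> norm (?Y n x - Y x)" by simp
        show "(\<lambda>n. norm (?Y n x - Y x)) \<longlonglongrightarrow> 0" by (intro tendsto_norm_zero LIM_zero Y)
      qed
      then have "(\<lambda>n. ?Y n (?Y n x - Y x) + ?Y n (Y x)) \<longlonglongrightarrow> 0 + Y (Y x)" by (intro tendsto_add Y)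
      then show ?thesis by (simp add: UNIV_ops_diff[OF ops])
    qed
    then have "(\<lambda>n. (1/2) *\<^sub>R (B x + ?Y n (?Y n x))) \<longlonglongrightarrow> (1/2) *\<^sub>R (B x + Y (Y x))"
      by (intro tendsto_intros)
    then have "(\<lambda>n. ?Y (Suc n) x) \<longlonglongrightarrow> (1/2) *\<^sub>R (B x + Y (Y x))" by simp
    moreover have "(\<lambda>n. ?Y (Suc n) x) \<longlonglongrightarrow> Y x" using Y by (rule LIMSEQ_Suc)
    ultimately have "Y x = (1/2) *\<^sub>R (B x + Y (Y x))" using LIMSEQ_unique by blast
    then have "2 *\<^sub>R Y x = 2 *\<^sub>R ((1/2) *\<^sub>R (B x + Y (Y x)))" by simp
    then show ?thesis by (simp add: add.commute)
  qed
  define R where "R x = x - Y x" for x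
  have id: "(\<lambda>x::'a. x) \<in> operators" by (rule bounded_opsI[where B = 1]) auto
  have Rops: "R \<in> operators"
    unfolding R_def by (rule bounded_ops_UNIV_diff[OF id Yops])
  have "positive_op R" unfolding positive_op_def
  proof (intro conjI allI Rops)
    fix x
    have re: "cinner (?Y n x) x \<in> \<real>" for n
      using poly_cone_symmetric[OF sqrt_iter_cone B sym, of n x x] cinner_commute[of "?Y n x" x]
      by (simp add: Reals_cnj_iff)
    have "cinner (Y x) x \<in> \<real>"
      using closed_sequentially[OF closed_complex_Reals, of "\<lambda>n. cinner (?Y n x) x"] re
        tendsto_cinner[OF Y tendsto_const] by blast
    then have c: "cinner (Y x) x = of_real (Re (cinner (Y x) x))" by (simp add: complex_is_Real_iff complex_eq_iff)
    have "Re (cinner (Y x) x) \<le> norm (Y x) * norm x"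
      using norm_cinner_le[of "Y x" x] complex_Re_le_cmod[of "cinner (Y x) x"] by linarith
    also have "\<dots> \<le> (norm x)\<^sup>2" unfolding power2_eq_square by (intro mult_right_mono Ybd) simp
    finally have "0 \<le> (norm x)\<^sup>2 - Re (cinner (Y x) x)" by simp
    moreover have "cinner (R x) x = of_real ((norm x)\<^sup>2 - Re (cinner (Y x) x))"
      using c by (simp add: R_def cinner_diff_left cinner_self)
    ultimately show "cinner (R x) x \<in> \<real>\<^sub>\<ge>\<^sub>0" by (simp only: nonneg_Reals_of_real_iff)
  qed
  moreover have "R (R x) = x - B x" for x
  proof -
    have "R (R x) = x - 2 *\<^sub>R Y x + Y (Y x)" 
      by (simp add: R_def UNIV_ops_diff[OF Yops] scaleR_2)
    also have "\<dots> = x - B x" unfolding YY[of x, symmetric] by simp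
    finally show ?thesis .
  qed
  moreover have "S (R x) = R (S x)" if S: "S \<in> operators" and c: "\<And>x. S (B x) = B (S x)" for S x
  proof -
    have "(\<lambda>n. S (?Y n x)) \<longlonglongrightarrow> S (Y x)"
      by (rule bounded_linear.tendsto[OF bounded_ops_UNIV_bounded_linear[OF S] Y])
    then have "(\<lambda>n. ?Y n (S x)) \<longlonglongrightarrow> S (Y x)"
      using poly_cone_commute[OF sqrt_iter_cone[of B] S c] by simp
    then have "Y (S x) = S (Y x)" using Y LIMSEQ_unique by blast
    then show ?thesis by (simp add: R_def UNIV_ops_diff[OF S])
  qed
  ultimately show ?thesis using that by blast
qed

text \<open>
  Another positive root \<open>S\<close> commutes with \<open>R\<close>. For \<open>E = S - R\<close> this gives \<open>(S + R) E = 0\<close>, so that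
  the positive forms of \<open>S\<close> and \<open>R\<close> both vanish on the range of \<open>E\<close>. Therefore \<open>E\<^sup>3 = 0\<close>, and a nilpotent
  self-adjoint operator is zero.
\<close>

lemma sqrt_unique:
  fixes B :: "'a::chilbert_space \<Rightarrow> 'a"
  assumes B: "B \<in> operators"
    and R: "positive_op R" "\<And>x. R (R x) = x - B x"
    and comm: "\<And>S x. S \<in> operators \<Longrightarrow> (\<And>x. S (B x) = B (S x)) \<Longrightarrow> S (R x) = R (S x)"
    and S: "positive_op S" "\<And>x. S (S x) = x - B x"
  shows "S = R"
proof
  fix x
  have So: "S \<in> operators" and Ro: "R \<in> operators"
    using S(1) R(1) by (auto simp: positive_op_def)
  have "S (B x) = B (S x)" for x
  proof -
    have "S (x - B x) = S x - B (S x)" using S(2)[of x] S(2)[of "S x"] by simp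
    then show ?thesis by (simp add: UNIV_ops_diff[OF So])
  qed
  then have SR: "S (R x) = R (S x)" for x using comm[OF So] by blast
  define E where "E x = S x - R x" for x
  have Eo: "E \<in> operators" unfolding E_def by (rule bounded_ops_UNIV_diff[OF So Ro])
  have Esym: "cinner (E x) y = cinner x (E y)" for x y
    unfolding E_def by (simp add: cinner_simps positive_op_symmetric[OF S(1)] positive_op_symmetric[OF R(1)])
  have "cinner (E (E (E x))) x = 0" for x
  proof -
    have "S (E x) + R (E x) = 0"
      by (simp add: E_def UNIV_ops_diff[OF So] UNIV_ops_diff[OF Ro] SR S(2) R(2))
    then have "cinner (S (E x)) (E x) + cinner (R (E x)) (E x) = 0"
      by (simp flip: cinner_add_left)
    moreover have "cinner (S (E x)) (E x) \<in> \<real>\<^sub>\<ge>\<^sub>0" "cinner (R (E x)) (E x) \<in> \<real>\<^sub>\<ge>\<^sub>0"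
      using S(1) R(1) by (auto simp: positive_op_def)
    ultimately have "cinner (S (E x)) (E x) = 0 \<and> cinner (R (E x)) (E x) = 0"
      by (auto simp: complex_nonneg_Reals_iff complex_eq_iff)
    then have "cinner (E (E x)) (E x) = 0" unfolding E_def[of "E x"] by (simp add: cinner_diff_left)
    then show ?thesis using Esym[of "E (E x)" x] by simp
  qed
  then have E3: "E (E (E x)) = 0" for x
    using zero_of_quadratic_form_zero[OF UNIV_ops_comp[OF UNIV_ops_comp[OF Eo Eo] Eo]] by blast
  have "cinner (E (E x)) (E (E x)) = 0" using Esym[of "E (E x)" "E x"] E3 by simp
  then have "E (E x) = 0" by simp
  then have "cinner (E x) (E x) = 0" using Esym[of "E x" x] by simp
  then show "S x = R x" by (simp add: E_def)
qed

lemma contraction_norm_le: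
  assumes "contraction A" shows "norm (A x) \<le> norm x"
  using onorm[OF bounded_ops_UNIV_bounded_linear, of A x] assms
    mult_right_mono[of "onorm A" 1 "norm x"]
  by (simp add: contraction_def)

lemma contraction_ops: "contraction A \<Longrightarrow> A \<in> operators"
  by (simp add: contraction_def)

lemma contractionI:
  assumes "A \<in> operators" "\<And>x. norm (A x) \<le> norm x"
  shows "contraction A"
  unfolding contraction_def using assms onorm_bound[of 1 A] by auto

lemma
  assumes A: "contraction A"
  shows defect_positive: "positive_op (defect A)"
    and defect_square: "defect A (defect A x) = x - adj UNIV UNIV A (A x)"
proof -
  define B where "B x = adj UNIV UNIV A (A x)" for x
  note Ao = contraction_ops[OF A]
  have B: "B \<in> operators"
    unfolding B_def by (rule UNIV_ops_comp[OF Ao adj_UNIV_ops[OF Ao]])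
  have ip: "cinner (B x) y = cinner (A x) (A y)" "cinner x (B y) = cinner (A x) (A y)" for x y
    unfolding B_def by (simp_all flip: adj_UNIV_cinner[OF Ao] adj_UNIV_cinner'[OF Ao])
  have Bn: "norm (B x) \<le> norm x" for x
  proof -
    have "(norm (B x))\<^sup>2 = cmod (cinner (B x) (B x))" by (simp add: cinner_self norm_power)
    also have "\<dots> = cmod (cinner (A x) (A (B x)))" by (simp only: ip(1)[of x "B x"])
    also have "\<dots> \<le> norm (A x) * norm (A (B x))" by (rule norm_cinner_le)
    also have "\<dots> \<le> norm x * norm (B x)" by (intro mult_mono contraction_norm_le A) auto
    finally have "norm (B x) * norm (B x) \<le> norm x * norm (B x)" by (simp add: power2_eq_square)
    then show ?thesis by (cases "norm (B x) = 0") (auto simp: mult_le_cancel_right)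
  qed
  obtain R where R: "positive_op R" "\<And>x. R (R x) = x - B x"
    "\<And>S x. S \<in> operators \<Longrightarrow> (\<And>x. S (B x) = B (S x)) \<Longrightarrow> S (R x) = R (S x)"
    using sqrt_exists[of B] B Bn by (metis ip)
  have "sqrt_op (\<lambda>x. x - B x) = R"
    unfolding sqrt_op_def
  proof (rule the_equality)
    show "positive_op R \<and> R \<circ> R = (\<lambda>x. x - B x)" using R by (auto simp: fun_eq_iff)
    fix S assume "positive_op S \<and> S \<circ> S = (\<lambda>x. x - B x)"
    then show "S = R" using sqrt_unique[OF B R] by (auto simp: fun_eq_iff)
  qed
  then have "defect A = R" by (simp add: defect_def B_def)
  with R show "positive_op (defect A)" "defect A (defect A x) = x - adj UNIV UNIV A (A x)"
    by (auto simp: B_def)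
qed

lemma defect_ops: "contraction A \<Longrightarrow> defect A \<in> operators"
  using defect_positive by (auto simp: positive_op_def)

lemma defect_symmetric: "contraction A \<Longrightarrow> cinner (defect A x) y = cinner x (defect A y)"
  using positive_op_symmetric[OF defect_positive] .

lemma cinner_defect:
  assumes A: "contraction A"
  shows "cinner (defect A x) (defect A y) = cinner x y - cinner (A x) (A y)"
proof -
  have "cinner (defect A x) (defect A y) = cinner x (defect A (defect A y))"
    using defect_symmetric[OF A] by simp
  then show ?thesis
    by (simp add: defect_square[OF A] cinner_simps flip: adj_UNIV_cinner[OF contraction_ops[OF A]])
qed

lemma defect_space_mem: "defect A x \<in> defect_space A"
  unfolding defect_space_def by (rule subsetD[OF closure_subset]) simp

lemma closed_defect_space: "closed (defect_space A)" by (simp add: defect_space_def)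

lemma subspace_closure:
  fixes M :: "'a::complex_inner set"
  assumes M: "csubspace M"
  shows "csubspace (closure M)"
  unfolding complex_vector.subspace_def
proof (intro conjI ballI allI)
  show "0 \<in> closure M" by (rule subsetD[OF closure_subset complex_vector.subspace_0[OF M]])
  fix x assume "x \<in> closure M"
  then obtain X where X: "\<And>n. X n \<in> M" "X \<longlonglongrightarrow> x" unfolding closure_sequential by blast
  { fix y assume "y \<in> closure M"
    then obtain Y where Y: "\<And>n. Y n \<in> M" "Y \<longlonglongrightarrow> y" unfolding closure_sequential by blast
    have "(\<lambda>n. X n + Y n) \<longlonglongrightarrow> x + y" by (intro tendsto_intros X Y)
    then show "x + y \<in> closure M" unfolding closure_sequential
      using complex_vector.subspace_add[OF M X(1) Y(1)] by (auto intro!: exI[of _ "\<lambda>n. X n + Y n"]) }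
  fix c
  have "(\<lambda>n. c *\<^sub>C X n) \<longlonglongrightarrow> c *\<^sub>C x" by (rule bounded_linear.tendsto[OF bounded_linear_scaleC X(2)])
  then show "c *\<^sub>C x \<in> closure M" unfolding closure_sequential
    using complex_vector.subspace_scale[OF M X(1)] by (auto intro!: exI[of _ "\<lambda>n. c *\<^sub>C X n"])
qed

lemma subspace_defect_space:
  assumes A: "contraction A" shows "csubspace (defect_space A)"
  unfolding defect_space_def
proof (rule subspace_closure)
  show "csubspace (range (defect A))"
    unfolding complex_vector.subspace_def
    using bounded_ops_zero[OF defect_ops[OF A]] UNIV_ops_add[OF defect_ops[OF A], symmetric]
      UNIV_ops_scaleC[OF defect_ops[OF A], symmetric]
    by auto
qed

section \<open>Extending isometries\<close>

text \<open>
  The span of the pairs \<open>(a s, b s)\<close>. If \<open>a\<close> and \<open>b\<close> have the same Gram matrix, it is the graph of an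
  isometry, and so is its closure \<open>closed_graph\<close>; the symmetry in \<open>a\<close> and \<open>b\<close> yields the
  surjectivity.
\<close>

inductive lin_graph :: "('i \<Rightarrow> 'a::complex_vector) \<Rightarrow> ('i \<Rightarrow> 'b::complex_vector) \<Rightarrow> 'a \<Rightarrow> 'b \<Rightarrow> bool"
  for a b where
  zero: "lin_graph a b 0 0"
| gen: "lin_graph a b (a s) (b s)"
| add: "lin_graph a b x y \<Longrightarrow> lin_graph a b x' y' \<Longrightarrow> lin_graph a b (x + x') (y + y')"
| scale: "lin_graph a b x y \<Longrightarrow> lin_graph a b (c *\<^sub>C x) (c *\<^sub>C y)"

lemma lin_graph_swap: "lin_graph a b x y \<Longrightarrow> lin_graph b a y x"
  by (induction rule: lin_graph.induct) (auto intro: lin_graph.intros)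

lemma lin_graph_diff:
  assumes "lin_graph a b x y" "lin_graph a b x' y'" shows "lin_graph a b (x - x') (y - y')"
  using lin_graph.add[OF assms(1) lin_graph.scale[OF assms(2), of "-1"]] by simp

lemma lin_graph_cinner:
  fixes a :: "'i \<Rightarrow> 'a::complex_inner" and b :: "'i \<Rightarrow> 'b::complex_inner"
  assumes iso: "\<And>s t. cinner (a s) (a t) = cinner (b s) (b t)"
    and "lin_graph a b x y" "lin_graph a b x' y'"
  shows "cinner x x' = cinner y y'"
proof -
  have *: "cinner x (a s) = cinner y (b s)" if "lin_graph a b x y" for x y s
    using that by induction (auto simp: iso cinner_simps)
  show ?thesis using assms(3) by induction (auto simp: *[OF assms(2)] cinner_simps)
qed

lemma lin_graph_total:
  assumes "x \<in> cspan (range a)" shows "\<exists>y. lin_graph a b x y"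
  using assms
proof (induction rule: complex_vector.span_induct)
  case base
  then show ?case
    unfolding complex_vector.subspace_def by (auto intro: lin_graph.intros)
qed (auto intro: lin_graph.intros)

definition closed_graph where
  "closed_graph a b x y \<longleftrightarrow> (\<exists>X Y. (\<forall>n::nat. lin_graph a b (X n) (Y n)) \<and> X \<longlonglongrightarrow> x \<and> Y \<longlonglongrightarrow> y)"

lemma closed_graph_swap: "closed_graph a b x y \<Longrightarrow> closed_graph b a y x"
  unfolding closed_graph_def using lin_graph_swap by metis

lemma closed_graph_total:
  fixes a :: "'i \<Rightarrow> 'a::chilbert_space" and b :: "'i \<Rightarrow> 'b::chilbert_space"
  assumes iso: "\<And>s t. cinner (a s) (a t) = cinner (b s) (b t)"
    and x: "x \<in> closure (cspan (range a))"
  shows "\<exists>y. closed_graph a b x y"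
proof -
  obtain X where X: "\<And>n. X n \<in> cspan (range a)" "X \<longlonglongrightarrow> x"
    using x unfolding closure_sequential by auto
  have "\<exists>y. lin_graph a b (X n) y" for n using lin_graph_total[OF X(1)] .
  then obtain Y where Y: "\<And>n. lin_graph a b (X n) (Y n)" by metis
  have nm: "norm (Y m - Y n) = norm (X m - X n)" for m n
    by (rule norm_eqI[OF lin_graph_cinner[OF iso lin_graph_diff[OF Y Y] lin_graph_diff[OF Y Y], symmetric]])
  have "Cauchy X" using X(2) by (rule LIMSEQ_imp_Cauchy)
  then have "Cauchy Y" unfolding Cauchy_iff nm .
  then obtain y where "Y \<longlonglongrightarrow> y" using Cauchy_convergent_iff convergent_def by blast
  with X Y show ?thesis unfolding closed_graph_def by blast
qed

text \<open>
  This yields the identification of two minimal dilations, the isometry onto the wandering subspace,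
  and the factors of a dilation.
\<close>

lemma isometric_extension:
  fixes a :: "'i \<Rightarrow> 'a::chilbert_space" and b :: "'i \<Rightarrow> 'b::chilbert_space"
  assumes iso: "\<And>s t. cinner (a s) (a t) = cinner (b s) (b t)"
    and M: "M = closure (cspan (range a))"
  obtains R where "R \<in> bounded_ops M UNIV" "\<And>s. R (a s) = b s"
    "\<And>x y. x \<in> M \<Longrightarrow> y \<in> M \<Longrightarrow> cinner (R x) (R y) = cinner x y"
    "\<And>y. y \<in> closure (cspan (range b)) \<Longrightarrow> \<exists>x\<in>M. R x = y"
proof -
  let ?G = "closed_graph a b"
  have sub: "csubspace M"
    unfolding M by (rule subspace_closure) (rule complex_vector.subspace_span)
  have ip: "cinner x x' = cinner y y'" if "?G x y" "?G x' y'" for x y x' y'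
  proof -
    obtain X Y where X: "\<And>n. lin_graph a b (X n) (Y n)" "X \<longlonglongrightarrow> x" "Y \<longlonglongrightarrow> y"
      using \<open>?G x y\<close> unfolding closed_graph_def by blast
    obtain X' Y' where X': "\<And>n. lin_graph a b (X' n) (Y' n)" "X' \<longlonglongrightarrow> x'" "Y' \<longlonglongrightarrow> y'"
      using \<open>?G x' y'\<close> unfolding closed_graph_def by blast
    have "(\<lambda>n. cinner (X n) (X' n)) \<longlonglongrightarrow> cinner x x'" by (rule tendsto_cinner[OF X(2) X'(2)])
    moreover have "(\<lambda>n. cinner (X n) (X' n)) \<longlonglongrightarrow> cinner y y'"
      unfolding lin_graph_cinner[OF iso X(1) X'(1)] by (rule tendsto_cinner[OF X(3) X'(3)])
    ultimately show ?thesis by (rule LIMSEQ_unique)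
  qed
  have Gadd: "?G (x + x') (y + y')" if "?G x y" "?G x' y'" for x y x' y'
  proof -
    obtain X Y where X: "\<And>n. lin_graph a b (X n) (Y n)" "X \<longlonglongrightarrow> x" "Y \<longlonglongrightarrow> y"
      using \<open>?G x y\<close> unfolding closed_graph_def by blast
    obtain X' Y' where X': "\<And>n. lin_graph a b (X' n) (Y' n)" "X' \<longlonglongrightarrow> x'" "Y' \<longlonglongrightarrow> y'"
      using \<open>?G x' y'\<close> unfolding closed_graph_def by blast
    show ?thesis unfolding closed_graph_def
      by (intro exI[of _ "\<lambda>n. X n + X' n"] exI[of _ "\<lambda>n. Y n + Y' n"] conjI allI
          lin_graph.add X X' tendsto_add)
  qed
  have Gscale: "?G (c *\<^sub>C x) (c *\<^sub>C y)" if "?G x y" for x y c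
  proof -
    obtain X Y where X: "\<And>n. lin_graph a b (X n) (Y n)" "X \<longlonglongrightarrow> x" "Y \<longlonglongrightarrow> y"
      using \<open>?G x y\<close> unfolding closed_graph_def by blast
    show ?thesis unfolding closed_graph_def
      by (intro exI[of _ "\<lambda>n. c *\<^sub>C X n"] exI[of _ "\<lambda>n. c *\<^sub>C Y n"] conjI allI
          lin_graph.scale X bounded_linear.tendsto[OF bounded_linear_scaleC])
  qed
  have uniq: "y = y'" if "?G x y" "?G x y'" for x y y'
  proof -
    have "cinner (y - y') (y - y') = cinner (x - x) (x - x)"
      using ip[OF that(1) that(1)] ip[OF that(1) that(2)] ip[OF that(2) that(1)] ip[OF that(2) that(2)]
      by (simp add: cinner_simps)
    then show ?thesis by simp
  qed
  define R where "R = (\<lambda>x\<in>M. THE y. ?G x y)"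
  have R: "?G x (R x)" if "x \<in> M" for x
  proof -
    obtain y where "?G x y" using closed_graph_total[of a b x, OF iso] \<open>x \<in> M\<close> unfolding M by metis
    then have "?G x (THE y. ?G x y)" using uniq by (metis theI)
    then show ?thesis using that by (simp add: R_def)
  qed
  have Req: "R x = y" if "x \<in> M" "?G x y" for x y using uniq[OF R[OF that(1)] that(2)] .
  have pres: "cinner (R x) (R y) = cinner x y" if "x \<in> M" "y \<in> M" for x y
    using ip[OF R R] that by simp
  have "R \<in> bounded_ops M UNIV"
  proof (rule bounded_opsI[where B = 1])
    show "R \<in> extensional M" by (simp add: R_def)
    fix x assume x: "x \<in> M"
    show "norm (R x) \<le> 1 * norm x" using norm_eqI[OF pres[OF x x]] by simp
    show "R (c *\<^sub>C x) = c *\<^sub>C R x" for c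
      by (rule Req[OF complex_vector.subspace_scale[OF sub x] Gscale[OF R[OF x]]])
    fix y assume y: "y \<in> M"
    show "R (x + y) = R x + R y"
      by (rule Req[OF complex_vector.subspace_add[OF sub x y] Gadd[OF R[OF x] R[OF y]]])
  qed simp
  moreover have "R (a s) = b s" for s
  proof (rule Req)
    have "a s \<in> cspan (range a)" by (intro complex_vector.span_base) simp
    then show "a s \<in> M" unfolding M by (rule subsetD[OF closure_subset])
    show "?G (a s) (b s)" unfolding closed_graph_def
      by (intro exI[of _ "\<lambda>_. a s"] exI[of _ "\<lambda>_. b s"]) (auto intro: lin_graph.intros)
  qed
  moreover have "\<exists>x\<in>M. R x = y" if y: "y \<in> closure (cspan (range b))" for y
  proof -
    obtain x where "closed_graph b a y x" using closed_graph_total[of b a y, OF iso[symmetric] y] by blast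
    then have G: "?G x y" by (rule closed_graph_swap)
    then obtain X Y where X: "\<And>n. lin_graph a b (X n) (Y n)" "X \<longlonglongrightarrow> x"
      unfolding closed_graph_def by blast
    have "p \<in> cspan (range a)" if "lin_graph a b p q" for p q
      using that by induction
        (auto intro: complex_vector.span_zero complex_vector.span_base complex_vector.span_add complex_vector.span_scale)
    then have "x \<in> M" unfolding M closure_sequential using X by blast
    then show ?thesis using Req[OF _ G] by blast
  qed
  ultimately show ?thesis using that pres by blast
qed

lemma bounded_ops_continuous_on:
  assumes f: "f \<in> bounded_ops M N" and M: "csubspace M"
  shows "continuous_on M f"
  unfolding continuous_on_sequentially using bounded_ops_tendsto[OF f M] by (auto simp: o_def)

lemma UNIV_ops_continuous_on:
  assumes f: "f \<in> operators"
  shows "continuous_on M f"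
  using continuous_on_subset[OF bounded_ops_continuous_on[OF f]] by auto

lemma continuous_on_cinner [continuous_intros]:
  fixes f g :: "'b::topological_space \<Rightarrow> 'a::complex_inner"
  shows "continuous_on M f \<Longrightarrow> continuous_on M g \<Longrightarrow> continuous_on M (\<lambda>x. cinner (f x) (g x))"
  using bounded_bilinear.continuous_on[OF bounded_bilinear_cinner] .

lemma closure_agree:
  fixes f g :: "'a::metric_space \<Rightarrow> 'b::t2_space"
  assumes f: "continuous_on (closure S) f" and g: "continuous_on (closure S) g"
    and eq: "\<And>x. x \<in> S \<Longrightarrow> f x = g x" and x: "x \<in> closure S"
  shows "f x = g x"
proof -
  obtain X where X: "\<And>n. X n \<in> S" "X \<longlonglongrightarrow> x" using x unfolding closure_sequential by auto
  have c: "X n \<in> closure S" for n using X(1) closure_subset by (rule subsetD[rotated])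
  have "(\<lambda>n. f (X n)) \<longlonglongrightarrow> f x" "(\<lambda>n. g (X n)) \<longlonglongrightarrow> g x"
    using f g X(2) x c unfolding continuous_on_sequentially o_def by auto
  then show ?thesis using LIMSEQ_unique by (simp add: eq[OF X(1)])
qed

lemma total_cinner_eqI:
  fixes x y :: "'a::chilbert_space"
  assumes tot: "closure (cspan S) = UNIV"
    and eq: "\<And>s. s \<in> S \<Longrightarrow> cinner x s = cinner y s"
  shows "x = y"
proof -
  have sp: "cinner x z = cinner y z" if "z \<in> cspan S" for z
    using that
  proof (induction rule: complex_vector.span_induct)
    case base
    show ?case unfolding complex_vector.subspace_def by (auto simp: cinner_simps)
  qed (rule eq)
  have "cinner x z = cinner y z" for z
    by (rule closure_agree[of "cspan S" "cinner x" "cinner y" z])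
       (auto intro!: continuous_intros sp simp: tot)
  then have "cinner (x - y) (x - y) = 0" by (simp add: cinner_diff_left)
  then show ?thesis by simp
qed

lemma total_ops_eqI:
  fixes f g :: "'a::chilbert_space \<Rightarrow> 'b::chilbert_space"
  assumes tot: "closure (cspan S) = UNIV"
    and f: "f \<in> operators" and g: "g \<in> operators"
    and eq: "\<And>s. s \<in> S \<Longrightarrow> f s = g s"
  shows "f = g"
proof
  fix x
  have sp: "f z = g z" if "z \<in> cspan S" for z
    using that
  proof (induction rule: complex_vector.span_induct)
    case base
    show ?case unfolding complex_vector.subspace_def
      using bounded_ops_zero[OF f] bounded_ops_zero[OF g]
      by (auto simp: UNIV_ops_add[OF f] UNIV_ops_add[OF g] UNIV_ops_scaleC[OF f] UNIV_ops_scaleC[OF g])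
  qed (rule eq)
  show "f x = g x"
    by (rule closure_agree[of "cspan S" f g])
       (auto intro!: UNIV_ops_continuous_on f g sp simp: tot)
qed

section \<open>Products, powers and monomials\<close>

lemma op_prod_simps [simp]:
  "op_prod A [] x = x" "op_prod A (j # js) x = A j (op_prod A js x)"
  "op_prod A (js @ ks) x = op_prod A js (op_prod A ks x)"
  by (induction js) (simp_all add: op_prod_def)

lemma op_prod_cong: "(\<And>j. j \<in> set js \<Longrightarrow> A j = B j) \<Longrightarrow> op_prod A js = op_prod B js"
  by (induction js) (auto simp: fun_eq_iff)

lemma op_prod_closed:
  "(\<And>j x. j \<in> set js \<Longrightarrow> x \<in> M \<Longrightarrow> A j x \<in> M) \<Longrightarrow> x \<in> M \<Longrightarrow> op_prod A js x \<in> M"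
  by (induction js) auto

lemma op_prod_commute:
  assumes "\<And>j x. j \<in> set js \<Longrightarrow> x \<in> M \<Longrightarrow> A j x \<in> M"
    and "\<And>j x. j \<in> set js \<Longrightarrow> x \<in> M \<Longrightarrow> f (A j x) = A j (f x)"
    and "\<And>x. x \<in> M \<Longrightarrow> f x \<in> M" "x \<in> M"
  shows "f (op_prod A js x) = op_prod A js (f x)"
  using assms by (induction js) (auto simp: op_prod_closed)

lemma op_prod_unfold: "op_prod A [] = id" "op_prod A (j # js) = A j \<circ> op_prod A js"
  by (simp_all add: fun_eq_iff)

lemma op_prod_rev:
  assumes "\<And>j x. j \<in> set js \<Longrightarrow> x \<in> M \<Longrightarrow> A j x \<in> M"
    and "\<And>i j x. i \<in> set js \<Longrightarrow> j \<in> set js \<Longrightarrow> x \<in> M \<Longrightarrow> A i (A j x) = A j (A i x)"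
    and "x \<in> M"
  shows "op_prod A (rev js) x = op_prod A js x"
  using assms
proof (induction js arbitrary: x)
  case (Cons j js)
  have "op_prod A (rev (j # js)) x = op_prod A js (A j x)"
    using Cons.IH[of "A j x"] Cons.prems by simp
  also have "\<dots> = A j (op_prod A js x)"
    using Cons.prems by (intro op_prod_commute[symmetric, where M = M]) auto
  finally show ?case by simp
qed simp

lemma funpow_commute_elem: "(\<And>x. f (g x) = g (f x)) \<Longrightarrow> f ((g ^^ k) x) = (g ^^ k) (f x)"
  by (induction k) auto

abbreviation op_monom :: "nat \<Rightarrow> (nat \<Rightarrow> 'a \<Rightarrow> 'a) \<Rightarrow> (nat \<Rightarrow> nat) \<Rightarrow> 'a \<Rightarrow> 'a" where
  "op_monom n A \<alpha> \<equiv> tuple_prod n (\<lambda>i. A i ^^ \<alpha> i)"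

lemma monom_add:
  assumes "commuting UNIV n A"
  shows "op_monom n A (\<lambda>i. \<alpha> i + \<beta> i) x = op_monom n A \<alpha> (op_monom n A \<beta> x)"
proof -
  have "op_prod (\<lambda>i. A i ^^ (\<alpha> i + \<beta> i)) js x
      = op_prod (\<lambda>i. A i ^^ \<alpha> i) js (op_prod (\<lambda>i. A i ^^ \<beta> i) js x)" if "set js \<subseteq> {1..n}" for js
    using that
  proof (induction js)
    case (Cons j js)
    have "A j (A i z) = A i (A j z)" if "i \<in> set js" for i z
      using assms Cons.prems that unfolding commuting_def by auto
    then have "A i ((A j ^^ \<beta> j) z) = (A j ^^ \<beta> j) (A i z)" if "i \<in> set js" for i z
      using that by (intro funpow_commute_elem) simp
    then have "(A j ^^ \<beta> j) ((A i ^^ \<alpha> i) z) = (A i ^^ \<alpha> i) ((A j ^^ \<beta> j) z)" if "i \<in> set js" for i z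
      using that by (intro funpow_commute_elem) simp
    then have "(A j ^^ \<beta> j) (op_prod (\<lambda>i. A i ^^ \<alpha> i) js z) = op_prod (\<lambda>i. A i ^^ \<alpha> i) js ((A j ^^ \<beta> j) z)" for z
      by (intro op_prod_commute[where M = UNIV]) auto
    then show ?case using Cons by (simp add: funpow_add)
  qed simp
  then show ?thesis by (simp add: atLeastLessThanSuc_atLeastAtMost del: upt_Suc)
qed

lemma monom_cong: "(\<And>i. i \<in> {1..n} \<Longrightarrow> \<alpha> i = \<beta> i) \<Longrightarrow> op_monom n A \<alpha> = op_monom n A \<beta>"
  by (rule op_prod_cong) (auto simp del: upt_Suc)

lemma monom_prefix:
  assumes "k \<le> n"
  shows "op_monom n A (\<lambda>i. if i \<le> k then 1 else 0) = op_prod A [1..<Suc k]"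
proof
  fix x
  have "[1..<Suc n] = [1..<Suc k] @ [Suc k..<Suc n]"
    using upt_add_eq_append[of 1 "Suc k" "n - k"] assms by (simp del: upt_Suc)
  moreover have "op_prod (\<lambda>i. A i ^^ (if i \<le> k then 1 else 0)) [Suc k..<Suc n] = op_prod (\<lambda>i z. z) [Suc k..<Suc n]"
    by (rule op_prod_cong) (auto simp del: upt_Suc)
  moreover have "op_prod (\<lambda>i z. z) js y = y" for js :: "nat list" and y :: 'a by (induction js) auto
  moreover have "op_prod (\<lambda>i. A i ^^ (if i \<le> k then 1 else 0)) [1..<Suc k] = op_prod A [1..<Suc k]"
    by (rule op_prod_cong) (auto simp del: upt_Suc)
  ultimately show "op_monom n A (\<lambda>i. if i \<le> k then 1 else 0) x = op_prod A [1..<Suc k] x"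
    by (simp del: upt_Suc)
qed

lemma monom_one: "op_monom n A (\<lambda>i. 1) = tuple_prod n A"
  by simp

lemma monom_zero: "op_monom n A (\<lambda>i. 0) x = x"
proof -
  have "op_prod (\<lambda>i. A i ^^ 0) js x = x" for js by (induction js) auto
  then show ?thesis .
qed

lemma monom_single:
  assumes "j \<in> {1..n}"
  shows "op_monom n A (\<lambda>i. if i = j then 1 else 0) = A j"
proof
  fix x
  have "op_prod (\<lambda>i. A i ^^ (if i = j then 1 else 0)) js x = (if j \<in> set js then A j x else x)" if "distinct js" for js
    using that by (induction js) auto
  from this[of "[1..<Suc n]"] show "op_monom n A (\<lambda>i. if i = j then 1 else 0) x = A j x"
    using assms by (simp del: upt_Suc)
qed

lemma monom_const:
  assumes "commuting UNIV n A"
  shows "op_monom n A (\<lambda>i. m) = tuple_prod n A ^^ m"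
proof
  fix x show "op_monom n A (\<lambda>i. m) x = (tuple_prod n A ^^ m) x"
  proof (induction m)
    case 0 show ?case by (simp only: monom_zero) simp
  next
    case (Suc m)
    have "op_monom n A (\<lambda>i. Suc m) x = op_monom n A (\<lambda>i. 1) (op_monom n A (\<lambda>i. m) x)"
      using monom_add[OF assms, of "\<lambda>_. 1" "\<lambda>_. m" x] by (simp only: plus_1_eq_Suc)
    also have "\<dots> = tuple_prod n A ((tuple_prod n A ^^ m) x)" by (simp only: Suc monom_one)
    finally show ?case by (simp only: funpow.simps o_def)
  qed
qed

lemma int_pow_step:
  assumes "bij V" shows "int_pow V (k + 1) x = V (int_pow V k x)"
proof (cases "k \<ge> 0")
  case True
  then show ?thesis by (simp add: int_pow_def nat_add_distrib)
next
  case False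
  then obtain m where m: "nat (- k) = Suc m" by (metis not0_implies_Suc nat_0_iff neg_0_less_iff_less not_le zero_less_nat_eq less_irrefl)
  then have k: "k = - int (Suc m)" by simp
  show ?thesis
  proof (cases m)
    case 0
    then show ?thesis unfolding k using assms by (simp add: int_pow_def bij_is_surj surj_f_inv_f)
  next
    case (Suc l)
    then show ?thesis unfolding k using assms by (simp add: int_pow_def bij_is_surj surj_f_inv_f nat_add_distrib)
  qed
qed

lemma int_pow_simps [simp]: "int_pow V 0 x = x" "int_pow V 1 x = V x" "int_pow V (int m) x = (V ^^ m) x"
  by (simp_all add: int_pow_def)

lemma int_pow_add:
  assumes "bij V" shows "int_pow V (k + l) x = int_pow V k (int_pow V l x)"
proof (induction k rule: int_induct[of _ 0])
  case (step1 i)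
  then show ?case using int_pow_step[OF assms, of "i + l" x] int_pow_step[OF assms, of i]
    by (simp add: ac_simps)
next
  case (step2 i)
  have "V (int_pow V (i - 1 + l) x) = V (int_pow V (i - 1) (int_pow V l x))"
    using int_pow_step[OF assms, of "i - 1 + l" x] int_pow_step[OF assms, of "i - 1"] step2(2) by simp
  then show ?case using assms by (meson bij_is_inj injD)
qed simp

lemma int_pow_commute:
  assumes "bij V" and c: "\<And>x. f (V x) = V (f x)"
  shows "f (int_pow V k x) = int_pow V k (f x)"
proof (induction k rule: int_induct[of _ 0])
  case (step1 i)
  then show ?case by (simp add: int_pow_step[OF assms(1)] c)
next
  case (step2 i)
  have "V (f (int_pow V (i - 1) x)) = V (int_pow V (i - 1) (f x))"
    using int_pow_step[OF assms(1), of "i - 1"] step2(2) by (simp flip: c)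
  then show ?case using assms by (meson bij_is_inj injD)
qed simp

section \<open>Unitary dilations\<close>

lemma isometric_embedding_cinner:
  assumes "isometric_embedding J" shows "cinner (J x) (J y) = cinner x y"
  using assms isometric_cinner[of J UNIV UNIV x y] by (auto simp: isometric_embedding_def)

text \<open>
  The projection of \<open>y\<close> onto the range of \<open>J\<close> exists because it is \<open>J J\<^sup>* y\<close>.
\<close>

lemma orth_proj_isometry:
  assumes J: "isometric_embedding J"
  shows "orth_proj (range J) y = J a \<longleftrightarrow> (\<forall>h. cinner (y - J a) (J h) = 0)"
proof -
  note Jo = J[unfolded isometric_embedding_def, THEN conjunct1]
  have uniq: "p = q" if pq: "p \<in> range J" "q \<in> range J"
    and *: "\<forall>z\<in>range J. cinner (y - p) z = 0" "\<forall>z\<in>range J. cinner (y - q) z = 0" for p q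
  proof -
    obtain u v where uv: "p = J u" "q = J v" using pq by auto
    have d: "p - q \<in> range J" unfolding uv by (simp flip: UNIV_ops_diff[OF Jo])
    have "cinner (p - q) (p - q) = cinner (y - q) (p - q) - cinner (y - p) (p - q)"
      by (simp add: cinner_diff_left)
    also have "\<dots> = 0" using bspec[OF *(1) d] bspec[OF *(2) d] by simp
    finally show ?thesis by simp
  qed
  define b where "b = adj UNIV UNIV J y"
  have b: "\<forall>z\<in>range J. cinner (y - J b) z = 0"
    unfolding b_def using isometric_embedding_cinner[OF J] adj_UNIV_cinner'[OF Jo, of y]
    by (auto simp: cinner_diff_left)
  have the: "orth_proj (range J) y = J b"
    unfolding orth_proj_def by (rule the_equality) (use b uniq in \<open>blast+\<close>)
  have "J b = J a" if "\<forall>h. cinner (y - J a) (J h) = 0"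
    by (rule uniq) (use b that in blast)+
  moreover have "\<forall>h. cinner (y - J a) (J h) = 0" if "J b = J a"
    using b unfolding that by blast
  ultimately show ?thesis unfolding the by blast
qed

lemma unitary_dilation_moment:
  assumes "unitary_dilation J n W T"
  shows "cinner (op_monom n W \<alpha> (J h)) (J h') = cinner (op_monom n T \<alpha> h) h'"
proof -
  have J: "isometric_embedding J" and
    eq: "orth_proj (range J) (op_monom n W \<alpha> (J h)) = J (op_monom n T \<alpha> h)"
    using assms unfolding unitary_dilation_def by simp_all
  show ?thesis
    using eq unfolding orth_proj_isometry[OF J]
    by (simp add: cinner_diff_left isometric_embedding_cinner[OF J] del: upt_Suc)
qed

lemma
  assumes "unitary UNIV UNIV V"
  shows unitary_UNIV_ops: "V \<in> operators"
    and unitary_UNIV_cinner: "cinner (V x) (V y) = cinner x y"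
    and unitary_UNIV_bij: "bij V"
proof -
  show "V \<in> operators" using assms by (simp add: unitary_def)
  show "cinner (V x) (V y) = cinner x y" using unitary_cinner[of UNIV UNIV V x y] assms by simp
  show "bij V" using assms unfolding unitary_def by (intro o_bij[of "adj UNIV UNIV V"]) auto
qed

locale min_dilation =
  fixes J :: "'h::chilbert_space \<Rightarrow> 'k::chilbert_space" and V :: "'k \<Rightarrow> 'k" and T :: "'h \<Rightarrow> 'h"
  assumes contr: "contraction T" and dil: "minimal_unitary_dilation_single J V T"
begin

lemma dilates: "unitary_dilation J 1 (\<lambda>_. V) (\<lambda>_. T)"
  using dil by (simp add: minimal_unitary_dilation_def)

lemma J_iso: "isometric_embedding J"
  using dilates by (simp add: unitary_dilation_def)

lemmas J_cinner [simp] = isometric_embedding_cinner[OF J_iso]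

lemma V_unitary: "unitary UNIV UNIV V"
  using dilates by (simp add: unitary_dilation_def)

lemmas V_ops = unitary_UNIV_ops[OF V_unitary]
  and V_cinner [simp] = unitary_UNIV_cinner[OF V_unitary]
  and V_bij = unitary_UNIV_bij[OF V_unitary]

lemma V_pow_moment: "cinner ((V ^^ m) (J h)) (J h') = cinner ((T ^^ m) h) h'"
  using unitary_dilation_moment[OF dilates, of "\<lambda>_. m" h h'] by simp

abbreviation v :: "int \<Rightarrow> 'k \<Rightarrow> 'k" where "v \<equiv> int_pow V"

lemma v_add: "v (k + l) x = v k (v l x)" by (rule int_pow_add[OF V_bij])

lemma v_cancel [simp]: "v k (v (- k) x) = x" "v (- k) (v k x) = x"
  by (simp_all flip: v_add)

lemma v_V: "v k (V x) = v (k + 1) x" "V (v k x) = v (k + 1) x"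
  using v_add[of k 1 x] v_add[of 1 k x] by (simp_all add: add.commute)

lemma v_cinner [simp]: "cinner (v k x) (v k y) = cinner x y"
proof (induction k rule: int_induct[of _ 0])
  case (step1 i)
  then show ?case by (simp flip: v_V(2))
next
  case (step2 i)
  then show ?case using V_cinner[of "v (i - 1) x" "v (i - 1) y"] by (simp add: v_V(2))
qed simp

lemma v_shift: "cinner (v k x) y = cinner x (v (- k) y)"
  using v_cinner[of k x "v (- k) y"] by simp

lemma v_linear: "v k (x + y) = v k x + v k y \<and> v k (c *\<^sub>C x) = c *\<^sub>C v k x"
proof -
  have sh: "cinner z (v k y) = cinner (v (- k) z) y" for z y using v_shift[of "- k" z y] by simp
  have "cinner z (v k (x + y)) = cinner z (v k x + v k y)"
    "cinner z (v k (c *\<^sub>C x)) = cinner z (c *\<^sub>C v k x)" for z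
    by (simp_all add: cinner_simps sh)
  then show ?thesis by (auto intro: cinner_eqI)
qed

lemma v_norm: "norm (v k x) = norm x"
  by (rule norm_eqI) simp

lemma v_ops: "v k \<in> operators"
  by (rule bounded_opsI[where B = 1]) (auto simp: v_linear v_norm)

lemma v_diff: "v k (x - y) = v k x - v k y" by (rule UNIV_ops_diff[OF v_ops])

lemma v_0: "v k 0 = 0" using v_diff[of k 0 0] by simp

lemma total: "closure (cspan (range (\<lambda>(k, h). v k (J h)))) = UNIV"
proof -
  have "{tuple_prod 1 (\<lambda>i. int_pow V (t i)) (J h) | (t :: nat \<Rightarrow> int) h. True}
      = range (\<lambda>(k, h). v k (J h))"
    by auto
  then show ?thesis using dil by (simp add: minimal_unitary_dilation_def)
qed

lemma eqI:
  assumes "\<And>k h. cinner x (v k (J h)) = cinner y (v k (J h))" shows "x = y"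
  by (rule total_cinner_eqI[OF total]) (use assms in auto)

lemma ops_eqI:
  assumes "f \<in> operators" "g \<in> operators"
    and "\<And>k h. f (v k (J h)) = g (v k (J h))"
  shows "f = g"
  by (rule total_ops_eqI[OF total assms(1,2)]) (use assms(3) in auto)

subsection \<open>Factorizations of the dilation\<close>

text \<open>
  \<open>R\<close> and \<open>R'\<close> are commuting isometric factors of \<open>V\<close> that dilate \<open>S\<close> and \<open>S'\<close> along the powers of
  \<open>T\<close>. The second factor is kept because it computes the adjoint of the first: \<open>R\<^sup>* V = R'\<close>.
\<close>

definition factor_pair :: "('k \<Rightarrow> 'k) \<Rightarrow> ('k \<Rightarrow> 'k) \<Rightarrow> ('h \<Rightarrow> 'h) \<Rightarrow> ('h \<Rightarrow> 'h) \<Rightarrow> bool" where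
  "factor_pair R R' S S' \<longleftrightarrow>
     (R \<in> operators \<and> R' \<in> operators) \<and>
     (\<forall>x y. cinner (R x) (R y) = cinner x y \<and> cinner (R' x) (R' y) = cinner x y) \<and>
     (\<forall>x. R (R' x) = V x \<and> R' (R x) = V x) \<and>
     (\<forall>h. S (T h) = T (S h) \<and> S' (T h) = T (S' h)) \<and>
     (\<forall>m h h'. cinner (R ((V ^^ m) (J h))) (J h') = cinner (S ((T ^^ m) h)) h' \<and>
        cinner (R' ((V ^^ m) (J h))) (J h') = cinner (S' ((T ^^ m) h)) h')"

lemma factor_pair_swap: "factor_pair R R' S S' \<Longrightarrow> factor_pair R' R S' S"
  by (auto simp: factor_pair_def)

text \<open>
  With this pair the results on factors specialize to statements about \<open>V\<close> alone.
\<close>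

lemma factor_pair_trivial: "factor_pair (\<lambda>x. x) V (\<lambda>h. h) T"
proof -
  have "(\<lambda>x::'k. x) \<in> operators" by (rule bounded_opsI[where B = 1]) auto
  moreover have "cinner (V ((V ^^ m) (J h))) (J h') = cinner (T ((T ^^ m) h)) h'" for m h h'
    using V_pow_moment[of "Suc m" h h'] by simp
  ultimately show ?thesis unfolding factor_pair_def by (auto simp: V_ops V_pow_moment)
qed

context
  fixes R R' S S' assumes fp: "factor_pair R R' S S'"
begin

lemma fp_ops: "R \<in> operators" and fp_cinner [simp]: "cinner (R x) (R y) = cinner x y"
  and fp_prod [simp]: "R (R' x) = V x" "R' (R x) = V x" and fp_ST: "S (T h) = T (S h)"
  using fp by (auto simp: factor_pair_def)

lemma fp_commute_V: "R (V x) = V (R x)" by (metis fp_prod)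

lemma fp_commute: "R (v k x) = v k (R x)" by (rule int_pow_commute[OF V_bij]) (rule fp_commute_V)

lemma fp_moment_nonneg: "cinner (R (v (int m) (J h))) (J h') = cinner (S ((T ^^ m) h)) h'"
  using fp by (simp add: factor_pair_def)

text \<open>
  Apply \<open>R'\<close> to both sides and cancel one factor \<open>V = R' R\<close>.
\<close>

lemma fp_moment_neg: "cinner (R (J h)) (v (int m + 1) (J h')) = cinner h (S' ((T ^^ m) h'))"
proof -
  have fp': "factor_pair R' R S' S" using fp by (rule factor_pair_swap)
  have iso: "cinner (R' x) (R' y) = cinner x y" for x y using fp by (simp add: factor_pair_def)
  have comm: "R' (V x) = V (R' x)" for x by (metis fp_prod)
  have "cinner (R (J h)) (v (int m + 1) (J h')) = cinner (R' (R (J h))) (R' (V (v (int m) (J h'))))"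
    unfolding iso v_V(2) ..
  also have "\<dots> = cinner (J h) (R' (v (int m) (J h')))" by (simp add: comm)
  also have "\<dots> = cinner h (S' ((T ^^ m) h'))"
  proof -
    have "cinner (R' (v (int m) (J h'))) (J h) = cinner (S' ((T ^^ m) h')) h"
      using fp by (simp add: factor_pair_def)
    then show ?thesis by (metis cinner_commute)
  qed
  finally show ?thesis .
qed

text \<open>
  Cancelling powers of \<open>V\<close> reduces to the two preceding lemmas. The right-hand side does not involve
  the dilation, which is the source of all uniqueness statements.
\<close>

lemma fp_moment:
  "cinner (R (v k (J h))) (v l (J h')) =
     (if k \<ge> l then cinner (S ((T ^^ nat (k - l)) h)) h' else cinner h (S' ((T ^^ nat (l - k - 1)) h')))"
proof (cases "k \<ge> l")
  case True
  have "cinner (R (v k (J h))) (v l (J h')) = cinner (v (- l) (R (v k (J h)))) (J h')"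
    using v_shift[of "- l"] by simp
  also have "v (- l) (R (v k (J h))) = R (v (int (nat (k - l))) (J h))"
    using True by (simp flip: fp_commute v_add)
  finally show ?thesis using True fp_moment_nonneg[of "nat (k - l)" h h'] by simp
next
  case False
  have "cinner (R (v k (J h))) (v l (J h')) = cinner (R (J h)) (v (- k) (v l (J h')))"
    unfolding fp_commute by (rule v_shift)
  also have "v (- k) (v l (J h')) = v (int (nat (l - k - 1)) + 1) (J h')"
    using False by (simp flip: v_add)
  finally show ?thesis using False fp_moment_neg[of h "nat (l - k - 1)" h'] by simp
qed

end

lemma factor_pair_unique:
  assumes "factor_pair R R' S S'" "factor_pair Q Q' S S'" shows "R = Q"
proof (rule ops_eqI[OF fp_ops fp_ops])
  show "R (v k (J h)) = Q (v k (J h))" for k h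
    by (rule eqI) (simp only: fp_moment[OF assms(1)] fp_moment[OF assms(2)])
qed (rule assms)+

end

text \<open>
  The isometry \<open>V\<^sup>k J h \<mapsto> V'\<^sup>k J' h\<close> intertwines all pairs of factors with the same compressions,
  because their moments agree.
\<close>

lemma factor_pair_transport:
  fixes J :: "'h::chilbert_space \<Rightarrow> 'k::chilbert_space" and J' :: "'h \<Rightarrow> 'l::chilbert_space"
  assumes d: "min_dilation J V T" and d': "min_dilation J' V' T"
  obtains \<rho> where "unitary UNIV UNIV \<rho>"
    "\<And>R R' Q Q' S S' x. min_dilation.factor_pair J V T R R' S S' \<Longrightarrow>
       min_dilation.factor_pair J' V' T Q Q' S S' \<Longrightarrow> \<rho> (R x) = Q (\<rho> x)"
proof -
  interpret A: min_dilation J V T by (rule d)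
  interpret B: min_dilation J' V' T by (rule d')
  let ?a = "\<lambda>(k, h). A.v k (J h)" and ?b = "\<lambda>(k, h). B.v k (J' h)"
  have "cinner (?a s) (?a t) = cinner (?b s) (?b t)" for s t
    using A.fp_moment[OF A.factor_pair_trivial] B.fp_moment[OF B.factor_pair_trivial]
    by (cases s, cases t) simp
  from isometric_extension[of ?a ?b, OF this A.total[symmetric]]
  obtain \<rho> where \<rho>: "\<rho> \<in> operators" "\<And>s. \<rho> (?a s) = ?b s"
    "\<And>x y. cinner (\<rho> x) (\<rho> y) = cinner x y" "\<And>y. \<exists>x. \<rho> x = y"
    by (auto simp: B.total)
  have U: "unitary UNIV UNIV \<rho>" using \<rho> by (intro unitaryI) auto
  have \<rho>v: "\<rho> (A.v k (J h)) = B.v k (J' h)" for k h using \<rho>(2)[of "(k, h)"] by simp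
  have "\<rho> (R x) = Q (\<rho> x)" if R: "A.factor_pair R R' S S'" and Q: "B.factor_pair Q Q' S S'" for R R' S S' Q Q' x
  proof -
    have "(\<lambda>x. \<rho> (R x)) = (\<lambda>x. Q (\<rho> x))"
    proof (rule A.ops_eqI[OF UNIV_ops_comp[OF A.fp_ops[OF R] \<rho>(1)] UNIV_ops_comp[OF \<rho>(1) B.fp_ops[OF Q]]])
      fix k h
      show "\<rho> (R (A.v k (J h))) = Q (\<rho> (A.v k (J h)))"
      proof (rule B.eqI)
        fix l h'
        have "cinner (\<rho> (R (A.v k (J h)))) (B.v l (J' h')) = cinner (R (A.v k (J h))) (A.v l (J h'))"
          unfolding \<rho>v[symmetric] by (rule \<rho>(3))
        also have "\<dots> = cinner (Q (B.v k (J' h))) (B.v l (J' h'))"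
          unfolding A.fp_moment[OF R] B.fp_moment[OF Q] ..
        finally show "cinner (\<rho> (R (A.v k (J h)))) (B.v l (J' h')) = cinner (Q (\<rho> (A.v k (J h)))) (B.v l (J' h'))"
          unfolding \<rho>v .
      qed
    qed
    then show ?thesis by (rule fun_cong)
  qed
  with U show ?thesis using that by blast
qed

lemma monom_ops:
  assumes "\<And>i. i \<in> {1..n} \<Longrightarrow> W i \<in> operators"
  shows "op_monom n W \<alpha> \<in> operators"
proof -
  have id: "(\<lambda>x::'a. x) \<in> operators" by (rule bounded_opsI[where B = 1]) auto
  have pow: "f ^^ k \<in> operators" if "f \<in> operators" for f :: "'a \<Rightarrow> 'a" and k
  proof (induction k)
    case 0 show ?case using id by (simp add: id_def)
  next
    case (Suc k) then show ?case using UNIV_ops_comp[OF Suc that] by (simp add: o_def)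
  qed
  have "op_prod (\<lambda>i. W i ^^ \<alpha> i) js \<in> operators" if "set js \<subseteq> {1..n}" for js
    using that
  proof (induction js)
    case Nil then show ?case using id by (simp add: op_prod_def id_def)
  next
    case (Cons j js)
    then have "W j \<in> operators" "op_prod (\<lambda>i. W i ^^ \<alpha> i) js \<in> operators"
      by (auto intro: assms)
    then have "(\<lambda>x. (W j ^^ \<alpha> j) (op_prod (\<lambda>i. W i ^^ \<alpha> i) js x)) \<in> operators"
      using UNIV_ops_comp pow by blast
    then show ?case by (simp add: op_prod_def o_def)
  qed
  then show ?thesis by (simp add: atLeastLessThanSuc_atLeastAtMost del: upt_Suc)
qed

lemma monom_cinner:
  assumes "\<And>i x y. i \<in> {1..n} \<Longrightarrow> cinner (W i x) (W i y) = cinner x y"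
  shows "cinner (op_monom n W \<alpha> x) (op_monom n W \<alpha> y) = cinner x y"
proof -
  have "cinner ((W i ^^ k) x) ((W i ^^ k) y) = cinner x y" if "i \<in> {1..n}" for i k x y
    using assms[OF that] by (induction k) auto
  then have "cinner (op_prod (\<lambda>i. W i ^^ \<alpha> i) js x) (op_prod (\<lambda>i. W i ^^ \<alpha> i) js y) = cinner x y"
    if "set js \<subseteq> {1..n}" for js
    using that by (induction js) auto
  then show ?thesis by (simp add: atLeastLessThanSuc_atLeastAtMost del: upt_Suc)
qed

text \<open>
  A sub-product of a dilating tuple is a factor of the full product. The complementary exponents
  provide the other factor. Single members of the tuple and initial products are both of this form.
\<close>

lemma monom_factor_pair:
  assumes d: "min_dilation J V (tuple_prod n T)" and W: "unitary_dilation J n W T"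
    and V: "V = tuple_prod n W" and T: "commuting UNIV n T"
    and \<alpha>: "\<And>i. i \<in> {1..n} \<Longrightarrow> \<alpha> i \<le> 1"
  shows "min_dilation.factor_pair J V (tuple_prod n T) (op_monom n W \<alpha>) (op_monom n W (\<lambda>i. 1 - \<alpha> i))
     (op_monom n T \<alpha>) (op_monom n T (\<lambda>i. 1 - \<alpha> i))"
proof -
  interpret min_dilation J V "tuple_prod n T" by (rule d)
  have Wu: "\<And>i. i \<in> {1..n} \<Longrightarrow> unitary UNIV UNIV (W i)" and Wc: "commuting UNIV n W"
    using W by (auto simp: unitary_dilation_def)
  have ops: "op_monom n W \<beta> \<in> operators" for \<beta>
    using Wu by (intro monom_ops) (auto simp: unitary_def)
  have iso: "cinner (op_monom n W \<beta> x) (op_monom n W \<beta> y) = cinner x y" for \<beta> x y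
    by (intro monom_cinner unitary_UNIV_cinner Wu)
  have prod: "op_monom n A \<beta> (op_monom n A \<gamma> x) = tuple_prod n A x"
    if "commuting UNIV n A" "\<And>i. i \<in> {1..n} \<Longrightarrow> \<beta> i + \<gamma> i = 1" for A :: "nat \<Rightarrow> 'c \<Rightarrow> 'c" and \<beta> \<gamma> x
  proof -
    have "op_monom n A \<beta> (op_monom n A \<gamma> x) = op_monom n A (\<lambda>i. \<beta> i + \<gamma> i) x"
      by (rule monom_add[OF that(1), symmetric])
    also have "op_monom n A (\<lambda>i. \<beta> i + \<gamma> i) = op_monom n A (\<lambda>i. 1)" by (rule monom_cong) (rule that(2))
    finally show ?thesis by (simp only: monom_one)
  qed
  have mT: "op_monom n T \<beta> (tuple_prod n T h) = tuple_prod n T (op_monom n T \<beta> h)" for \<beta> h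
  proof -
    have "op_monom n T \<beta> (op_monom n T (\<lambda>i. 1) h) = op_monom n T (\<lambda>i. 1) (op_monom n T \<beta> h)"
      unfolding monom_add[OF T, symmetric] by (simp only: add.commute)
    then show ?thesis unfolding monom_one .
  qed
  have mom: "cinner (op_monom n W \<beta> ((V ^^ m) (J h))) (J h') = cinner (op_monom n T \<beta> ((tuple_prod n T ^^ m) h)) h'" for \<beta> m h h'
    unfolding V monom_const[OF Wc, symmetric] monom_const[OF T, symmetric]
      monom_add[OF Wc, symmetric] monom_add[OF T, symmetric]
    by (rule unitary_dilation_moment[OF W])
  have "\<alpha> i + (1 - \<alpha> i) = 1" "1 - \<alpha> i + \<alpha> i = 1" if "i \<in> {1..n}" for i using \<alpha>[OF that] by auto
  then show ?thesis
    unfolding factor_pair_def using ops iso mom mT prod[OF Wc] V by (simp del: upt_Suc)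
qed

section \<open>The wandering subspace\<close>

context min_dilation
begin

abbreviation D where "D \<equiv> defect T"
abbreviation DT where "DT \<equiv> defect_space T"

lemmas D_ops = defect_ops[OF contr]
  and D_sym = defect_symmetric[OF contr]
  and D_cinner = cinner_defect[OF contr]
  and DT_sub = subspace_defect_space[OF contr]
  and DT_closed = closed_defect_space[of T]
  and D_mem [simp] = defect_space_mem[of T]

lemma DT_closure: "DT = closure (range D)" by (simp add: defect_space_def)

lemma DT_span: "DT = closure (cspan (range D))"
proof -
  have "csubspace (range D)"
    unfolding complex_vector.subspace_def
    using bounded_ops_zero[OF D_ops] UNIV_ops_add[OF D_ops, symmetric] UNIV_ops_scaleC[OF D_ops, symmetric]
    by auto
  then show ?thesis unfolding DT_closure by (simp only: complex_vector.span_eq_iff[THEN iffD2])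
qed

lemma DT_agree:
  fixes f g :: "'h \<Rightarrow> 'c::t2_space"
  assumes "continuous_on DT f" "continuous_on DT g" "\<And>h. f (D h) = g (D h)" "x \<in> DT"
  shows "f x = g x"
  using closure_agree[of "range D" f g x] assms unfolding DT_closure by auto

lemma wandering_isometry:
  "\<exists>L. L \<in> bounded_ops DT UNIV \<and> (\<forall>h. L (D h) = V (J h) - J (T h)) \<and>
     (\<forall>x\<in>DT. \<forall>y\<in>DT. cinner (L x) (L y) = cinner x y)"
proof -
  have "cinner (V (J h)) (J (T h')) = cinner (T h) (T h')" for h h'
    using V_pow_moment[of 1 h "T h'"] by simp
  moreover from this have "cinner (J (T h)) (V (J h')) = cinner (T h) (T h')" for h h'
    by (metis cinner_commute)
  ultimately have "cinner (D h) (D h') = cinner (V (J h) - J (T h)) (V (J h') - J (T h'))" for h h'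
    by (simp add: D_cinner cinner_simps)
  from isometric_extension[of D "\<lambda>h. V (J h) - J (T h)", OF this DT_span] show ?thesis by metis
qed

text \<open>
  The isometry of the defect space onto the wandering subspace. \<open>Lam_adj\<close> below is its adjoint.
\<close>

definition Lam :: "'h \<Rightarrow> 'k" where
  "Lam = (SOME L. L \<in> bounded_ops DT UNIV \<and> (\<forall>h. L (D h) = V (J h) - J (T h)) \<and>
     (\<forall>x\<in>DT. \<forall>y\<in>DT. cinner (L x) (L y) = cinner x y))"

lemma Lam_ops: "Lam \<in> bounded_ops DT UNIV"
  and Lam_D: "Lam (D h) = V (J h) - J (T h)"
  and Lam_cinner: "x \<in> DT \<Longrightarrow> y \<in> DT \<Longrightarrow> cinner (Lam x) (Lam y) = cinner x y"
proof -
  from someI_ex[OF wandering_isometry] show "Lam \<in> bounded_ops DT UNIV"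
    "Lam (D h) = V (J h) - J (T h)" "x \<in> DT \<Longrightarrow> y \<in> DT \<Longrightarrow> cinner (Lam x) (Lam y) = cinner x y"
    unfolding Lam_def by blast+
qed

definition Lam_adj :: "'k \<Rightarrow> 'h" where "Lam_adj = adj DT UNIV Lam"

lemma Lam_adj_mem [simp]: "Lam_adj y \<in> DT"
  unfolding Lam_adj_def by (rule adj_mem[OF DT_sub DT_closed Lam_ops]) simp

lemma Lam_adj_cinner: "z \<in> DT \<Longrightarrow> cinner (Lam z) y = cinner z (Lam_adj y)"
  unfolding Lam_adj_def by (rule adj_cinner[OF DT_sub DT_closed Lam_ops]) simp_all

lemma Lam_adj_cinner': "z \<in> DT \<Longrightarrow> cinner y (Lam z) = cinner (Lam_adj y) z"
  by (metis Lam_adj_cinner cinner_commute)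

lemma Lam_adj_ops: "Lam_adj \<in> bounded_ops UNIV DT"
  unfolding Lam_adj_def by (rule adj_bounded_ops[OF DT_sub DT_closed _ Lam_ops]) simp

lemma Lam_adj_add: "Lam_adj (x + y) = Lam_adj x + Lam_adj y"
  using bounded_ops_add[OF Lam_adj_ops] by simp

lemma Lam_adj_diff: "Lam_adj (x - y) = Lam_adj x - Lam_adj y"
  using bounded_ops_diff[OF Lam_adj_ops] by simp

lemma DT_eqI: "x \<in> DT \<Longrightarrow> y \<in> DT \<Longrightarrow> (\<And>z. z \<in> DT \<Longrightarrow> cinner z x = cinner z y) \<Longrightarrow> x = y"
  by (rule cinner_ext[OF DT_sub])

lemma Lam_continuous: "continuous_on DT Lam"
  by (rule bounded_ops_continuous_on[OF Lam_ops DT_sub])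

lemma v_continuous: "continuous_on M f \<Longrightarrow> continuous_on M (\<lambda>x. v k (f x))"
  by (rule continuous_on_compose2[OF UNIV_ops_continuous_on[OF v_ops, of UNIV]]) auto

text \<open>
  The wandering subspace is orthogonal to the past \<open>V\<^sup>-\<^sup>m J h\<close>: on \<open>Lam (D h) = V J h - J T h\<close> this is the
  dilation property, and it extends by density.
\<close>

lemma Lam_orth_J:
  assumes "x \<in> DT" shows "cinner (Lam x) (v (- int m) (J h')) = 0"
proof -
  have *: "cinner (Lam (D h)) (v (- int m) (J h')) = 0" for h
  proof -
    have "cinner (Lam (D h)) (v (- int m) (J h')) = cinner (v (int m) (Lam (D h))) (J h')"
      by (rule v_shift[symmetric])
    also have "v (int m) (Lam (D h)) = (V ^^ Suc m) (J h) - (V ^^ m) (J (T h))"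
      unfolding Lam_D v_diff by (simp add: funpow_swap1)
    finally show ?thesis
      using V_pow_moment[of "Suc m" h h'] V_pow_moment[of m "T h" h'] by (simp add: cinner_diff_left funpow_swap1)
  qed
  have c: "continuous_on DT (\<lambda>x. cinner (Lam x) (v (- int m) (J h')))"
    by (intro continuous_intros Lam_continuous)
  show ?thesis by (rule DT_agree[OF c continuous_on_const * assms])
qed

lemma Lam_orth_neg:
  assumes "x \<in> DT" "y \<in> DT" "m > 0" shows "cinner (Lam y) (v (- int m) (Lam x)) = 0"
proof -
  have *: "cinner (Lam y) (v (- int m) (Lam (D h))) = 0" for h
  proof -
    obtain l where m: "m = Suc l" using assms(3) by (cases m) auto
    have "v (- int m) (Lam (D h)) = v (- int l) (J h) - v (- int m) (J (T h))"
      unfolding Lam_D v_diff v_V m by simp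
    then show ?thesis using Lam_orth_J[OF assms(2)] by (simp add: cinner_diff_right)
  qed
  have c: "continuous_on DT (\<lambda>x. cinner (Lam y) (v (- int m) (Lam x)))"
    by (intro continuous_intros Lam_continuous v_continuous)
  show ?thesis by (rule DT_agree[OF c continuous_on_const * assms(1)])
qed

lemma Lam_orth:
  assumes "x \<in> DT" "y \<in> DT" "k \<noteq> 0" shows "cinner (Lam x) (v k (Lam y)) = 0"
proof (cases "k < 0")
  case True
  then show ?thesis using Lam_orth_neg[OF assms(2,1), of "nat (- k)"] by simp
next
  case False
  have "cinner (v k (Lam y)) (Lam x) = 0"
    using Lam_orth_neg[OF assms(1,2), of "nat k"] False assms(3) unfolding v_shift by simp
  then show ?thesis using cinner_commute[of "Lam x"] by simp
qed

lemma Lam_adj_Lam [simp]: "x \<in> DT \<Longrightarrow> Lam_adj (Lam x) = x"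
  by (rule DT_eqI) (auto simp: Lam_cinner simp flip: Lam_adj_cinner)

lemma Lam_adj_v_Lam: "x \<in> DT \<Longrightarrow> k \<noteq> 0 \<Longrightarrow> Lam_adj (v k (Lam x)) = 0"
  by (rule DT_eqI) (auto simp: Lam_orth complex_vector.subspace_0[OF DT_sub] simp flip: Lam_adj_cinner)

text \<open>
  In \<open>V\<^sup>m\<^sup>+\<^sup>1 J h = V\<^sup>m (J T h) + V\<^sup>m (Lam (D h))\<close> the last term does not contribute for \<open>m > 0\<close>, so that
  each power of \<open>V\<close> but one can be replaced by a power of \<open>T\<close>.
\<close>

lemma Lam_v_J:
  assumes "x \<in> DT"
  shows "cinner (Lam x) (v (int m + 1) (J h)) = cinner (Lam x) (V (J ((T ^^ m) h)))"
proof (induction m arbitrary: h)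
  case (Suc m)
  have "v (int (Suc m) + 1) (J h) = v (int m + 1) (Lam (D h)) + v (int m + 1) (J (T h))"
    unfolding Lam_D v_diff v_V by (simp add: ac_simps)
  then have "cinner (Lam x) (v (int (Suc m) + 1) (J h)) = cinner (Lam x) (v (int m + 1) (J (T h)))"
    using Lam_orth[OF assms D_mem, of "int m + 1"] by (simp add: cinner_add_right)
  then show ?case unfolding Suc by (simp add: funpow_swap1)
qed simp

text \<open>
  Both conditions hold for all \<open>Lam x\<close>. Together with the values on \<open>V J g\<close>, which \<open>Lam_adj y\<close>
  controls, they determine the inner products with a spanning set.
\<close>

lemma range_Lam_criterion:
  assumes past: "\<And>m h. cinner y (v (- int m) (J h)) = 0"
    and future: "\<And>m h. cinner y (v (int m + 1) (J h)) = cinner y (V (J ((T ^^ m) h)))"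
  shows "Lam (Lam_adj y) = y"
proof (rule eqI)
  fix k h
  have base: "cinner (Lam (Lam_adj y)) (V (J g)) = cinner y (V (J g))" for g
  proof -
    have "cinner (Lam (Lam_adj y)) (V (J g)) = cinner (Lam (Lam_adj y)) (Lam (D g))"
      using Lam_orth_J[OF Lam_adj_mem, of y 0 "T g"] by (simp add: Lam_D cinner_diff_right)
    also have "\<dots> = cinner y (Lam (D g))" by (simp add: Lam_cinner Lam_adj_cinner')
    also have "\<dots> = cinner y (V (J g))" using past[of 0 "T g"] by (simp add: Lam_D cinner_diff_right)
    finally show ?thesis .
  qed
  show "cinner (Lam (Lam_adj y)) (v k (J h)) = cinner y (v k (J h))"
  proof (cases "k > 0")
    case True
    then show ?thesis
      using Lam_v_J[OF Lam_adj_mem, of y "nat (k - 1)" h] future[of "nat (k - 1)" h] base by simp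
  next
    case False
    then show ?thesis
      using Lam_orth_J[OF Lam_adj_mem, of y "nat (- k)" h] past[of "nat (- k)" h] by simp
  qed
qed

subsection \<open>A factor acts on the wandering subspace as a linear polynomial in the shift\<close>

text \<open>
  The coefficients of \<open>1\<close> and of \<open>z\<close> in the action of \<open>R\<close> on the wandering subspace. Both are
  meant for arguments in the defect space.
\<close>

definition A_of where "A_of R x = Lam_adj (R (Lam x))"
definition B_of where "B_of R x = Lam_adj (v (- 1) (R (Lam x)))"

lemma A_of_mem [simp]: "A_of R x \<in> DT" and B_of_mem [simp]: "B_of R x \<in> DT"
  by (simp_all add: A_of_def B_of_def)

lemma Lam_add: "x \<in> DT \<Longrightarrow> y \<in> DT \<Longrightarrow> Lam (x + y) = Lam x + Lam y"
  by (rule bounded_ops_add[OF Lam_ops])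

lemma Lam_diff: "x \<in> DT \<Longrightarrow> y \<in> DT \<Longrightarrow> Lam (x - y) = Lam x - Lam y"
  by (rule bounded_ops_diff[OF Lam_ops DT_sub])

lemma DT_add [simp]: "x \<in> DT \<Longrightarrow> y \<in> DT \<Longrightarrow> x + y \<in> DT"
  by (rule complex_vector.subspace_add[OF DT_sub])

lemma DT_diff [simp]: "x \<in> DT \<Longrightarrow> y \<in> DT \<Longrightarrow> x - y \<in> DT"
  by (rule complex_vector.subspace_diff[OF DT_sub])

lemma comp_DT_ops:
  assumes R: "R \<in> operators"
  shows "restrict (\<lambda>x. Lam_adj (R (Lam x))) DT \<in> bounded_ops DT DT"
proof -
  obtain B where B: "B \<ge> 0" "\<And>x. norm (R x) \<le> B * norm x" using bounded_ops_bound[OF R] by auto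
  obtain C where C: "C \<ge> 0" "\<And>x. norm (Lam_adj x) \<le> C * norm x" using bounded_ops_bound[OF Lam_adj_ops] by auto
  obtain E where E: "E \<ge> 0" "\<And>x. x \<in> DT \<Longrightarrow> norm (Lam x) \<le> E * norm x" using bounded_ops_bound[OF Lam_ops] by auto
  have "norm (Lam_adj (R (Lam x))) \<le> (C * (B * E)) * norm x" if "x \<in> DT" for x
  proof -
    have "norm (Lam_adj (R (Lam x))) \<le> C * (B * (E * norm x))"
      by (rule order_trans[OF C(2)] mult_left_mono[OF _ C(1)] order_trans[OF B(2)] mult_left_mono[OF _ B(1)] E(2) that)+
    then show ?thesis by (simp add: mult.assoc)
  qed
  then show ?thesis
    using bounded_ops_scaleC[OF Lam_adj_ops] bounded_ops_scaleC[OF Lam_ops]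
    by (intro bounded_opsI[where B = "C * (B * E)"])
       (auto simp: Lam_add UNIV_ops_add[OF R] UNIV_ops_scaleC[OF R] Lam_adj_add complex_vector.subspace_scale[OF DT_sub])
qed

lemma A_of_ops: "R \<in> operators \<Longrightarrow> restrict (A_of R) DT \<in> bounded_ops DT DT"
  unfolding A_of_def by (rule comp_DT_ops)

lemma B_of_ops: "R \<in> operators \<Longrightarrow> restrict (B_of R) DT \<in> bounded_ops DT DT"
  unfolding B_of_def by (rule comp_DT_ops) (rule UNIV_ops_comp[OF _ v_ops])

lemma A_of_continuous: "R \<in> operators \<Longrightarrow> continuous_on DT (A_of R)"
  using bounded_ops_continuous_on[OF A_of_ops DT_sub] by (simp cong: continuous_on_cong)

lemma B_of_continuous: "R \<in> operators \<Longrightarrow> continuous_on DT (B_of R)"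
  using bounded_ops_continuous_on[OF B_of_ops DT_sub] by (simp cong: continuous_on_cong)

context
  fixes R R' S S' assumes fp: "factor_pair R R' S S'"
begin

lemmas R_ops = fp_ops[OF fp]

lemma A_of_add: "x \<in> DT \<Longrightarrow> y \<in> DT \<Longrightarrow> A_of R (x + y) = A_of R x + A_of R y"
  by (simp add: A_of_def Lam_add UNIV_ops_add[OF R_ops] Lam_adj_add)

lemma B_of_add: "x \<in> DT \<Longrightarrow> y \<in> DT \<Longrightarrow> B_of R (x + y) = B_of R x + B_of R y"
  by (simp add: B_of_def Lam_add UNIV_ops_add[OF R_ops] Lam_adj_add v_linear)

lemma B_of_diff: "x \<in> DT \<Longrightarrow> y \<in> DT \<Longrightarrow> B_of R (x - y) = B_of R x - B_of R y"
  by (simp add: B_of_def Lam_diff UNIV_ops_diff[OF R_ops] Lam_adj_diff v_diff)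

text \<open>
  The operator \<open>E\<close> with \<open>R J - J S = Lam E\<close> exists by \<open>range_Lam_criterion\<close>, whose two conditions are the
  moment formulas for \<open>R\<close>. Applying \<open>R\<close> to \<open>Lam (D h) = V J h - J T h\<close> then exhibits the two coefficients, and
  shows that \<open>B_of R\<close> agrees with \<open>E\<close> on the range of \<open>D\<close>.
\<close>

lemma factor_on_J: "R (J h) = J (S h) + Lam (B_of R (D h))"
  and A_of_D: "A_of R (D h) = D (S h) - B_of R (D (T h))"
  and factor_on_Lam_D: "R (Lam (D h)) = Lam (A_of R (D h)) + v 1 (Lam (B_of R (D h)))"
proof -
  define E where "E h = Lam_adj (R (J h) - J (S h))" for h
  have E_mem: "E h \<in> DT" for h by (simp add: E_def)
  have STm: "S ((T ^^ m) h) = (T ^^ m) (S h)" for m h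
    by (rule funpow_commute_elem) (rule fp_ST[OF fp])
  have J: "R (J h) = J (S h) + Lam (E h)" for h
  proof -
    have "Lam (E h) = R (J h) - J (S h)" unfolding E_def
    proof (rule range_Lam_criterion)
      fix m h'
      have "cinner (R (J h)) (v (- int m) (J h')) = cinner (S ((T ^^ m) h)) h'"
        using fp_moment_nonneg[OF fp, of m h h'] unfolding fp_commute[OF fp] v_shift .
      moreover have "cinner (J (S h)) (v (- int m) (J h')) = cinner ((T ^^ m) (S h)) h'"
        using V_pow_moment[of m "S h" h'] v_shift[of "int m" "J (S h)" "J h'"] by simp
      ultimately show "cinner (R (J h) - J (S h)) (v (- int m) (J h')) = 0"
        by (simp add: cinner_diff_left STm)
      have 1: "cinner (J g) (v (int p) (J g')) = cinner g ((T ^^ p) g')" for g p g'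
        using V_pow_moment[of p g' g] cinner_commute[of "J g"] cinner_commute[of g] by simp
      have "cinner (J (S h)) (v (int m + 1) (J h')) = cinner (J (S h)) (V (J ((T ^^ m) h')))"
        using 1[of "S h" "Suc m" h'] 1[of "S h" 1 "(T ^^ m) h'"] by (simp add: add.commute)
      moreover have "cinner (R (J h)) (v (int m + 1) (J h')) = cinner (R (J h)) (V (J ((T ^^ m) h')))"
        using fp_moment_neg[OF fp, of h m h'] fp_moment_neg[OF fp, of h 0 "(T ^^ m) h'"] by simp
      ultimately show "cinner (R (J h) - J (S h)) (v (int m + 1) (J h')) =
          cinner (R (J h) - J (S h)) (V (J ((T ^^ m) h')))"
        by (simp add: cinner_diff_left)
    qed
    then show ?thesis by simp
  qed
  have LD: "R (Lam (D h)) = Lam (D (S h) - E (T h)) + v 1 (Lam (E h))" for h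
  proof -
    have "R (Lam (D h)) = V (J (S h) + Lam (E h)) - (J (S (T h)) + Lam (E (T h)))"
      by (simp add: Lam_D UNIV_ops_diff[OF R_ops] fp_commute_V[OF fp] J)
    also have "\<dots> = Lam (D (S h)) + V (Lam (E h)) - Lam (E (T h))"
      by (simp add: Lam_D UNIV_ops_add[OF V_ops] fp_ST[OF fp])
    finally show ?thesis by (simp add: Lam_diff E_mem)
  qed
  have B: "B_of R (D h) = E h" for h
    unfolding B_of_def LD v_linear[THEN conjunct1] Lam_adj_add
    using Lam_adj_v_Lam[of "D (S h) - E (T h)" "-1"] by (simp add: E_mem v_V)
  have A: "A_of R (D h) = D (S h) - E (T h)" for h
    unfolding A_of_def LD v_linear[THEN conjunct1] Lam_adj_add
    using Lam_adj_v_Lam[of "E h" 1] by (simp add: E_mem del: int_pow_simps)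
  show "R (J h) = J (S h) + Lam (B_of R (D h))" unfolding B J ..
  show "A_of R (D h) = D (S h) - B_of R (D (T h))" unfolding A B ..
  show "R (Lam (D h)) = Lam (A_of R (D h)) + v 1 (Lam (B_of R (D h)))" unfolding A B LD ..
qed

lemma factor_on_Lam:
  assumes x: "x \<in> DT" shows "R (Lam x) = Lam (A_of R x) + v 1 (Lam (B_of R x))"
proof -
  have 1: "continuous_on DT (\<lambda>x. R (Lam x))"
    by (rule continuous_on_compose2[OF UNIV_ops_continuous_on[OF R_ops, of UNIV] Lam_continuous]) auto
  have "continuous_on DT (\<lambda>x. Lam (A_of R x))" "continuous_on DT (\<lambda>x. Lam (B_of R x))"
    by (rule continuous_on_compose2[OF Lam_continuous A_of_continuous[OF R_ops]]
          continuous_on_compose2[OF Lam_continuous B_of_continuous[OF R_ops]]; auto)+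
  then have 2: "continuous_on DT (\<lambda>x. Lam (A_of R x) + v 1 (Lam (B_of R x)))"
    by (intro continuous_on_add v_continuous)
  show ?thesis by (rule DT_agree[OF 1 2 factor_on_Lam_D x])
qed

lemma AB_isometric:
  assumes x: "x \<in> DT" and y: "y \<in> DT"
  shows "cinner (A_of R x) (A_of R y) + cinner (B_of R x) (B_of R y) = cinner x y"
proof -
  have "cinner x y = cinner (R (Lam x)) (R (Lam y))" using x y by (simp add: fp_cinner[OF fp] Lam_cinner)
  also have "\<dots> = cinner (Lam (A_of R x)) (Lam (A_of R y)) + cinner (Lam (A_of R x)) (v 1 (Lam (B_of R y)))
     + cinner (v 1 (Lam (B_of R x))) (Lam (A_of R y)) + cinner (v 1 (Lam (B_of R x))) (v 1 (Lam (B_of R y)))"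
    unfolding factor_on_Lam[OF x] factor_on_Lam[OF y] by (simp only: cinner_simps ac_simps)
  also have "\<dots> = cinner (A_of R x) (A_of R y) + cinner (B_of R x) (B_of R y)"
    unfolding v_cinner by (simp add: Lam_cinner Lam_orth v_shift[of 1] del: int_pow_simps)
  finally show ?thesis by simp
qed

text \<open>
  The inner product of \<open>R Lam x\<close> and \<open>V R Lam y\<close> vanishes, and its only surviving term in the
  expansion is the one with \<open>B_of R x\<close> and \<open>A_of R y\<close>.
\<close>

lemma AB_orth:
  assumes x: "x \<in> DT" and y: "y \<in> DT"
  shows "cinner (B_of R x) (A_of R y) = 0"
proof -
  have "0 = cinner (R (Lam x)) (v 1 (R (Lam y)))"
    using Lam_orth[OF x y, of 1] by (simp add: fp_cinner[OF fp] del: int_pow_simps flip: fp_commute[OF fp])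
  also have "\<dots> = cinner (Lam (A_of R x)) (v 1 (Lam (A_of R y))) + cinner (Lam (A_of R x)) (v 2 (Lam (B_of R y)))
     + cinner (v 1 (Lam (B_of R x))) (v 1 (Lam (A_of R y))) + cinner (v 1 (Lam (B_of R x))) (v 2 (Lam (B_of R y)))"
    unfolding factor_on_Lam[OF x] factor_on_Lam[OF y] v_linear[THEN conjunct1]
    by (simp only: cinner_simps ac_simps v_add[symmetric] one_add_one)
  also have "cinner (v 1 (Lam (B_of R x))) (v 2 (Lam (B_of R y))) = cinner (Lam (B_of R x)) (v 1 (Lam (B_of R y)))"
    unfolding v_shift[of 1] v_add[symmetric] by simp
  finally show ?thesis unfolding v_cinner by (simp add: Lam_cinner Lam_orth del: int_pow_simps)
qed

text \<open>
  From \<open>\<langle>R' Lam x, Lam y\<rangle> = \<langle>V Lam x, R Lam y\<rangle>\<close>: passing to the complementary factor takes adjoints and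
  exchanges the two coefficients.
\<close>

lemma A_of_adj:
  assumes x: "x \<in> DT" and y: "y \<in> DT"
  shows "cinner (A_of R' x) y = cinner x (B_of R y)"
proof -
  have "cinner (A_of R' x) y = cinner (R' (Lam x)) (Lam y)"
    unfolding A_of_def using y by (simp add: Lam_adj_cinner')
  also have "\<dots> = cinner (R (R' (Lam x))) (R (Lam y))" by (simp add: fp_cinner[OF fp])
  also have "R (R' (Lam x)) = v 1 (Lam x)" by (simp add: fp_prod[OF fp])
  also have "cinner (v 1 (Lam x)) (R (Lam y)) = cinner (v 1 (Lam x)) (Lam (A_of R y)) + cinner (v 1 (Lam x)) (v 1 (Lam (B_of R y)))"
    unfolding factor_on_Lam[OF y] by (rule cinner_add_right)
  also have "\<dots> = cinner x (B_of R y)"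
    unfolding v_cinner using x by (simp add: Lam_cinner Lam_orth v_shift[of 1] del: int_pow_simps)
  finally show ?thesis .
qed

end

lemma B_of_adj:
  assumes fp: "factor_pair R R' S S'" and x: "x \<in> DT" and y: "y \<in> DT"
  shows "cinner (B_of R' x) y = cinner x (A_of R y)"
  using A_of_adj[OF factor_pair_swap[OF fp] y x] by (metis cinner_commute)

text \<open>
  With \<open>A = A_of R\<close>, \<open>B = B_of R\<close> the operator \<open>A + B\<close> is a unitary \<open>U\<^sup>*\<close> and
  \<open>B B\<^sup>*\<close> is a projection \<open>P\<close>, with \<open>A = P\<^sup>\<bottom> U\<^sup>*\<close> and \<open>B = P U\<^sup>*\<close>. Adjoints are
  expressed by \<open>R'\<close>: \<open>B\<^sup>* = A_of R'\<close> and \<open>U = u_of R'\<close>.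
\<close>

definition u_of where "u_of R x = A_of R x + B_of R x"

definition p_of where "p_of R R' x = B_of R (A_of R' x)"

lemma u_of_mem [simp]: "u_of R x \<in> DT" and p_of_mem [simp]: "p_of R R' x \<in> DT"
  by (simp_all add: u_of_def p_of_def)

context
  fixes R R' S S' assumes fp: "factor_pair R R' S S'"
begin

lemma A'A: assumes "x \<in> DT" shows "A_of R' (A_of R x) = 0"
proof (rule DT_eqI)
  fix z assume z: "z \<in> DT"
  have "cinner (A_of R' (A_of R x)) z = cinner (A_of R x) (B_of R z)" by (rule A_of_adj[OF fp _ z]) simp
  also have "\<dots> = 0" using AB_orth[OF fp z assms] by (metis cinner_commute complex_cnj_zero)
  finally show "cinner z (A_of R' (A_of R x)) = cinner z 0" by (metis cinner_commute complex_cnj_zero cinner_zero_right)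
qed (simp_all add: complex_vector.subspace_0[OF DT_sub])

lemma B'B: assumes "x \<in> DT" shows "B_of R' (B_of R x) = 0"
proof (rule DT_eqI)
  fix z assume z: "z \<in> DT"
  have "cinner (B_of R' (B_of R x)) z = cinner (B_of R x) (A_of R z)" by (rule B_of_adj[OF fp _ z]) simp
  also have "\<dots> = 0" using AB_orth[OF fp assms z] by simp
  finally show "cinner z (B_of R' (B_of R x)) = cinner z 0" by (metis cinner_commute complex_cnj_zero cinner_zero_right)
qed (simp_all add: complex_vector.subspace_0[OF DT_sub])

lemma A'B_B'A: assumes x: "x \<in> DT" shows "A_of R' (B_of R x) + B_of R' (A_of R x) = x"
proof (rule DT_eqI)
  fix z assume z: "z \<in> DT"
  have "cinner (A_of R' (B_of R x) + B_of R' (A_of R x)) z = cinner x z"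
    using A_of_adj[OF fp _ z, of "B_of R x"] B_of_adj[OF fp _ z, of "A_of R x"] AB_isometric[OF fp x z]
    by (simp add: cinner_add_left add.commute)
  then show "cinner z (A_of R' (B_of R x) + B_of R' (A_of R x)) = cinner z x"
    by (metis cinner_commute)
qed (simp_all add: x)

lemma u_of_inverse: assumes x: "x \<in> DT" shows "u_of R' (u_of R x) = x"
  using A'A[OF x] B'B[OF x] A'B_B'A[OF x]
  by (simp add: u_of_def A_of_add[OF factor_pair_swap[OF fp]] B_of_add[OF factor_pair_swap[OF fp]] ac_simps)

lemma u_of_adj: "x \<in> DT \<Longrightarrow> y \<in> DT \<Longrightarrow> cinner (u_of R' x) y = cinner x (u_of R y)"
  using A_of_adj[OF fp, of x y] B_of_adj[OF fp, of x y] by (simp add: u_of_def cinner_simps)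

lemma p_of_adj: "x \<in> DT \<Longrightarrow> y \<in> DT \<Longrightarrow> cinner (p_of R R' x) y = cinner x (p_of R R' y)"
  unfolding p_of_def using A_of_adj[OF fp, of y "A_of R' x"] A_of_adj[OF fp, of x "A_of R' y"]
    cinner_commute[of "B_of R (A_of R' x)" y] cinner_commute[of "A_of R' x" "A_of R' y"] by simp

end

context
  fixes R R' S S' assumes fp: "factor_pair R R' S S'"
begin

lemma p_of_B: assumes x: "x \<in> DT" shows "p_of R R' (B_of R x) = B_of R x"
proof -
  have "A_of R' (B_of R x) = x - B_of R' (A_of R x)" using A'B_B'A[OF fp x] by (simp add: algebra_simps)
  then have "p_of R R' (B_of R x) = B_of R x - B_of R (B_of R' (A_of R x))"
    unfolding p_of_def by (simp add: B_of_diff[OF fp] x)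
  then show ?thesis using B'B[OF factor_pair_swap[OF fp], of "A_of R x"] by simp
qed

lemma B_of_zero: "B_of R 0 = 0"
  using B_of_diff[OF fp, of 0 0] complex_vector.subspace_0[OF DT_sub] by auto

lemma p_of_u: assumes x: "x \<in> DT" shows "p_of R R' (u_of R x) = B_of R x"
proof -
  have "p_of R R' (u_of R x) = B_of R (A_of R' (A_of R x)) + B_of R (A_of R' (B_of R x))"
    unfolding p_of_def u_of_def by (simp add: A_of_add[OF factor_pair_swap[OF fp]] B_of_add[OF fp])
  then show ?thesis using A'A[OF fp x] p_of_B[OF x] B_of_zero by (simp add: p_of_def)
qed

lemma perp_p_of_u: "x \<in> DT \<Longrightarrow> u_of R x - p_of R R' (u_of R x) = A_of R x"
  by (simp add: p_of_u) (simp add: u_of_def)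

lemma p_of_idem: "p_of R R' (p_of R R' x) = p_of R R' x"
  unfolding p_of_def[of R R' x] by (rule p_of_B) simp

lemma u_of_p_of: assumes x: "x \<in> DT" shows "u_of R' (p_of R R' x) = A_of R' x"
proof -
  have "A_of R' (B_of R (A_of R' x)) = A_of R' x - B_of R' (A_of R (A_of R' x))"
    using A'B_B'A[OF fp, of "A_of R' x"] by (simp add: algebra_simps)
  moreover have "A_of R (A_of R' x) = 0" by (rule A'A[OF factor_pair_swap[OF fp] x])
  moreover have "B_of R' 0 = 0"
    using B_of_diff[OF factor_pair_swap[OF fp], of 0 0] complex_vector.subspace_0[OF DT_sub] by simp
  ultimately show ?thesis
    unfolding u_of_def p_of_def using B'B[OF fp, of "A_of R' x"] by simp
qed

lemma D_factor: "D (S h) = A_of R (D h) + B_of R (D (T h))"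
  using A_of_D[OF fp, of h] by simp

lemma B_of_D_cinner: "cinner (B_of R (D h)) (B_of R (D h')) = cinner h h' - cinner (S h) (S h')"
proof -
  have L: "Lam (B_of R (D h)) = R (J h) - J (S h)" for h using factor_on_J[OF fp, of h] by simp
  have 1: "cinner (R (J h)) (J h') = cinner (S h) h'" for h h'
    using fp_moment_nonneg[OF fp, of 0 h h'] by simp
  then have 2: "cinner (J h) (R (J h')) = cinner h (S h')" for h h' by (metis cinner_commute)
  have "cinner (B_of R (D h)) (B_of R (D h')) = cinner (R (J h) - J (S h)) (R (J h') - J (S h'))"
    by (simp add: Lam_cinner flip: L)
  then show ?thesis by (simp add: cinner_simps 1 2 fp_cinner[OF fp])
qed

end

lemma product_on_Lam:
  assumes fpR: "factor_pair R R' S S'" and fpQ: "factor_pair Q Q' Z Z'" and x: "x \<in> DT"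
  shows "R (Q (Lam x)) = Lam (A_of R (A_of Q x))
     + v 1 (Lam (B_of R (A_of Q x) + A_of R (B_of Q x))) + v 2 (Lam (B_of R (B_of Q x)))"
proof -
  have "R (Q (Lam x)) = R (Lam (A_of Q x)) + v 1 (R (Lam (B_of Q x)))"
    unfolding factor_on_Lam[OF fpQ x] UNIV_ops_add[OF R_ops[OF fpR]] fp_commute[OF fpR] ..
  also have "R (Lam (A_of Q x)) = Lam (A_of R (A_of Q x)) + v 1 (Lam (B_of R (A_of Q x)))"
    by (rule factor_on_Lam[OF fpR]) simp
  also have "R (Lam (B_of Q x)) = Lam (A_of R (B_of Q x)) + v 1 (Lam (B_of R (B_of Q x)))"
    by (rule factor_on_Lam[OF fpR]) simp
  finally show ?thesis by (simp add: Lam_add v_linear v_add[of 1 1, simplified one_add_one] del: int_pow_simps)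
qed

text \<open>
  A polynomial of degree two in the shift determines its coefficients.
\<close>

lemma Lam_coefficients:
  assumes "a \<in> DT" "b \<in> DT" "c \<in> DT" "y = Lam a + v 1 (Lam b) + v 2 (Lam c)"
  shows "Lam_adj y = a" "Lam_adj (v (- 1) y) = b" "Lam_adj (v (- 2) y) = c"
  unfolding assms(4) v_linear[THEN conjunct1] Lam_adj_add v_add[symmetric]
  using assms(1-3) Lam_adj_v_Lam[of _ 1] by (simp_all add: Lam_adj_v_Lam)

lemma product_coefficients:
  assumes fpR: "factor_pair R R' S S'" and fpQ: "factor_pair Q Q' Z Z'" and x: "x \<in> DT"
  shows "Lam_adj (R (Q (Lam x))) = A_of R (A_of Q x)"
    "Lam_adj (v (- 1) (R (Q (Lam x)))) = B_of R (A_of Q x) + A_of R (B_of Q x)"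
    "Lam_adj (v (- 2) (R (Q (Lam x)))) = B_of R (B_of Q x)"
  using Lam_coefficients[OF _ _ _ product_on_Lam[OF assms]] by simp_all

text \<open>
  Constant terms give the first equation; the second is the evaluation of the product at \<open>z = 1\<close>.
\<close>

lemma factors_commute:
  assumes fpR: "factor_pair R R' S S'" and fpQ: "factor_pair Q Q' Z Z'"
    and c: "\<And>x. R (Q x) = Q (R x)" and x: "x \<in> DT"
  shows "A_of R (A_of Q x) = A_of Q (A_of R x)" "u_of R (u_of Q x) = u_of Q (u_of R x)"
  using product_coefficients[OF fpR fpQ x] product_coefficients[OF fpQ fpR x]
  by (simp_all add: c u_of_def A_of_add[OF fpR] B_of_add[OF fpR] A_of_add[OF fpQ] B_of_add[OF fpQ])
     (metis (no_types, opaque_lifting) add.assoc add.commute)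

text \<open>
  If the product of two factors is itself a factor, it has degree at most one as well, so that the
  coefficient of \<open>z\<^sup>2\<close> vanishes.
\<close>

lemma factor_product:
  assumes fpR: "factor_pair R R' S S'" and fpQ: "factor_pair Q Q' Z Z'"
    and fpX: "factor_pair X X' Y Y'" and X: "\<And>x. X x = R (Q x)" and x: "x \<in> DT"
  shows "B_of R (B_of Q x) = 0" "B_of X x = u_of R (B_of Q x) + B_of R (u_of Q x)"
    "u_of X x = u_of R (u_of Q x)"
proof -
  show 0: "B_of R (B_of Q x) = 0"
  proof -
    have "Lam_adj (v (- 2) (X (Lam x))) = 0"
      unfolding factor_on_Lam[OF fpX x] v_linear[THEN conjunct1] Lam_adj_add v_add[symmetric]
      by (simp add: Lam_adj_v_Lam)
    then show ?thesis using product_coefficients(3)[OF fpR fpQ x] by (simp add: X)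
  qed
  have B: "B_of X x = B_of R (A_of Q x) + A_of R (B_of Q x)"
    using product_coefficients(2)[OF fpR fpQ x] by (simp add: B_of_def X)
  then show "B_of X x = u_of R (B_of Q x) + B_of R (u_of Q x)"
    using 0 by (simp add: u_of_def B_of_add[OF fpR] add.commute)
  have A: "A_of X x = A_of R (A_of Q x)"
    using product_coefficients(1)[OF fpR fpQ x] by (simp add: A_of_def X)
  show "u_of X x = u_of R (u_of Q x)"
    unfolding u_of_def A B
    using 0 by (simp add: A_of_add[OF fpR] B_of_add[OF fpR] ac_simps)
qed

end

section \<open>From a dilation to projections and unitaries\<close>

text \<open>
  All that the theorem requires of the tuples \<open>P\<close> and \<open>U\<close>. The arguments \<open>D\<close> and \<open>DT\<close> stand for the defect
  operator and the defect space of \<open>TT\<close>. Extensionality makes equality of tuples the same as equality at the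
  indices \<open>1, \<dots>, n\<close>.
\<close>

definition factor_data where
  "factor_data n T TT D DT P U \<longleftrightarrow>
        P \<in> extensional {1..n} \<and> U \<in> extensional {1..n} \<and>
        (\<forall>i\<in>{1..n}. projection DT (P i)) \<and>
        (\<forall>i\<in>{1..n}. unitary DT DT (U i)) \<and>
        commuting DT n U \<and>
        (\<forall>x\<in>DT. tuple_prod n U x = x) \<and>
        (\<forall>i\<in>{1..n}. \<forall>h.
           D (T i h) = perp (P i) (adj DT DT (U i) (D h)) + P i (adj DT DT (U i) (D (TT h)))) \<and>
        (\<forall>i\<in>{1..n}. \<forall>j\<in>{1..n}. \<forall>x\<in>DT.
           perp (P i) (adj DT DT (U i) (perp (P j) (adj DT DT (U j) x))) =
           perp (P j) (adj DT DT (U j) (perp (P i) (adj DT DT (U i) x)))) \<and>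
        (\<forall>i\<in>{1..n}. \<forall>j\<in>{1..n}. \<forall>x\<in>DT.
           U i (P i (U j (P j x))) = U j (P j (U i (P i x)))) \<and>
        (\<forall>i\<in>{1..n}. \<forall>h.
           D (U i (P i (adj DT DT (U i) (D h)))) = defect (T i) (defect (T i) h)) \<and>
        (\<forall>x\<in>DT.
           (\<Sum>k=1..n. op_prod (\<lambda>i. adj DT DT (U i)) [1..<k]
                        (P k (op_prod U (rev [1..<k]) x))) = x)"

lemma restrict_add_ops:
  assumes N: "csubspace N" and M: "csubspace M"
    and f: "f \<in> bounded_ops M N" and g: "g \<in> bounded_ops M N"
  shows "restrict (\<lambda>x. f x + g x) M \<in> bounded_ops M N"
proof -
  obtain B where B: "\<And>x. x \<in> M \<Longrightarrow> norm (f x) \<le> B * norm x" using bounded_ops_bound[OF f] by auto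
  obtain C where C: "\<And>x. x \<in> M \<Longrightarrow> norm (g x) \<le> C * norm x" using bounded_ops_bound[OF g] by auto
  have "norm (f x + g x) \<le> (B + C) * norm x" if "x \<in> M" for x
    using norm_triangle_ineq[of "f x" "g x"] B[OF that] C[OF that] by (simp add: distrib_right)
  then show ?thesis
    by (intro bounded_opsI[where B = "B + C"])
       (auto simp: bounded_ops_add[OF f] bounded_ops_add[OF g] bounded_ops_scaleC[OF f] bounded_ops_scaleC[OF g]
          scaleC_add_right bounded_ops_mem[OF f] bounded_ops_mem[OF g]
          complex_vector.subspace_add[OF N] complex_vector.subspace_add[OF M] complex_vector.subspace_scale[OF M])
qed

lemma restrict_comp_ops:
  assumes M: "csubspace M" and g: "g \<in> bounded_ops M N" and f: "f \<in> bounded_ops N K"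
  shows "restrict (\<lambda>x. f (g x)) M \<in> bounded_ops M K"
proof -
  obtain B where B: "\<And>x. x \<in> M \<Longrightarrow> norm (g x) \<le> B * norm x" using bounded_ops_bound[OF g] by auto
  obtain C where C: "C \<ge> 0" "\<And>x. x \<in> N \<Longrightarrow> norm (f x) \<le> C * norm x" using bounded_ops_bound[OF f] by auto
  have "norm (f (g x)) \<le> (C * B) * norm x" if "x \<in> M" for x
    using C(2)[OF bounded_ops_mem[OF g that]] mult_left_mono[OF B[OF that] C(1)] by (simp add: ac_simps)
  then show ?thesis
    by (intro bounded_opsI[where B = "C * B"])
       (auto simp: bounded_ops_add[OF g] bounded_ops_scaleC[OF g] bounded_ops_add[OF f] bounded_ops_scaleC[OF f]
          bounded_ops_mem[OF f] bounded_ops_mem[OF g]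
          complex_vector.subspace_add[OF M] complex_vector.subspace_scale[OF M])
qed

context min_dilation
begin

lemma u_of_ops: "R \<in> operators \<Longrightarrow> restrict (u_of R) DT \<in> bounded_ops DT DT"
  using restrict_add_ops[OF DT_sub DT_sub A_of_ops B_of_ops, of R R]
  unfolding u_of_def[abs_def] by (simp cong: restrict_cong)

lemma p_of_ops:
  assumes "R \<in> operators" "R' \<in> operators"
  shows "restrict (p_of R R') DT \<in> bounded_ops DT DT"
  using restrict_comp_ops[OF DT_sub A_of_ops[OF assms(2)] B_of_ops[OF assms(1)]]
  unfolding p_of_def[abs_def] by (simp cong: restrict_cong)

lemma u_of_cinner:
  assumes fp: "factor_pair R R' S S'" and x: "x \<in> DT" and y: "y \<in> DT"
  shows "cinner (u_of R x) (u_of R y) = cinner x y"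
  using u_of_adj[OF factor_pair_swap[OF fp] x, of "u_of R y"] u_of_inverse[OF fp y] by simp

lemma unitary_u_of:
  assumes fp: "factor_pair R R' S S'" shows "unitary DT DT (restrict (u_of R') DT)"
proof (rule unitaryI[OF DT_sub u_of_ops])
  note fp' = factor_pair_swap[OF fp]
  show "R' \<in> operators" by (rule R_ops[OF fp'])
  show "cinner (restrict (u_of R') DT x) (restrict (u_of R') DT y) = cinner x y" if "x \<in> DT" "y \<in> DT" for x y
    using u_of_cinner[OF fp' that] that by simp
  show "\<exists>x\<in>DT. restrict (u_of R') DT x = y" if "y \<in> DT" for y
    using u_of_inverse[OF fp that] by (intro bexI[of _ "u_of R y"]) auto
qed

lemma adj_u_of:
  assumes fp: "factor_pair R R' S S'" and x: "x \<in> DT"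
  shows "adj DT DT (restrict (u_of R') DT) x = u_of R x"
  by (rule adj_unique[OF DT_sub x]) (simp_all add: u_of_adj[OF fp _ x])

lemma projection_p_of:
  assumes fp: "factor_pair R R' S S'" shows "projection DT (restrict (p_of R R') DT)"
proof -
  have ops: "restrict (p_of R R') DT \<in> bounded_ops DT DT"
    by (rule p_of_ops[OF R_ops[OF fp] R_ops[OF factor_pair_swap[OF fp]]])
  have "adj DT DT (restrict (p_of R R') DT) = restrict (p_of R R') DT"
  proof
    fix x show "adj DT DT (restrict (p_of R R') DT) x = restrict (p_of R R') DT x"
    proof (cases "x \<in> DT")
      case True
      show ?thesis by (rule adj_unique[OF DT_sub True]) (simp_all add: True p_of_adj[OF fp _ True])
    qed (simp add: adj_def)
  qed
  then show ?thesis using ops p_of_idem[OF fp] by (auto simp: projection_def)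
qed

end

text \<open>
  Take \<open>R = W i\<close> with complementary factor \<open>W' i\<close>. For the initial products \<open>F k\<close> the coefficient of
  \<open>z\<close> satisfies the recursion \<open>factor_product(2)\<close>; solving it expresses the sum of the first \<open>k\<close>
  conjugated projections through \<open>F k\<close>. For \<open>k = n\<close> the polynomial is \<open>z\<close>, which gives condition (5).
\<close>

lemma factor_data_of_dilation:
  fixes J :: "'h::chilbert_space \<Rightarrow> 'k::chilbert_space"
  assumes d: "min_dilation J V TT" and TT: "TT = tuple_prod n T" and W: "unitary_dilation J n W T"
    and V: "V = tuple_prod n W" and T: "commuting UNIV n T" and contrT: "\<And>i. i \<in> {1..n} \<Longrightarrow> contraction (T i)"
  shows "\<exists>P U. factor_data n T TT (defect TT) (defect_space TT) P U"
proof -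
  interpret min_dilation J V TT by (rule d)
  have Wc: "commuting UNIV n W" using W by (simp add: unitary_dilation_def)
  define \<delta> where "\<delta> i = (\<lambda>j. if j = i then 1 else 0 :: nat)" for i :: nat
  define W' where "W' i = op_monom n W (\<lambda>j. 1 - \<delta> i j)" for i
  define T' where "T' i = op_monom n T (\<lambda>j. 1 - \<delta> i j)" for i
  have pair: "factor_pair (op_monom n W \<alpha>) (op_monom n W (\<lambda>i. 1 - \<alpha> i)) (op_monom n T \<alpha>) (op_monom n T (\<lambda>i. 1 - \<alpha> i))"
    if "\<And>i. \<alpha> i \<le> 1" for \<alpha>
    using monom_factor_pair[OF d[unfolded TT] W V T, of \<alpha>] that unfolding TT by blast
  have fp: "factor_pair (W i) (W' i) (T i) (T' i)" if "i \<in> {1..n}" for i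
    using pair[of "\<delta> i"] monom_single[OF that, of W] monom_single[OF that, of T]
    unfolding W'_def T'_def \<delta>_def by simp
  note fp' = factor_pair_swap[OF fp]
  define F where "F k = op_prod W [1..<Suc k]" for k
  have fpF: "\<exists>R' S S'. factor_pair (F k) R' S S'" if "k \<le> n" for k
  proof -
    have "(if i \<le> k then 1 else 0 :: nat) \<le> 1" for i by simp
    from pair[of "\<lambda>i. if i \<le> k then 1 else 0", OF this] show ?thesis unfolding F_def monom_prefix[OF that] by blast
  qed
  define U where "U = (\<lambda>i\<in>{1..n}. restrict (u_of (W' i)) DT)"
  define P where "P = (\<lambda>i\<in>{1..n}. restrict (p_of (W i) (W' i)) DT)"
  define u where "u i = adj DT DT (U i)" for i
  have Ux: "U i x = u_of (W' i) x" and Px: "P i x = p_of (W i) (W' i) x" and ux: "u i x = u_of (W i) x"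
    if "i \<in> {1..n}" "x \<in> DT" for i x
    using that adj_u_of[OF fp] by (simp_all add: U_def P_def u_def)
  have mem: "U i x \<in> DT" "P i x \<in> DT" "u i x \<in> DT" if "i \<in> {1..n}" "x \<in> DT" for i x
    using that by (simp_all add: Ux Px ux)
  have Bx: "P i (u i x) = B_of (W i) x" and Ax: "perp (P i) (u i x) = A_of (W i) x"
    and UPx: "U i (P i x) = A_of (W' i) x" and Uu: "U i (u i x) = x" and uU: "u i (U i x) = x"
    if "i \<in> {1..n}" "x \<in> DT" for i x
    using that p_of_u[OF fp] perp_p_of_u[OF fp] u_of_p_of[OF fp] u_of_inverse[OF fp] u_of_inverse[OF fp']
    by (simp_all add: Ux Px ux perp_def)
  have Wcomm: "W i (W j x) = W j (W i x)" if "i \<in> {1..n}" "j \<in> {1..n}" for i j x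
    using Wc that by (simp add: commuting_def)
  have W'comm: "W' i (W' j x) = W' j (W' i x)" for i j x
    unfolding W'_def monom_add[OF Wc, symmetric] by (simp only: add.commute)
  have ucomm: "u_of (W' i) (u_of (W' j) x) = u_of (W' j) (u_of (W' i) x)" if "i \<in> {1..n}" "j \<in> {1..n}" "x \<in> DT" for i j x
    using factors_commute(2)[OF fp'[OF that(1)] fp'[OF that(2)] _ that(3)] W'comm by blast
  have Ucomm: "U i (U j x) = U j (U i x)" if "i \<in> {1..n}" "j \<in> {1..n}" "x \<in> DT" for i j x
    using ucomm[OF that] that by (simp only: Ux u_of_mem)
  have FS: "F (Suc k) x = F k (W (Suc k) x)" for k x by (simp add: F_def)
  have F0: "F 0 = (\<lambda>x. x)" by (simp add: F_def fun_eq_iff)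
  have uF: "u_of (F k) x = op_prod u [1..<Suc k] x" if "k \<le> n" "x \<in> DT" for k x
    using that
  proof (induction k arbitrary: x)
    case 0
    then show ?case using Lam_adj_v_Lam[of x "-1"] by (simp add: u_of_def A_of_def B_of_def F0)
  next
    case (Suc k)
    then have k: "k \<le> n" and i: "Suc k \<in> {1..n}" by auto
    obtain R' S S' where f: "factor_pair (F k) R' S S'" using fpF[OF k] by auto
    obtain Q' Z Z' where g: "factor_pair (F (Suc k)) Q' Z Z'" using fpF[OF Suc.prems(1)] by auto
    have "u_of (F (Suc k)) x = u_of (F k) (u_of (W (Suc k)) x)"
      by (rule factor_product(3)[OF f fp[OF i] g FS Suc.prems(2)])
    also have "\<dots> = op_prod u [1..<Suc k] (u (Suc k) x)"
      using Suc.IH[OF k, of "u_of (W (Suc k)) x"] ux[OF i Suc.prems(2)] by simp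
    finally show ?case by simp
  qed
  have Upre: "op_prod U (rev [1..<Suc k]) x \<in> DT" if "k \<le> n" "x \<in> DT" for k x
    by (rule op_prod_closed) (use that mem in \<open>auto simp del: upt_Suc\<close>)
  have sumF: "(\<Sum>j=1..k. op_prod u [1..<j] (P j (op_prod U (rev [1..<j]) x)))
      = B_of (F k) (op_prod U (rev [1..<Suc k]) x)" if "k \<le> n" "x \<in> DT" for k x
    using that(1)
  proof (induction k)
    case 0
    then show ?case using Lam_adj_v_Lam[of x "-1"] that(2) by (simp add: B_of_def F0)
  next
    case (Suc k)
    then have k: "k \<le> n" and i: "Suc k \<in> {1..n}" by auto
    define y where "y = op_prod U (rev [1..<Suc k]) x"
    define z where "z = U (Suc k) y"
    have y: "y \<in> DT" unfolding y_def using Upre[OF k that(2)] .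
    have z: "z \<in> DT" unfolding z_def using mem(1)[OF i y] .
    have zz: "op_prod U (rev [1..<Suc (Suc k)]) x = z" by (simp add: z_def y_def)
    have uz: "u (Suc k) z = y" unfolding z_def by (rule uU[OF i y])
    obtain R' S S' where f: "factor_pair (F k) R' S S'" using fpF[OF k] by auto
    obtain Q' Z Z' where g: "factor_pair (F (Suc k)) Q' Z Z'" using fpF[OF Suc.prems] by auto
    have "B_of (F (Suc k)) z = u_of (F k) (B_of (W (Suc k)) z) + B_of (F k) (u_of (W (Suc k)) z)"
      by (rule factor_product(2)[OF f fp[OF i] g FS z])
    also have "\<dots> = op_prod u [1..<Suc k] (P (Suc k) y) + B_of (F k) y"
      using Bx[OF i z] ux[OF i z] uz uF[OF k, of "B_of (W (Suc k)) z"] by simp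
    finally show ?case unfolding zz using Suc.IH[OF k] by (simp add: y_def del: upt_Suc)
  qed
  have FV: "F n = V" by (simp add: F_def V)
  have BV: "B_of V x = x" and AV: "A_of V x = 0" if "x \<in> DT" for x
    using that Lam_adj_v_Lam[of x 1] by (simp_all add: B_of_def A_of_def v_V)
  have un: "op_prod u [1..<Suc n] x = x" if "x \<in> DT" for x
    using uF[OF order_refl that] that unfolding FV u_of_def by (simp add: BV AV del: upt_Suc)
  \<comment> \<open>As \<open>u\<close> inverts \<open>U\<close> factor by factor, \<open>un\<close> says that the product of the \<open>U i\<close> is the identity.\<close>
  have inv: "op_prod U (rev js) (op_prod u js x) = x" if "set js \<subseteq> {1..n}" "x \<in> DT" for js x
    using that
  proof (induction js)
    case (Cons j js)
    have "op_prod u js x \<in> DT" by (rule op_prod_closed) (use Cons.prems mem in auto)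
    then show ?case using Cons Uu[of j] by simp
  qed simp
  have Urev: "op_prod U (rev [1..<Suc n]) x = x" if "x \<in> DT" for x
    using inv[of "[1..<Suc n]" x] un[OF that] that by (simp add: atLeastLessThanSuc_atLeastAtMost del: upt_Suc)
  have Un: "tuple_prod n U x = x" if "x \<in> DT" for x
    using op_prod_rev[of "[1..<Suc n]" DT U x] mem Ucomm that Urev[OF that]
    by (simp add: atLeastLessThanSuc_atLeastAtMost del: upt_Suc)
  have c1: "(defect TT) (T i h) = perp (P i) (u i (D h)) + P i (u i (D (TT h)))" if "i \<in> {1..n}" for i h
    using D_factor[OF fp[OF that], of h] that by (simp add: Ax Bx)
  have c2: "perp (P i) (u i (perp (P j) (u j x))) = perp (P j) (u j (perp (P i) (u i x)))"
    if "i \<in> {1..n}" "j \<in> {1..n}" "x \<in> DT" for i j x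
    using factors_commute(1)[OF fp[OF that(1)] fp[OF that(2)] Wcomm[OF that(1,2)] that(3)] that
    by (simp add: Ax)
  have c3: "U i (P i (U j (P j x))) = U j (P j (U i (P i x)))"
    if "i \<in> {1..n}" "j \<in> {1..n}" "x \<in> DT" for i j x
    using factors_commute(1)[OF fp'[OF that(1)] fp'[OF that(2)] W'comm[of i j] that(3)] that
    by (simp add: UPx)
  have c4: "D (U i (P i (u i (D h)))) = defect (T i) (defect (T i) h)" if i: "i \<in> {1..n}" for i h
  proof (rule cinner_eqI)
    fix h'
    have adjU: "cinner (U i z) w = cinner z (u i w)" if "z \<in> DT" "w \<in> DT" for z w
      using u_of_adj[OF fp[OF i] that] i that by (simp add: Ux ux)
    let ?B = "B_of (W i)"
    have "cinner (D (U i (P i (u i (D h))))) h' = cinner (U i (?B (D h))) (D h')"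
      using i by (simp add: D_sym Bx)
    also have "\<dots> = cinner (?B (D h)) (A_of (W i) (D h') + ?B (D h'))"
      using i by (simp add: adjU ux u_of_def)
    also have "\<dots> = cinner (?B (D h)) (?B (D h'))"
      using AB_orth[OF fp[OF i], of "D h" "D h'"] by (simp add: cinner_add_right)
    also have "\<dots> = cinner (defect (T i) h) (defect (T i) h')"
      unfolding B_of_D_cinner[OF fp[OF i]] cinner_defect[OF contrT[OF i]] ..
    also have "\<dots> = cinner (defect (T i) (defect (T i) h)) h'" by (rule defect_symmetric[OF contrT[OF i], symmetric])
    finally show "cinner h' (D (U i (P i (u i (D h))))) = cinner h' (defect (T i) (defect (T i) h))"
      by (metis cinner_commute)
  qed
  have c5: "(\<Sum>k=1..n. op_prod u [1..<k] (P k (op_prod U (rev [1..<k]) x))) = x" if "x \<in> DT" for x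
    using sumF[OF order_refl that] unfolding FV Urev[OF that] BV[OF that] .
  have "projection DT (P i)" "unitary DT DT (U i)" if "i \<in> {1..n}" for i
    using that projection_p_of[OF fp] unitary_u_of[OF fp] by (simp_all add: P_def U_def)
  moreover have "P \<in> extensional {1..n}" "U \<in> extensional {1..n}" by (simp_all add: P_def U_def)
  moreover have "commuting DT n U" using Ucomm by (simp add: commuting_def)
  ultimately have "factor_data n T TT D DT P U"
    unfolding factor_data_def u_def[symmetric] using Un c1 c2 c3 c4 c5 by (simp del: upt_Suc)
  then show ?thesis by blast
qed

section \<open>From projections and unitaries to a dilation\<close>

lemma op_prod_preserves_add:
  assumes "\<And>j x. j \<in> set js \<Longrightarrow> x \<in> M \<Longrightarrow> A j x \<in> M"
    and "\<And>j x y. j \<in> set js \<Longrightarrow> x \<in> M \<Longrightarrow> y \<in> M \<Longrightarrow> A j (x + y) = A j x + A j y"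
    and "x \<in> M" "y \<in> M"
  shows "op_prod A js (x + y) = op_prod A js x + op_prod A js y"
  using assms by (induction js) (auto simp: op_prod_closed)

context min_dilation
begin

lemma J_orth_Lam:
  assumes "x \<in> DT" shows "cinner (J h) (Lam x) = 0"
  using Lam_orth_J[OF assms, of 0 h] cinner_commute[of "J h" "Lam x"] by simp

text \<open>
  \<open>R\<close> is the isometric extension of \<open>V\<^sup>k J h \<mapsto> V\<^sup>k (J (S h) + Lam (B (D h)))\<close>. That inner products are
  preserved is \<open>BD\<close> for equal powers of \<open>V\<close>. For different powers the mixed term of \<open>J S\<close> and \<open>Lam B D\<close>
  survives, and \<open>DS\<close> and \<open>orth\<close> bring it into the form to which \<open>BD\<close> applies.
\<close>

lemma factor_lift:
  assumes mem: "\<And>x. x \<in> DT \<Longrightarrow> A x \<in> DT" "\<And>x. x \<in> DT \<Longrightarrow> B x \<in> DT"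
    and cont: "continuous_on DT A" "continuous_on DT B"
    and orth: "\<And>x y. x \<in> DT \<Longrightarrow> y \<in> DT \<Longrightarrow> cinner (A x) (B y) = 0"
    and S: "\<And>h. S (T h) = T (S h)"
    and DS: "\<And>h. D (S h) = A (D h) + B (D (T h))"
    and BD: "\<And>h h'. cinner (B (D h)) (B (D h')) = cinner h h' - cinner (S h) (S h')"
  obtains R where "R \<in> operators" "\<And>x y. cinner (R x) (R y) = cinner x y"
    "\<And>x. R (V x) = V (R x)" "\<And>h. R (J h) = J (S h) + Lam (B (D h))"
    "\<And>x. x \<in> DT \<Longrightarrow> R (Lam x) = Lam (A x) + v 1 (Lam (B x))"
proof -
  define c where "c h = J (S h) + Lam (B (D h))" for h
  have STm: "S ((T ^^ m) h) = (T ^^ m) (S h)" for m h by (rule funpow_commute_elem) (rule S)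
  note BDm [simp] = mem(2)[OF D_mem] and ADm [simp] = mem(1)[OF D_mem]
  have JT: "cinner (v (int m) (J h)) (J h') = cinner ((T ^^ m) h) h'" for m h h'
    using V_pow_moment[of m h h'] by simp
  have key: "cinner (v (int m) (c h)) (c h') = cinner (v (int m) (J h)) (J h')" for m h h'
  proof (cases m)
    case 0
    then show ?thesis
      using Lam_orth_J[OF BDm, of h 0 "S h'"] J_orth_Lam[OF BDm]
      by (simp add: c_def cinner_simps Lam_cinner BD)
  next
    case (Suc p)
    define g where "g = (T ^^ p) h"
    have 1: "cinner (v (int m) (Lam (B (D h)))) (J (S h')) = 0"
      unfolding v_shift using Lam_orth_J[OF BDm, of h m "S h'"] by simp
    have 2: "cinner (v (int m) (Lam (B (D h)))) (Lam (B (D h'))) = 0"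
      unfolding v_shift using Lam_orth[OF BDm BDm, of "- int m"] Suc by simp
    have 3: "cinner (v (int m) (J (S h))) (Lam (B (D h'))) = cinner (D (S g)) (B (D h'))"
    proof -
      have "cinner (Lam (B (D h'))) (v (int p + 1) (J (S h))) = cinner (Lam (B (D h'))) (V (J ((T ^^ p) (S h))))"
        by (rule Lam_v_J) simp
      also have "\<dots> = cinner (Lam (B (D h'))) (Lam (D (S g)))"
        using Lam_orth_J[OF BDm, of h' 0] by (simp add: Lam_D cinner_diff_right g_def STm)
      also have "\<dots> = cinner (B (D h')) (D (S g))" by (simp add: Lam_cinner)
      finally show ?thesis using Suc by (metis cinner_commute add.commute of_nat_Suc)
    qed
    have "cinner (v (int m) (c h)) (c h') = cinner ((T ^^ m) (S h)) (S h') + cinner (D (S g)) (B (D h'))"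
      unfolding c_def v_linear[THEN conjunct1] cinner_add_left cinner_add_right 1 2 3 JT by simp
    also have "cinner (D (S g)) (B (D h')) = cinner (B (D (T g))) (B (D h'))"
      unfolding DS by (simp add: cinner_add_left orth)
    also have "\<dots> = cinner (T g) h' - cinner (S (T g)) (S h')" by (rule BD)
    also have "S (T g) = (T ^^ m) (S h)" by (simp add: g_def Suc S STm)
    also have "T g = (T ^^ m) h" by (simp add: g_def Suc)
    finally show ?thesis unfolding JT by simp
  qed
  let ?a = "\<lambda>(k, h). v k (J h)" and ?b = "\<lambda>(k, h). v k (c h)"
  have "cinner (v k (J h)) (v l (J h')) = cinner (v k (c h)) (v l (c h'))" for k l h h'
  proof (cases "k \<ge> l")
    case True
    have sh: "cinner (v k p) (v l q) = cinner (v (int (nat (k - l))) p) q" for p q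
      unfolding v_shift[of k] v_shift[of "int (nat (k - l))"] v_add[symmetric] using True by simp
    show ?thesis unfolding sh by (rule key[symmetric])
  next
    case False
    have sh: "cinner (v k p) (v l q) = cinner p (v (int (nat (l - k))) q)" for p q
      unfolding v_shift[of k] v_add[symmetric] using False by simp
    show ?thesis unfolding sh using key[of "nat (l - k)" h' h] by (metis cinner_commute)
  qed
  then have "cinner (?a s) (?a t) = cinner (?b s) (?b t)" for s t by (cases s, cases t) simp
  from isometric_extension[of ?a ?b, OF this total[symmetric]]
  obtain R where R: "R \<in> operators" "\<And>s. R (?a s) = ?b s" "\<And>x y. cinner (R x) (R y) = cinner x y"
    by (metis UNIV_I)
  have Rv: "R (v k (J h)) = v k (c h)" for k h using R(2)[of "(k, h)"] by simp
  have RJ: "R (J h) = c h" for h using Rv[of 0 h] by simp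
  have "(\<lambda>x. R (V x)) = (\<lambda>x. V (R x))"
    by (rule ops_eqI[OF UNIV_ops_comp[OF V_ops R(1)] UNIV_ops_comp[OF R(1) V_ops]]) (simp add: Rv v_V)
  then have RV: "R (V x) = V (R x)" for x by (rule fun_cong)
  have LD: "R (Lam (D h)) = Lam (A (D h)) + v 1 (Lam (B (D h)))" for h
  proof -
    have "R (Lam (D h)) = V (c h) - c (T h)"
      by (simp add: Lam_D UNIV_ops_diff[OF R(1)] RV RJ)
    also have "\<dots> = Lam (D (S h)) + V (Lam (B (D h))) - Lam (B (D (T h)))"
      by (simp add: c_def Lam_D UNIV_ops_add[OF V_ops] S)
    finally show ?thesis by (simp add: DS Lam_add)
  qed
  have c1: "continuous_on DT (\<lambda>x. R (Lam x))"
    by (rule continuous_on_compose2[OF UNIV_ops_continuous_on[OF R(1), of UNIV] Lam_continuous]) auto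
  have "continuous_on DT (\<lambda>x. Lam (A x))" "continuous_on DT (\<lambda>x. Lam (B x))"
    by (rule continuous_on_compose2[OF Lam_continuous cont(1)] continuous_on_compose2[OF Lam_continuous cont(2)];
        use mem in auto)+
  then have c2: "continuous_on DT (\<lambda>x. Lam (A x) + v 1 (Lam (B x)))"
    by (intro continuous_on_add v_continuous)
  show ?thesis
    by (rule that[OF R(1) R(3) RV _ DT_agree[OF c1 c2 LD]]) (simp_all add: RJ c_def)
qed

text \<open>
  The part of the dilation space that is generated from the wandering subspace by forward shifts. It is
  orthogonal to the range of \<open>J\<close>.
\<close>

definition future :: "'k set" where
  "future = cspan {v (int k) (Lam x) | k x. x \<in> DT}"

lemma future_orth_J: "y \<in> future \<Longrightarrow> cinner y (J h) = 0"
  unfolding future_def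
proof (induction rule: complex_vector.span_induct)
  case base
  show ?case unfolding complex_vector.subspace_def by (auto simp: cinner_simps)
next
  case (step y)
  then obtain k x where y: "y = v (int k) (Lam x)" and x: "x \<in> DT" by auto
  show ?case unfolding y v_shift by (rule Lam_orth_J[OF x])
qed

lemma future_base: "x \<in> DT \<Longrightarrow> v (int k) (Lam x) \<in> future"
  unfolding future_def by (intro complex_vector.span_base) blast

end

text \<open>
  A minimal unitary dilation of the product, together with projections and unitaries subject to (1) to (5).
  The operators \<open>A i\<close> and \<open>B i\<close> below are the coefficients that the factor \<open>W i\<close> must have.
\<close>

locale factor_data_dilation = min_dilation J V TT
  for J :: "'h::chilbert_space \<Rightarrow> 'k::chilbert_space" and V and TT +
  fixes n :: nat and T :: "nat \<Rightarrow> 'h \<Rightarrow> 'h" and P U :: "nat \<Rightarrow> 'h \<Rightarrow> 'h"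
  assumes TT: "TT = tuple_prod n T" and Tc: "commuting UNIV n T"
    and contrT: "\<And>i. i \<in> {1..n} \<Longrightarrow> contraction (T i)"
    and data: "factor_data n T TT (defect TT) (defect_space TT) P U"
begin

definition "u i = adj DT DT (U i)"
definition "A i x = perp (P i) (u i x)"
definition "B i x = P i (u i x)"

lemma extensionals: "P \<in> extensional {1..n}" "U \<in> extensional {1..n}"
  using data by (auto simp: factor_data_def)

lemma P_proj: "i \<in> {1..n} \<Longrightarrow> projection DT (P i)" and U_unit: "i \<in> {1..n} \<Longrightarrow> unitary DT DT (U i)"
  using data by (auto simp: factor_data_def)

context
  fixes i assumes i: "i \<in> {1..n}"
begin

lemma P_ops: "P i \<in> bounded_ops DT DT" and U_ops: "U i \<in> bounded_ops DT DT"
  using P_proj[OF i] U_unit[OF i] by (auto simp: projection_def unitary_def)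

lemma u_ops: "u i \<in> bounded_ops DT DT"
  unfolding u_def by (rule adj_bounded_ops[OF DT_sub DT_closed DT_sub U_ops])

lemmas mems = bounded_ops_mem[OF P_ops] bounded_ops_mem[OF U_ops] bounded_ops_mem[OF u_ops]

lemma Uu: "x \<in> DT \<Longrightarrow> U i (u i x) = x" and uU: "x \<in> DT \<Longrightarrow> u i (U i x) = x"
  using U_unit[OF i] by (auto simp: unitary_def u_def)

lemma U_adj: "x \<in> DT \<Longrightarrow> y \<in> DT \<Longrightarrow> cinner (U i x) y = cinner x (u i y)"
  unfolding u_def by (rule adj_cinner[OF DT_sub DT_closed U_ops])

lemma P_sym: assumes "x \<in> DT" "y \<in> DT" shows "cinner (P i x) y = cinner x (P i y)"
proof -
  have "adj DT DT (P i) y = P i y" using P_proj[OF i] by (simp add: projection_def)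
  then show ?thesis using adj_cinner[OF DT_sub DT_closed P_ops assms(2,1)] by simp
qed

lemma P_idem: "x \<in> DT \<Longrightarrow> P i (P i x) = P i x"
  using P_proj[OF i] by (simp add: projection_def)

lemma A_mem: "x \<in> DT \<Longrightarrow> A i x \<in> DT" and B_mem: "x \<in> DT \<Longrightarrow> B i x \<in> DT"
  by (simp_all add: A_def B_def perp_def mems)

lemma A_B: "A i x + B i x = u i x" by (simp add: A_def B_def perp_def)

lemma B_add: "x \<in> DT \<Longrightarrow> y \<in> DT \<Longrightarrow> B i (x + y) = B i x + B i y"
  by (simp add: B_def bounded_ops_add[OF u_ops] bounded_ops_add[OF P_ops] mems)

lemma A_add: "x \<in> DT \<Longrightarrow> y \<in> DT \<Longrightarrow> A i (x + y) = A i x + A i y"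
  using A_B[of "x + y"] A_B[of x] A_B[of y] B_add[of x y] bounded_ops_add[OF u_ops, of x y]
  by (simp add: A_def perp_def B_def algebra_simps)

lemma B_continuous: "continuous_on DT (B i)"
  unfolding B_def
  by (rule continuous_on_compose2[OF bounded_ops_continuous_on[OF P_ops DT_sub]
        bounded_ops_continuous_on[OF u_ops DT_sub]]) (auto simp: mems)

lemma A_continuous: "continuous_on DT (A i)"
  unfolding A_def perp_def using B_continuous
  by (intro continuous_on_diff bounded_ops_continuous_on[OF u_ops DT_sub]) (simp add: B_def)

lemma A_B_orth: assumes "x \<in> DT" "y \<in> DT" shows "cinner (A i x) (B i y) = 0"
proof -
  have "cinner (A i x) (B i y) = cinner (P i (A i x)) (u i y)"
    unfolding B_def by (rule P_sym[symmetric]) (simp_all add: assms A_mem mems)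
  also have "P i (A i x) = 0"
    unfolding A_def perp_def using bounded_ops_diff[OF P_ops DT_sub, of "u i x" "P i (u i x)"] assms
    by (simp add: mems P_idem)
  finally show ?thesis by simp
qed

lemma D_T: "D (T i h) = A i (D h) + B i (D (TT h))"
  using data i unfolding factor_data_def A_def B_def u_def by blast

text \<open>
  Condition (4), rewritten for inner products.
\<close>

lemma B_D: "cinner (B i (D h)) (B i (D h')) = cinner h h' - cinner (T i h) (T i h')"
proof -
  have "cinner (B i (D h)) (B i (D h')) = cinner (P i (u i (D h))) (u i (D h'))"
    unfolding B_def using P_sym[of "P i (u i (D h))" "u i (D h')"] by (simp add: mems P_idem)
  also have "\<dots> = cinner (U i (P i (u i (D h)))) (D h')" by (rule U_adj[symmetric]) (simp_all add: mems)
  also have "\<dots> = cinner (D (U i (P i (u i (D h))))) h'" by (rule D_sym[symmetric])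
  also have "D (U i (P i (u i (D h)))) = defect (T i) (defect (T i) h)"
    using data i unfolding factor_data_def u_def by blast
  also have "cinner \<dots> h' = cinner (defect (T i) h) (defect (T i) h')"
    by (rule defect_symmetric[OF contrT[OF i]])
  finally show ?thesis unfolding cinner_defect[OF contrT[OF i]] .
qed

lemma T_TT: "T i (TT h) = TT (T i h)"
  unfolding TT
  by (rule op_prod_commute[where M = UNIV])
     (use Tc i in \<open>auto simp: commuting_def atLeastLessThanSuc_atLeastAtMost simp del: upt_Suc\<close>)

end

definition is_factor where
  "is_factor i R \<longleftrightarrow> R \<in> operators \<and> (\<forall>x y. cinner (R x) (R y) = cinner x y) \<and>
     (\<forall>x. R (V x) = V (R x)) \<and> (\<forall>h. R (J h) = J (T i h) + Lam (B i (D h))) \<and>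
     (\<forall>x\<in>DT. R (Lam x) = Lam (A i x) + v 1 (Lam (B i x)))"

definition "W i = (SOME R. is_factor i R)"

lemma W_factor: assumes i: "i \<in> {1..n}" shows "is_factor i (W i)"
proof -
  obtain R where "R \<in> operators" "\<And>x y. cinner (R x) (R y) = cinner x y"
    "\<And>x. R (V x) = V (R x)" "\<And>h. R (J h) = J (T i h) + Lam (B i (D h))"
    "\<And>x. x \<in> DT \<Longrightarrow> R (Lam x) = Lam (A i x) + v 1 (Lam (B i x))"
    by (rule factor_lift[OF A_mem[OF i] B_mem[OF i] A_continuous[OF i] B_continuous[OF i]
          A_B_orth[OF i] T_TT[OF i] D_T[OF i] B_D[OF i]]) blast+
  then have "\<exists>R. is_factor i R" unfolding is_factor_def by blast
  then show ?thesis unfolding W_def by (rule someI_ex)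
qed

lemma W_ops: "i \<in> {1..n} \<Longrightarrow> W i \<in> operators"
  and W_cinner: "i \<in> {1..n} \<Longrightarrow> cinner (W i x) (W i y) = cinner x y"
  and W_V: "i \<in> {1..n} \<Longrightarrow> W i (V x) = V (W i x)"
  and W_J: "i \<in> {1..n} \<Longrightarrow> W i (J h) = J (T i h) + Lam (B i (D h))"
  and W_Lam: "i \<in> {1..n} \<Longrightarrow> z \<in> DT \<Longrightarrow> W i (Lam z) = Lam (A i z) + v 1 (Lam (B i z))"
  using W_factor unfolding is_factor_def by blast+

lemma W_v: "i \<in> {1..n} \<Longrightarrow> W i (v k x) = v k (W i x)"
  by (rule int_pow_commute[OF V_bij]) (rule W_V)

lemma u_comm:
  assumes i: "i \<in> {1..n}" and j: "j \<in> {1..n}" and x: "x \<in> DT"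
  shows "u i (u j x) = u j (u i x)"
proof -
  have c: "U i (U j y) = U j (U i y)" if "y \<in> DT" for y
    using data i j that by (simp add: factor_data_def commuting_def)
  let ?y = "u i (u j x)"
  have "U j (U i ?y) = x" using i j x by (simp add: Uu mems)
  then have "U i (U j ?y) = x" using c[of ?y] i j x by (simp add: mems)
  then have "u j (u i x) = ?y" using uU i j x by (metis mems)
  then show ?thesis by simp
qed

lemma A_comm:
  assumes "i \<in> {1..n}" "j \<in> {1..n}" "x \<in> DT" shows "A i (A j x) = A j (A i x)"
  using data assms unfolding factor_data_def A_def u_def by blast

lemma B_comm:
  assumes i: "i \<in> {1..n}" and j: "j \<in> {1..n}" and x: "x \<in> DT" shows "B i (B j x) = B j (B i x)"
proof (rule DT_eqI)
  fix z assume z: "z \<in> DT"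
  have adj: "cinner z (B k y) = cinner (U k (P k z)) y" if "k \<in> {1..n}" "y \<in> DT" "z \<in> DT" for k y z
    unfolding B_def using that by (simp add: mems U_adj P_sym)
  have "U j (P j (U i (P i z))) = U i (P i (U j (P j z)))"
    using data i j z unfolding factor_data_def by blast
  then show "cinner z (B i (B j x)) = cinner z (B j (B i x))"
    using i j x z by (simp add: adj B_mem mems)
qed (use i j x in \<open>simp_all add: B_mem\<close>)

text \<open>
  In \<open>u i (u j x) = u j (u i x)\<close> the terms of degree zero and two agree by (2) and (3), and so do the
  mixed terms.
\<close>

lemma AB_comm:
  assumes i: "i \<in> {1..n}" and j: "j \<in> {1..n}" and x: "x \<in> DT"
  shows "B i (A j x) + A i (B j x) = B j (A i x) + A j (B i x)"
proof -
  have e: "u k (u l x) = A k (A l x) + B k (B l x) + (B k (A l x) + A k (B l x))"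
    if k: "k \<in> {1..n}" and l: "l \<in> {1..n}" for k l
  proof -
    have "u k (u l x) = A k (A l x + B l x) + B k (A l x + B l x)" by (simp only: A_B[OF k] A_B[OF l])
    then show ?thesis
      using x by (simp add: A_add[OF k] B_add[OF k] A_mem[OF l] B_mem[OF l] ac_simps)
  qed
  show ?thesis
    using e[OF i j] e[OF j i] u_comm[OF i j x] A_comm[OF i j x] B_comm[OF i j x] by simp
qed

text \<open>
  By (1), \<open>W k (W l (J h))\<close> is expressed through products of the coefficients, which are symmetric in
  \<open>k\<close> and \<open>l\<close>; vectors \<open>J h\<close> suffice because the factors commute with \<open>V\<close>.
\<close>

lemma W_comm: assumes i: "i \<in> {1..n}" and j: "j \<in> {1..n}" shows "W i (W j x) = W j (W i x)"
proof -
  have e: "W k (W l (J h)) = J (T k (T l h)) + Lam (B k (A l (D h)) + A k (B l (D h)))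
      + Lam (B k (B l (D (TT h)))) + v 1 (Lam (B k (B l (D h))))"
    if k: "k \<in> {1..n}" and l: "l \<in> {1..n}" for k l h
    by (simp add: W_J[OF l] W_J[OF k] W_Lam[OF k] UNIV_ops_add[OF W_ops[OF k]] D_T[OF l] B_add[OF k]
        A_mem[OF l] B_mem[OF l] A_mem[OF k] B_mem[OF k] Lam_add ac_simps del: int_pow_simps)
  have "T i (T j h) = T j (T i h)" for h using Tc i j by (simp add: commuting_def)
  then have "W i (W j (J h)) = W j (W i (J h))" for h
    unfolding e[OF i j] e[OF j i] AB_comm[OF i j D_mem] B_comm[OF i j D_mem] by simp
  then have "(\<lambda>x. W i (W j x)) = (\<lambda>x. W j (W i x))"
    by (intro ops_eqI[OF UNIV_ops_comp[OF W_ops[OF j] W_ops[OF i]] UNIV_ops_comp[OF W_ops[OF i] W_ops[OF j]]])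
       (simp add: W_v[OF i] W_v[OF j])
  then show ?thesis by (rule fun_cong)
qed

subsection \<open>The product of the factors\<close>

text \<open>
  \<open>Q k\<close> is the \<open>k\<close>-th summand in condition (5), the conjugate of \<open>P k\<close> by the product of the first
  \<open>k - 1\<close> unitaries. The lists start at \<open>1\<close>, so that \<open>\<phi> k\<close> and \<open>\<psi> k\<close> have \<open>k\<close> factors.
\<close>

definition "\<phi> k = op_prod u [1..<Suc k]"
definition "\<psi> k = op_prod U (rev [1..<Suc k])"
definition "Q k x = \<phi> (k - Suc 0) (P k (\<psi> (k - Suc 0) x))"
definition "c k x = (\<Sum>j=1..k. Q j x)"

lemma \<phi>_0 [simp]: "\<phi> 0 x = x" and \<phi>_Suc: "\<phi> (Suc k) x = \<phi> k (u (Suc k) x)"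
  and \<psi>_0 [simp]: "\<psi> 0 x = x" and \<psi>_Suc: "\<psi> (Suc k) x = U (Suc k) (\<psi> k x)"
  by (simp_all add: \<phi>_def \<psi>_def)

lemma
  assumes "k \<le> n"
  shows \<phi>_mem: "x \<in> DT \<Longrightarrow> \<phi> k x \<in> DT" and \<psi>_mem: "x \<in> DT \<Longrightarrow> \<psi> k x \<in> DT"
    and \<phi>_\<psi>: "x \<in> DT \<Longrightarrow> \<phi> k (\<psi> k x) = x" and \<psi>_\<phi>: "x \<in> DT \<Longrightarrow> \<psi> k (\<phi> k x) = x"
    and \<phi>_adj: "x \<in> DT \<Longrightarrow> y \<in> DT \<Longrightarrow> cinner (\<psi> k x) y = cinner x (\<phi> k y)"
    and \<phi>_add: "x \<in> DT \<Longrightarrow> y \<in> DT \<Longrightarrow> \<phi> k (x + y) = \<phi> k x + \<phi> k y"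
    and \<phi>_diff: "x \<in> DT \<Longrightarrow> y \<in> DT \<Longrightarrow> \<phi> k (x - y) = \<phi> k x - \<phi> k y"
    and \<psi>_add: "x \<in> DT \<Longrightarrow> y \<in> DT \<Longrightarrow> \<psi> k (x + y) = \<psi> k x + \<psi> k y"
    and \<psi>_diff: "x \<in> DT \<Longrightarrow> y \<in> DT \<Longrightarrow> \<psi> k (x - y) = \<psi> k x - \<psi> k y"
proof -
  have *: "(x \<in> DT \<longrightarrow> \<phi> k x \<in> DT \<and> \<psi> k x \<in> DT \<and> \<phi> k (\<psi> k x) = x \<and> \<psi> k (\<phi> k x) = x) \<and>
    (x \<in> DT \<longrightarrow> y \<in> DT \<longrightarrow> cinner (\<psi> k x) y = cinner x (\<phi> k y) \<and>
       \<phi> k (x + y) = \<phi> k x + \<phi> k y \<and> \<phi> k (x - y) = \<phi> k x - \<phi> k y \<and>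
       \<psi> k (x + y) = \<psi> k x + \<psi> k y \<and> \<psi> k (x - y) = \<psi> k x - \<psi> k y)" for x y
    using assms
  proof (induction k arbitrary: x y)
    case (Suc k)
    then have k: "k \<le> n" and i: "Suc k \<in> {1..n}" by auto
    note IH = Suc.IH[OF k]
    show ?case
      using IH by (auto simp: \<phi>_Suc \<psi>_Suc mems[OF i] Uu[OF i] uU[OF i] U_adj[OF i]
        bounded_ops_add[OF u_ops[OF i]] bounded_ops_diff[OF u_ops[OF i] DT_sub]
        bounded_ops_add[OF U_ops[OF i]] bounded_ops_diff[OF U_ops[OF i] DT_sub])
  qed simp
  show "x \<in> DT \<Longrightarrow> \<phi> k x \<in> DT" "x \<in> DT \<Longrightarrow> \<psi> k x \<in> DT"
    "x \<in> DT \<Longrightarrow> \<phi> k (\<psi> k x) = x" "x \<in> DT \<Longrightarrow> \<psi> k (\<phi> k x) = x"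
    "x \<in> DT \<Longrightarrow> y \<in> DT \<Longrightarrow> cinner (\<psi> k x) y = cinner x (\<phi> k y)"
    "x \<in> DT \<Longrightarrow> y \<in> DT \<Longrightarrow> \<phi> k (x + y) = \<phi> k x + \<phi> k y"
    "x \<in> DT \<Longrightarrow> y \<in> DT \<Longrightarrow> \<phi> k (x - y) = \<phi> k x - \<phi> k y"
    "x \<in> DT \<Longrightarrow> y \<in> DT \<Longrightarrow> \<psi> k (x + y) = \<psi> k x + \<psi> k y"
    "x \<in> DT \<Longrightarrow> y \<in> DT \<Longrightarrow> \<psi> k (x - y) = \<psi> k x - \<psi> k y"
    using * by blast+
qed

lemma sum_Q: assumes "x \<in> DT" shows "c n x = x"
proof -
  have "op_prod u [1..<k] (P k (op_prod U (rev [1..<k]) x)) = Q k x" if "k \<in> {1..n}" for k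
    using that by (cases k) (simp_all add: Q_def \<phi>_def \<psi>_def)
  then have "c n x = (\<Sum>k=1..n. op_prod u [1..<k] (P k (op_prod U (rev [1..<k]) x)))"
    unfolding c_def by (intro sum.cong) auto
  also have "\<dots> = x" using data assms unfolding factor_data_def u_def[abs_def] by blast
  finally show ?thesis .
qed

context
  fixes k assumes k: "k \<in> {1..n}"
begin

lemma k1: "k - Suc 0 \<le> n" using k by auto

lemma Q_mem: "x \<in> DT \<Longrightarrow> Q k x \<in> DT"
  by (simp add: Q_def \<phi>_mem[OF k1] \<psi>_mem[OF k1] mems[OF k])

lemma Q_idem: "x \<in> DT \<Longrightarrow> Q k (Q k x) = Q k x"
  by (simp add: Q_def \<phi>_mem[OF k1] \<psi>_mem[OF k1] mems[OF k] \<psi>_\<phi>[OF k1] P_idem[OF k])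

lemma Q_sym: assumes "x \<in> DT" "y \<in> DT" shows "cinner (Q k x) y = cinner x (Q k y)"
proof -
  have "cinner (Q k x) y = cinner (P k (\<psi> (k - Suc 0) x)) (\<psi> (k - Suc 0) y)"
    unfolding Q_def using \<phi>_adj[OF k1 assms(2), of "P k (\<psi> (k - Suc 0) x)"] assms
    by (metis cinner_commute \<psi>_mem[OF k1] mems(1)[OF k])
  also have "\<dots> = cinner (\<psi> (k - Suc 0) x) (P k (\<psi> (k - Suc 0) y))"
    by (rule P_sym[OF k]) (simp_all add: assms \<psi>_mem[OF k1])
  also have "\<dots> = cinner x (Q k y)"
    unfolding Q_def by (rule \<phi>_adj[OF k1]) (simp_all add: assms \<psi>_mem[OF k1] mems[OF k])
  finally show ?thesis .
qed

lemma Q_add: "x \<in> DT \<Longrightarrow> y \<in> DT \<Longrightarrow> Q k (x + y) = Q k x + Q k y"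
  by (simp add: Q_def \<psi>_add[OF k1] \<phi>_add[OF k1] bounded_ops_add[OF P_ops[OF k]] mems[OF k] \<psi>_mem[OF k1])

lemma Q_diff: "x \<in> DT \<Longrightarrow> y \<in> DT \<Longrightarrow> Q k (x - y) = Q k x - Q k y"
  by (simp add: Q_def \<psi>_diff[OF k1] \<phi>_diff[OF k1] bounded_ops_diff[OF P_ops[OF k] DT_sub] mems[OF k] \<psi>_mem[OF k1])

end

text \<open>
  Projections that sum to the identity are mutually orthogonal: for \<open>y\<close> in the range of \<open>Q j\<close> the
  numbers \<open>\<parallel>Q k y\<parallel>\<^sup>2\<close> add up to \<open>\<parallel>y\<parallel>\<^sup>2 = \<parallel>Q j y\<parallel>\<^sup>2\<close>.
\<close>

lemma Q_orth:
  assumes i: "i \<in> {1..n}" and j: "j \<in> {1..n}" and ij: "i \<noteq> j" and x: "x \<in> DT"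
  shows "Q i (Q j x) = 0"
proof -
  define y where "y = Q j x"
  have y: "y \<in> DT" unfolding y_def by (rule Q_mem[OF j x])
  have nn: "cinner (Q k y) y = of_real ((norm (Q k y))\<^sup>2)" if "k \<in> {1..n}" for k
    using Q_sym[OF that Q_mem[OF that y] y] Q_idem[OF that y] unfolding cinner_self[symmetric] by simp
  have "(\<Sum>k=1..n. cinner (Q k y) y) = cinner y y"
  proof -
    have sm: "cinner (\<Sum>k\<in>K. Q k y) y = (\<Sum>k\<in>K. cinner (Q k y) y)" for K
      by (induction K rule: infinite_finite_induct) (auto simp: cinner_add_left)
    show ?thesis unfolding sm[symmetric] using sum_Q[OF y] by (simp only: c_def)
  qed
  moreover have "(\<Sum>k=1..n. cinner (Q k y) y) = (\<Sum>k=1..n. of_real ((norm (Q k y))\<^sup>2))"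
    by (rule sum.cong[OF refl nn])
  ultimately have "complex_of_real (\<Sum>k=1..n. (norm (Q k y))\<^sup>2) = complex_of_real ((norm y)\<^sup>2)"
    by (simp only: cinner_self of_real_sum)
  then have s: "(\<Sum>k=1..n. (norm (Q k y))\<^sup>2) = (norm y)\<^sup>2" using of_real_eq_iff by blast
  have Qj: "Q j y = y" unfolding y_def by (rule Q_idem[OF j x])
  have "(\<Sum>k=1..n. (norm (Q k y))\<^sup>2) = (norm (Q j y))\<^sup>2 + (\<Sum>k\<in>{1..n} - {j}. (norm (Q k y))\<^sup>2)"
    using j by (intro sum.remove) auto
  then have "(\<Sum>k\<in>{1..n} - {j}. (norm (Q k y))\<^sup>2) = 0" using s Qj by simp
  then have "(norm (Q i y))\<^sup>2 = 0" using i ij by (subst (asm) sum_nonneg_eq_0_iff) auto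
  then show ?thesis by (simp add: y_def)
qed

lemma c_mem: "k \<le> n \<Longrightarrow> x \<in> DT \<Longrightarrow> c k x \<in> DT"
  unfolding c_def by (intro complex_vector.subspace_sum[OF DT_sub] Q_mem) auto

lemma c_add: "k \<le> n \<Longrightarrow> x \<in> DT \<Longrightarrow> y \<in> DT \<Longrightarrow> c k (x + y) = c k x + c k y"
  unfolding c_def sum.distrib[symmetric] by (intro sum.cong Q_add) auto

lemma c_diff: "k \<le> n \<Longrightarrow> x \<in> DT \<Longrightarrow> y \<in> DT \<Longrightarrow> c k (x - y) = c k x - c k y"
  unfolding c_def sum_subtractf[symmetric] by (intro sum.cong Q_diff) auto

lemma c_Q: assumes "Suc k \<le> n" "x \<in> DT" shows "c k (Q (Suc k) x) = 0"
  unfolding c_def by (intro sum.neutral ballI Q_orth) (use assms in auto)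

text \<open>
  The product of the first \<open>k\<close> factors acts as the linear polynomial \<open>(\<phi> k - c k \<phi> k) + z (c k \<phi> k)\<close>. In the
  induction step the coefficient of \<open>z\<^sup>2\<close> is \<open>c k\<close> applied to a vector in the range of \<open>Q (k + 1)\<close>, which
  vanishes by orthogonality.
\<close>

lemma W_prefix:
  assumes "k \<le> n"
  shows "op_prod W [1..<Suc k] (J h) = J (op_prod T [1..<Suc k] h) + Lam (c k (\<phi> k (D h)))
    \<and> (x \<in> DT \<longrightarrow> op_prod W [1..<Suc k] (Lam x)
        = Lam (\<phi> k x - c k (\<phi> k x)) + v 1 (Lam (c k (\<phi> k x))))"
  using assms
proof (induction k arbitrary: h x)
  case 0
  have "Lam 0 = 0" by (rule bounded_ops_zero[OF Lam_ops DT_sub])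
  then show ?case by (simp add: c_def v_0 del: int_pow_simps) 
next
  case (Suc k)
  then have k: "k \<le> n" and i: "Suc k \<in> {1..n}" by auto
  note IH = Suc.IH[OF k]
  let ?F = "op_prod W [1..<Suc k]" and ?i = "Suc k"
  define b where "b x = c k (\<phi> k x)" for x
  define a where "a x = \<phi> k x - b x" for x
  have IHJ: "?F (J h) = J (op_prod T [1..<Suc k] h) + Lam (b (D h))" for h
    using IH unfolding b_def by blast
  have IHL: "?F (Lam x) = Lam (a x) + v 1 (Lam (b x))" if "x \<in> DT" for x
    using IH that unfolding b_def a_def by blast
  have F_add: "?F (x + y) = ?F x + ?F y" for x y
    by (rule op_prod_preserves_add[where M = UNIV]) (use k UNIV_ops_add[OF W_ops] in \<open>auto simp del: upt_Suc\<close>)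
  have Fv: "?F (v l x) = v l (?F x)" for l x
    by (rule op_prod_commute[where M = UNIV, symmetric]) (use k W_v in \<open>auto simp del: upt_Suc\<close>)
  have bm: "b x \<in> DT" and am: "a x \<in> DT" if "x \<in> DT" for x
    using that k by (simp_all add: a_def b_def c_mem \<phi>_mem)
  have b_add: "b (x + y) = b x + b y" if "x \<in> DT" "y \<in> DT" for x y
    using that k by (simp add: b_def \<phi>_add c_add \<phi>_mem)
  have b_diff: "b (x - y) = b x - b y" if "x \<in> DT" "y \<in> DT" for x y
    using that k by (simp add: b_def \<phi>_diff c_diff \<phi>_mem)
  have \<phi>B: "\<phi> k (B ?i x) = Q ?i (\<phi> (Suc k) x)" if "x \<in> DT" for x
    using that k by (simp add: Q_def \<phi>_Suc B_def \<psi>_\<phi> mems[OF i])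
  have bB: "b (B ?i x) = 0" if "x \<in> DT" for x
    unfolding b_def \<phi>B[OF that] by (rule c_Q) (use that Suc.prems \<phi>_mem in auto)
  have c': "c (Suc k) (\<phi> (Suc k) x) = b (u ?i x) + \<phi> k (B ?i x)" if "x \<in> DT" for x
    using that unfolding \<phi>B[OF that] by (simp add: c_def b_def \<phi>_Suc)
  have Ax: "A ?i x = u ?i x - B ?i x" for x using A_B[of ?i x] by (simp add: algebra_simps A_def B_def perp_def)
  have bA: "b (A ?i x) = b (u ?i x)" if "x \<in> DT" for x
    unfolding Ax using that by (simp add: b_diff mems[OF i] B_mem[OF i] bB)
  have aB: "a (B ?i x) = \<phi> k (B ?i x)" if "x \<in> DT" for x using bB[OF that] by (simp add: a_def)
  have J1: "op_prod W [1..<Suc (Suc k)] (J h) = J (op_prod T [1..<Suc (Suc k)] h) + Lam (c (Suc k) (\<phi> (Suc k) (D h)))"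
  proof -
    have "op_prod W [1..<Suc (Suc k)] (J h) = ?F (J (T ?i h)) + ?F (Lam (B ?i (D h)))"
      using W_J[OF i, of h] F_add by simp
    also have "\<dots> = J (op_prod T [1..<Suc k] (T ?i h)) + Lam (b (D (T ?i h))) + Lam (a (B ?i (D h))) + v 1 (Lam (b (B ?i (D h))))"
      unfolding IHJ using IHL[OF B_mem[OF i D_mem]] by (simp add: ac_simps del: upt_Suc int_pow_simps)
    also have "b (D (T ?i h)) = b (u ?i (D h))"
      unfolding D_T[OF i] by (simp add: b_add A_mem[OF i] B_mem[OF i] bA bB)
    also have "b (B ?i (D h)) = 0" by (simp add: bB)
    finally show ?thesis
      unfolding c'[OF D_mem] aB[OF D_mem]
      by (simp add: Lam_add bm mems[OF i] B_mem[OF i] \<phi>_mem[OF k] v_0 bounded_ops_zero[OF Lam_ops DT_sub] del: int_pow_simps)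
  qed
  have "op_prod W [1..<Suc (Suc k)] (Lam x) = Lam (\<phi> (Suc k) x - c (Suc k) (\<phi> (Suc k) x)) + v 1 (Lam (c (Suc k) (\<phi> (Suc k) x)))"
    if x: "x \<in> DT" for x
  proof -
    have "op_prod W [1..<Suc (Suc k)] (Lam x) = ?F (Lam (A ?i x)) + v 1 (?F (Lam (B ?i x)))"
      using W_Lam[OF i x] F_add Fv by (simp del: int_pow_simps)
    also have "\<dots> = Lam (a (A ?i x)) + v 1 (Lam (b (A ?i x))) + (v 1 (Lam (a (B ?i x))) + v 1 (v 1 (Lam (b (B ?i x)))))"
      unfolding IHL[OF A_mem[OF i x]] IHL[OF B_mem[OF i x]] v_linear[THEN conjunct1] ..
    also have "b (B ?i x) = 0" by (rule bB[OF x])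
    also have "a (A ?i x) = \<phi> (Suc k) x - c (Suc k) (\<phi> (Suc k) x)"
      unfolding c'[OF x] a_def bA[OF x] unfolding Ax \<phi>_Suc
      using x by (simp add: \<phi>_diff[OF k] mems[OF i] B_mem[OF i])
    finally show ?thesis
      unfolding bA[OF x] aB[OF x] c'[OF x] using x
      by (simp add: Lam_add bm mems[OF i] B_mem[OF i] \<phi>_mem[OF k] v_0 v_linear bounded_ops_zero[OF Lam_ops DT_sub]
          ac_simps del: int_pow_simps)
  qed
  with J1 show ?case by blast
qed

lemma \<phi>_n: assumes x: "x \<in> DT" shows "\<phi> n x = x"
proof -
  have "U i (U j y) = U j (U i y)" if "i \<in> {1..n}" "j \<in> {1..n}" "y \<in> DT" for i j y
    using data that by (simp add: factor_data_def commuting_def)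
  then have "\<psi> n x = tuple_prod n U x"
    unfolding \<psi>_def by (intro op_prod_rev[where M = DT]) (use x mems in \<open>auto simp del: upt_Suc\<close>)
  also have "\<dots> = x" using data x unfolding factor_data_def by blast
  finally show ?thesis using \<phi>_\<psi>[OF order_refl x] by simp
qed

lemma W_prod: "tuple_prod n W = V"
proof (rule ops_eqI)
  show "tuple_prod n W \<in> operators"
    using monom_ops[of n W "\<lambda>_. 1"] W_ops by (simp del: upt_Suc)
  show "V \<in> operators" by (rule V_ops)
  fix k h
  have "tuple_prod n W (v k (J h)) = v k (tuple_prod n W (J h))"
    by (rule op_prod_commute[where M = UNIV, symmetric]) (use W_v in \<open>auto simp del: upt_Suc\<close>)
  also have "tuple_prod n W (J h) = J (TT h) + Lam (D h)"
    using W_prefix[OF order_refl, of h] unfolding TT[symmetric] \<phi>_n[OF D_mem] sum_Q[OF D_mem] by blast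
  also have "\<dots> = V (J h)" by (simp add: Lam_D)
  finally show "tuple_prod n W (v k (J h)) = V (v k (J h))" by (simp add: v_V add.commute del: upt_Suc)
qed

lemma W_commuting: "commuting UNIV n W" using W_comm by (simp add: commuting_def)

text \<open>
  Surjectivity is inherited from \<open>V\<close>, which is \<open>W i\<close> times a product of the other factors.
\<close>

lemma W_unitary: assumes i: "i \<in> {1..n}" shows "unitary UNIV UNIV (W i)"
proof (rule unitaryI[OF _ W_ops[OF i] W_cinner[OF i]])
  fix y
  let ?d = "\<lambda>j. if j = i then 1 else 0 :: nat"
  obtain z where z: "y = V z" using V_bij by (metis bij_pointE)
  have "V z = op_monom n W (\<lambda>j. ?d j + (1 - ?d j)) z"
  proof -
    have "op_monom n W (\<lambda>j. ?d j + (1 - ?d j)) = op_monom n W (\<lambda>j. 1)" by (rule monom_cong) simp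
    then show ?thesis using W_prod by (simp only: monom_one)
  qed
  also have "\<dots> = W i (op_monom n W (\<lambda>j. 1 - ?d j) z)"
    unfolding monom_add[OF W_commuting] monom_single[OF i] ..
  finally show "\<exists>x\<in>UNIV. W i x = y" using z by auto
qed simp

text \<open>
  The dilation property of monomials rests on properties of the single factors that are stable under
  composition: they leave \<open>future\<close> invariant and act as the given operators modulo \<open>future\<close>.
\<close>

definition compresses where
  "compresses f g \<longleftrightarrow> (\<forall>x y. f (x + y) = f x + f y) \<and> (\<forall>y\<in>future. f y \<in> future) \<and>
     (\<forall>h. \<exists>y\<in>future. f (J h) = J (g h) + y)"

lemma compresses_id: "compresses id id"
  unfolding compresses_def future_def by (auto intro!: bexI[of _ 0] complex_vector.span_zero)

lemma compresses_comp: assumes "compresses f g" "compresses f' g'" shows "compresses (f \<circ> f') (g \<circ> g')"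
  unfolding compresses_def
proof (intro conjI allI ballI)
  fix h
  obtain y where y: "y \<in> future" "f' (J h) = J (g' h) + y" using assms(2) unfolding compresses_def by blast
  obtain z where z: "z \<in> future" "f (J (g' h)) = J (g (g' h)) + z" using assms(1) unfolding compresses_def by blast
  have "f (f' (J h)) = J (g (g' h)) + (z + f y)"
    using assms(1) y z unfolding compresses_def by (simp add: ac_simps)
  moreover have "z + f y \<in> future"
    using assms(1) y z unfolding compresses_def future_def by (simp add: complex_vector.span_add)
  ultimately show "\<exists>y\<in>future. (f \<circ> f') (J h) = J ((g \<circ> g') h) + y" by auto
qed (use assms in \<open>simp_all add: compresses_def\<close>)

lemma compresses_W: assumes i: "i \<in> {1..n}" shows "compresses (W i) (T i)"
  unfolding compresses_def
proof (intro conjI allI ballI)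
  show "W i (x + y) = W i x + W i y" for x y by (rule UNIV_ops_add[OF W_ops[OF i]])
  show "\<exists>y\<in>future. W i (J h) = J (T i h) + y" for h
    using W_J[OF i] future_base[of "B i (D h)" 0] B_mem[OF i] by auto
  fix y assume "y \<in> future"
  then show "W i y \<in> future"
    unfolding future_def
  proof (induction rule: complex_vector.span_induct)
    case base
    show ?case
      unfolding complex_vector.subspace_def
      using bounded_ops_zero[OF W_ops[OF i]]
      by (auto simp: UNIV_ops_add[OF W_ops[OF i]] UNIV_ops_scaleC[OF W_ops[OF i]]
          complex_vector.span_zero complex_vector.span_add complex_vector.span_scale)
  next
    case (step z)
    then obtain k x where z: "z = v (int k) (Lam x)" and x: "x \<in> DT" by auto
    have "W i z = v (int k) (Lam (A i x)) + v (int (Suc k)) (Lam (B i x))"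
      unfolding z W_v[OF i] W_Lam[OF i x] v_linear[THEN conjunct1] v_add[symmetric] by (simp add: add.commute)
    then show ?case
      using future_base[OF A_mem[OF i x], of k] future_base[OF B_mem[OF i x], of "Suc k"]
      unfolding future_def by (simp only: complex_vector.span_add)
  qed
qed

lemma compresses_monom: "compresses (op_monom n W \<alpha>) (op_monom n T \<alpha>)"
proof -
  have pow: "compresses (W i ^^ m) (T i ^^ m)" if "i \<in> {1..n}" for i m
  proof (induction m)
    case (Suc m)
    then show ?case unfolding funpow.simps by (intro compresses_comp compresses_W that)
  qed (simp only: funpow.simps compresses_id)
  have "compresses (op_prod (\<lambda>i. W i ^^ \<alpha> i) js) (op_prod (\<lambda>i. T i ^^ \<alpha> i) js)" if "set js \<subseteq> {1..n}" for js
    using that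
  proof (induction js)
    case Nil
    show ?case by (simp only: op_prod_unfold compresses_id)
  next
    case (Cons j js)
    then have "compresses ((W j ^^ \<alpha> j) \<circ> op_prod (\<lambda>i. W i ^^ \<alpha> i) js) ((T j ^^ \<alpha> j) \<circ> op_prod (\<lambda>i. T i ^^ \<alpha> i) js)"
      by (intro compresses_comp pow) auto
    then show ?case by (simp only: op_prod_unfold)
  qed
  then show ?thesis by (simp add: atLeastLessThanSuc_atLeastAtMost del: upt_Suc)
qed

lemma W_dilation: "unitary_dilation J n W T"
  unfolding unitary_dilation_def
proof (intro conjI allI ballI J_iso W_unitary W_commuting)
  fix \<alpha> h
  obtain y where y: "y \<in> future" "op_monom n W \<alpha> (J h) = J (op_monom n T \<alpha> h) + y"
    using compresses_monom unfolding compresses_def by blast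
  have "orth_proj (range J) (op_monom n W \<alpha> (J h)) = J (op_monom n T \<alpha> h)"
    unfolding orth_proj_isometry[OF J_iso] y(2) using future_orth_J[OF y(1)] by simp
  then show "J (op_monom n T \<alpha> h) = orth_proj (range J) (op_monom n W \<alpha> (J h))" ..
qed

lemma determined_by_W:
  assumes "i \<in> {1..n}"
  shows "B i (D h) = Lam_adj (W i (J h) - J (T i h))" "x \<in> DT \<Longrightarrow> A i x = Lam_adj (W i (Lam x))"
  using assms Lam_adj_v_Lam[of "B i x" 1]
  by (simp_all add: W_J W_Lam B_mem A_mem Lam_adj_add del: int_pow_simps)

end

text \<open>
  Both families lead to dilations on the same space with the same product \<open>V\<close>, and such dilations
  coincide. The dilation determines \<open>A i\<close> and \<open>B i\<close>, hence \<open>U i\<^sup>* = A i + B i\<close> and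
  \<open>P i = B i U i\<close>.
\<close>

lemma factor_data_unique:
  assumes "factor_data_dilation J V TT n T P U" "factor_data_dilation J V TT n T P' U'"
  shows "P = P' \<and> U = U'"
proof -
  interpret X: factor_data_dilation J V TT n T P U by (rule assms(1))
  interpret Y: factor_data_dilation J V TT n T P' U' by (rule assms(2))
  have d: "min_dilation J V (tuple_prod n T)" using X.min_dilation_axioms unfolding X.TT .
  have W: "X.W i = Y.W i" if i: "i \<in> {1..n}" for i
  proof -
    let ?d = "\<lambda>j. if j = i then 1 else 0 :: nat"
    have "?d j \<le> 1" for j by simp
    then show ?thesis
      using min_dilation.factor_pair_unique[OF d
          monom_factor_pair[OF d X.W_dilation X.W_prod[symmetric] X.Tc, of ?d]
          monom_factor_pair[OF d Y.W_dilation Y.W_prod[symmetric] X.Tc, of ?d]]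
      unfolding monom_single[OF i] by blast
  qed
  have B: "X.B i x = Y.B i x" if "i \<in> {1..n}" "x \<in> X.DT" for i x
    by (rule X.DT_agree[OF X.B_continuous[OF that(1)] Y.B_continuous[OF that(1)] _ that(2)])
       (simp only: X.determined_by_W(1)[OF that(1)] Y.determined_by_W(1)[OF that(1)] W[OF that(1)])
  have A: "X.A i x = Y.A i x" if "i \<in> {1..n}" "x \<in> X.DT" for i x
    using that by (simp add: X.determined_by_W(2) Y.determined_by_W(2) W)
  have u: "X.u i x = Y.u i x" if "i \<in> {1..n}" "x \<in> X.DT" for i x
    using A[OF that] B[OF that] X.A_B[OF that(1), of x] Y.A_B[OF that(1), of x] by simp
  have U: "U i = U' i" if i: "i \<in> {1..n}" for i
  proof (rule extensionalityI[OF bounded_ops_extensional[OF X.U_ops[OF i]] bounded_ops_extensional[OF Y.U_ops[OF i]]])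
    fix x assume x: "x \<in> X.DT"
    have "U' i x = U' i (Y.u i (U i x))" using X.uU[OF i x] u[OF i X.mems(2)[OF i x]] by simp
    also have "\<dots> = U i x" by (rule Y.Uu[OF i X.mems(2)[OF i x]])
    finally show "U i x = U' i x" ..
  qed
  have P: "P i = P' i" if i: "i \<in> {1..n}" for i
  proof (rule extensionalityI[OF bounded_ops_extensional[OF X.P_ops[OF i]] bounded_ops_extensional[OF Y.P_ops[OF i]]])
    fix x assume x: "x \<in> X.DT"
    have m: "U i x \<in> X.DT" by (rule X.mems(2)[OF i x])
    have "X.u i (U i x) = x" "Y.u i (U i x) = x" using X.uU[OF i x] u[OF i m] by simp_all
    then show "P i x = P' i x" using B[OF i m] by (simp add: X.B_def Y.B_def)
  qed
  show ?thesis
    using P U by (auto intro!: extensionalityI[OF X.extensionals(1) Y.extensionals(1)]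
        extensionalityI[OF X.extensionals(2) Y.extensionals(2)])
qed

section \<open>The characterization\<close>

lemma contraction_op_prod:
  assumes "\<And>i. i \<in> set js \<Longrightarrow> contraction (A i)" shows "contraction (op_prod A js)"
  using assms
proof (induction js)
  case Nil
  have "(id :: 'a \<Rightarrow> 'a) \<in> operators" by (rule bounded_opsI[where B = 1]) auto
  then show ?case unfolding op_prod_unfold by (rule contractionI) simp
next
  case (Cons j js)
  then have c: "contraction (A j)" "contraction (op_prod A js)" by auto
  have e: "op_prod A (j # js) = (\<lambda>x. A j (op_prod A js x))" by (simp add: fun_eq_iff)
  show ?case unfolding e
    by (intro contractionI UNIV_ops_comp[OF contraction_ops[OF c(2)] contraction_ops[OF c(1)]]
        order_trans[OF contraction_norm_le[OF c(1)] contraction_norm_le[OF c(2)]])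
qed

lemma tuple_prod_int_pow:
  assumes bij: "\<And>i. i \<in> {1..n} \<Longrightarrow> bij (W i)" and c: "commuting UNIV n W" and V: "bij (tuple_prod n W)"
  shows "tuple_prod n (\<lambda>i. int_pow (W i) k) x = int_pow (tuple_prod n W) k x"
proof -
  have list: "op_prod (\<lambda>i. int_pow (W i) (k + 1)) js x = op_prod W js (op_prod (\<lambda>i. int_pow (W i) k) js x)"
    if "set js \<subseteq> {1..n}" for js k x
    using that
  proof (induction js)
    case (Cons j js)
    have "W i (W j z) = W j (W i z)" if "i \<in> set js" for i z
      using c Cons.prems that unfolding commuting_def by auto
    then have "int_pow (W j) k (W i z) = W i (int_pow (W j) k z)" if "i \<in> set js" for i z
      using int_pow_commute[OF bij[of j], of "W i" k z] Cons.prems that by auto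
    then have "int_pow (W j) k (op_prod W js y) = op_prod W js (int_pow (W j) k y)" for y
      by (intro op_prod_commute[where M = UNIV]) auto
    then show ?case using Cons int_pow_step[OF bij[of j]] by simp
  qed simp
  have step: "tuple_prod n (\<lambda>i. int_pow (W i) (k + 1)) x = tuple_prod n W (tuple_prod n (\<lambda>i. int_pow (W i) k) x)" for k
    by (rule list) (simp add: atLeastLessThanSuc_atLeastAtMost del: upt_Suc)
  show ?thesis
  proof (induction k rule: int_induct[of _ 0])
    case base
    have "op_prod (\<lambda>i. int_pow (W i) 0) js x = x" for js by (induction js) auto
    then show ?case by (simp only: int_pow_simps(1)[of "tuple_prod n W"])
  next
    case (step1 i)
    then show ?case unfolding step int_pow_step[OF V] by simp
  next
    case (step2 i)
    have "tuple_prod n W (tuple_prod n (\<lambda>j. int_pow (W j) (i - 1)) x) = tuple_prod n W (int_pow (tuple_prod n W) (i - 1) x)"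
      using step[of "i - 1"] int_pow_step[OF V, of "i - 1" x] step2(2) by (simp del: upt_Suc)
    then show ?case using V by (meson bij_is_inj injD)
  qed
qed

text \<open>
  The powers of the product occur among the monomials in the tuple, so that these span at least as much.
\<close>

lemma minimal_of_product_minimal:
  assumes W: "unitary_dilation J n W T"
    and min: "minimal_unitary_dilation_single J (tuple_prod n W) TT"
  shows "minimal_unitary_dilation J n W T"
proof -
  let ?V = "tuple_prod n W"
  have V: "unitary UNIV UNIV ?V"
    using min by (simp add: minimal_unitary_dilation_def unitary_dilation_def del: upt_Suc)
  have Wu: "\<And>i. i \<in> {1..n} \<Longrightarrow> unitary UNIV UNIV (W i)" and Wc: "commuting UNIV n W"
    using W by (auto simp: unitary_dilation_def)
  let ?S = "{tuple_prod n (\<lambda>i. int_pow (W i) (t i)) (J h) | (t :: nat \<Rightarrow> int) h. True}"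
  have "tuple_prod 1 (\<lambda>i. int_pow ?V (t i)) (J h) \<in> ?S" for t :: "nat \<Rightarrow> int" and h
  proof -
    have "tuple_prod 1 (\<lambda>i. int_pow ?V (t i)) (J h) = int_pow ?V (t 1) (J h)" by simp
    also have "\<dots> = tuple_prod n (\<lambda>i. int_pow (W i) (t 1)) (J h)"
      by (rule tuple_prod_int_pow[OF unitary_UNIV_bij[OF Wu] Wc unitary_UNIV_bij[OF V], symmetric])
    finally have "tuple_prod 1 (\<lambda>i. int_pow ?V (t i)) (J h) = tuple_prod n (\<lambda>i. int_pow (W i) (t 1)) (J h)" .
    then show ?thesis by (intro CollectI exI[of _ "\<lambda>_. t 1"] exI[of _ h] conjI TrueI)
  qed
  then have "{tuple_prod 1 (\<lambda>i. int_pow ?V (t i)) (J h) | (t :: nat \<Rightarrow> int) h. True} \<subseteq> ?S" by blast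
  then have "closure (cspan {tuple_prod 1 (\<lambda>i. int_pow ?V (t i)) (J h) | (t :: nat \<Rightarrow> int) h. True})
      \<subseteq> closure (cspan ?S)"
    by (intro closure_mono complex_vector.span_mono)
  then have "closure (cspan ?S) = UNIV"
    using min unfolding minimal_unitary_dilation_def by blast
  then show ?thesis using W unfolding minimal_unitary_dilation_def by blast
qed

lemma dilation_unique:
  assumes d: "min_dilation J V (tuple_prod n T)" "min_dilation J' V' (tuple_prod n T)"
    and W: "unitary_dilation J n W T" "V = tuple_prod n W"
    and X: "unitary_dilation J' n X T" "V' = tuple_prod n X" and T: "commuting UNIV n T"
  shows "\<exists>\<rho>. unitary UNIV UNIV \<rho> \<and> (\<forall>i\<in>{1..n}. X i = \<rho> \<circ> W i \<circ> adj UNIV UNIV \<rho>)"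
proof -
  obtain \<rho> where \<rho>: "unitary UNIV UNIV \<rho>"
    and tr: "\<And>R R' Q Q' S S' x. min_dilation.factor_pair J V (tuple_prod n T) R R' S S' \<Longrightarrow>
       min_dilation.factor_pair J' V' (tuple_prod n T) Q Q' S S' \<Longrightarrow> \<rho> (R x) = Q (\<rho> x)"
    using factor_pair_transport[OF d] by metis
  have "X i y = \<rho> (W i (adj UNIV UNIV \<rho> y))" if i: "i \<in> {1..n}" for i y
  proof -
    let ?d = "\<lambda>j. if j = i then 1 else 0 :: nat"
    have "?d j \<le> 1" for j by simp
    then have "\<rho> (W i x) = X i (\<rho> x)" for x
      using tr[OF monom_factor_pair[OF d(1) W T, of ?d] monom_factor_pair[OF d(2) X T, of ?d]]
      unfolding monom_single[OF i] by blast
    then show ?thesis using \<rho> by (simp add: unitary_def)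
  qed
  then show ?thesis using \<rho> by (auto simp: fun_eq_iff)
qed

theorem theorem1p3:
  fixes T :: "nat \<Rightarrow> 'h::chilbert_space \<Rightarrow> 'h" and n :: nat
    and TT :: "'h \<Rightarrow> 'h" and D :: "'h \<Rightarrow> 'h" and DT :: "'h set"
  assumes n: "n \<ge> 1"
    and contr: "\<forall>i\<in>{1..n}. contraction (T i)"
    and comm: "commuting UNIV n T"
    and TT: "TT = tuple_prod n T"
    and D: "D = defect TT"
    and DT: "DT = defect_space TT"
  shows
    "((\<exists>(J :: 'h \<Rightarrow> 'k::chilbert_space) V. minimal_unitary_dilation_single J V TT) \<longrightarrow>
     ((\<exists>(J :: 'h \<Rightarrow> 'k) W. unitary_dilation J n W T \<and>
        minimal_unitary_dilation_single J (tuple_prod n W) TT) \<longleftrightarrow>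
     (\<exists>!(P, U).
        P \<in> extensional {1..n} \<and> U \<in> extensional {1..n} \<and>
        (\<forall>i\<in>{1..n}. projection DT (P i)) \<and>
        (\<forall>i\<in>{1..n}. unitary DT DT (U i)) \<and>
        commuting DT n U \<and>
        (\<forall>x\<in>DT. tuple_prod n U x = x) \<and>
        (\<forall>i\<in>{1..n}. \<forall>h.
           D (T i h) = perp (P i) (adj DT DT (U i) (D h)) + P i (adj DT DT (U i) (D (TT h)))) \<and>
        (\<forall>i\<in>{1..n}. \<forall>j\<in>{1..n}. \<forall>x\<in>DT.
           perp (P i) (adj DT DT (U i) (perp (P j) (adj DT DT (U j) x))) =
           perp (P j) (adj DT DT (U j) (perp (P i) (adj DT DT (U i) x)))) \<and>
        (\<forall>i\<in>{1..n}. \<forall>j\<in>{1..n}. \<forall>x\<in>DT.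
           U i (P i (U j (P j x))) = U j (P j (U i (P i x)))) \<and>
        (\<forall>i\<in>{1..n}. \<forall>h.
           D (U i (P i (adj DT DT (U i) (D h)))) = defect (T i) (defect (T i) h)) \<and>
        (\<forall>x\<in>DT.
           (\<Sum>k=1..n. op_prod (\<lambda>i. adj DT DT (U i)) [1..<k]
                        (P k (op_prod U (rev [1..<k]) x))) = x)))) \<and>
     (\<forall>(J :: 'h \<Rightarrow> 'k) W.
       unitary_dilation J n W T \<and>
       minimal_unitary_dilation_single J (tuple_prod n W) TT \<longrightarrow>
       minimal_unitary_dilation J n W T \<and>
       (\<forall>(J' :: 'h \<Rightarrow> 'l::chilbert_space) X.
          unitary_dilation J' n X T \<and>
          minimal_unitary_dilation_single J' (tuple_prod n X) TT \<longrightarrow>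
          (\<exists>\<rho> :: 'k \<Rightarrow> 'l. unitary UNIV UNIV \<rho> \<and>
             (\<forall>i\<in>{1..n}. X i = \<rho> \<circ> W i \<circ> adj UNIV UNIV \<rho>))))"
proof -
  have cT: "contraction TT"
    unfolding TT by (rule contraction_op_prod) (use contr in \<open>auto simp del: upt_Suc\<close>)
  then have md: "min_dilation J V TT" if "minimal_unitary_dilation_single J V TT"
    for J :: "'h \<Rightarrow> 'c::chilbert_space" and V
    using that by (simp add: min_dilation_def)
  have fdd: "factor_data_dilation J V TT n T P U"
    if "minimal_unitary_dilation_single J V TT" "factor_data n T TT D DT P U"
    for J :: "'h \<Rightarrow> 'k" and V P U
    using md[OF that(1)] that(2) TT comm contr D DT
    by (simp add: factor_data_dilation_def factor_data_dilation_axioms_def)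
  have a: "(\<exists>(J :: 'h \<Rightarrow> 'k) W. unitary_dilation J n W T \<and>
        minimal_unitary_dilation_single J (tuple_prod n W) TT) \<longleftrightarrow> (\<exists>!(P, U). factor_data n T TT D DT P U)"
    (is "?dil \<longleftrightarrow> ?data") if ex: "\<exists>(J :: 'h \<Rightarrow> 'k) V. minimal_unitary_dilation_single J V TT"
  proof
    assume ?dil
    then obtain J :: "'h \<Rightarrow> 'k" and W where W: "unitary_dilation J n W T"
      and min: "minimal_unitary_dilation_single J (tuple_prod n W) TT" by blast
    obtain P U where PU: "factor_data n T TT D DT P U"
      using factor_data_of_dilation[OF md[OF min] TT W refl comm] contr unfolding D DT by blast
    show ?data
    proof (rule ex1I[of _ "(P, U)"])
      show "case (P, U) of (P, U) \<Rightarrow> factor_data n T TT D DT P U" using PU by simp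
      fix z assume z: "case z of (P, U) \<Rightarrow> factor_data n T TT D DT P U"
      obtain P' U' where [simp]: "z = (P', U')" by (cases z)
      have "factor_data n T TT D DT P' U'" using z by simp
      from factor_data_unique[OF fdd[OF min this] fdd[OF min PU]] show "z = (P, U)" by simp
    qed
  next
    assume ?data
    then obtain P U where PU: "factor_data n T TT D DT P U" by auto
    obtain J :: "'h \<Rightarrow> 'k" and V where min: "minimal_unitary_dilation_single J V TT" using ex by blast
    interpret factor_data_dilation J V TT n T P U by (rule fdd[OF min PU])
    show ?dil
    proof (intro exI conjI)
      show "unitary_dilation J n W T" by (rule W_dilation)
      show "minimal_unitary_dilation_single J (tuple_prod n W) TT" using min by (simp only: W_prod)
    qed
  qed
  have b: "\<exists>\<rho> :: 'k \<Rightarrow> 'l. unitary UNIV UNIV \<rho> \<and> (\<forall>i\<in>{1..n}. X i = \<rho> \<circ> W i \<circ> adj UNIV UNIV \<rho>)"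
    if "unitary_dilation J n W T" "minimal_unitary_dilation_single J (tuple_prod n W) TT"
      "unitary_dilation J' n X T" "minimal_unitary_dilation_single J' (tuple_prod n X) TT"
    for J :: "'h \<Rightarrow> 'k" and W and J' :: "'h \<Rightarrow> 'l" and X
    by (rule dilation_unique[OF md[OF that(2), unfolded TT] md[OF that(4), unfolded TT] that(1) refl that(3) refl comm])
  show ?thesis
    unfolding factor_data_def[symmetric] using a b minimal_of_product_minimal by blast
qed

end
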